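(* Let $(V(u),\,u\in\mathcal T)$ be a branching random walk with reproduction point process $\aleph$ and intensity $\mu$ satisfying $\mu(\mathbb R)>1$. Suppose that (H1') or (H2) holds (defined in the context, with the associated $t^*>0$), that $\mu$ is supported on $\{\dots,-2,-1,0\}\cup\{1\}$, and that $$\mathbb E\Big[\sum_{|u|=|v|=1,\ u\ne v}e^{-t^*V(u)}e^{-t^*V(v)}\Big]<\infty .$$ For $\xi\in\partial\mathcal T$ and an integer $k\ge0$ let $N_\xi^k:=\sum_{n\ge0}\mathbf 1_{\{V(\xi_n)=k\}}$. (i) Under (H1'), $$\lim_{n\to\infty}\frac1n\sup_{\xi\in\partial\mathcal T}N_\xi^n=-\frac{t^*}{\log q},\qquad\mathbb P^*\text{-a.s.},$$ where $q:=\mathbb P(\sigma_1<\infty)\in(0,1)$. (ii) Under (H2), $$\lim_{n\to\infty}\frac1{n^2}\sup_{\xi\in\partial\mathcal T}N_\xi^n=\frac{t^*}{2\theta},\qquad\mathbb P^*\text{-a.s.},$$ where $\theta\in(0,\infty)$ is the constant such that $\mathbb P\bigl(\min_{0\le i\le\sigma_1}S_i\le-n\bigr)\sim\theta/n$ as $n\to\infty$. Here $(S_k)_{k\ge0}$ and $\sigma_1$ are the random walk and return time defined in the context.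
   Context: Branching random walk: $\aleph$ is a point process on $\mathbb R$. A single particle $\varnothing$ (the root) starts at $V(\varnothing)=0$ in generation $0$. Its children, together with their positions, form the point process $\aleph=\sum_{|u|=1}\delta_{V(u)}$. Recursively, each particle $u$ of generation $n$ gives birth in generation $n+1$ to children whose positions form an independent copy of $\aleph$ shifted by $V(u)$. $\mathcal T$ is the resulting genealogical (Ulam–Harris) tree, $|u|$ is the generation of $u$ and $V(u)\in\mathbb R$ its position. Let $\mu(\mathrm dx):=\mathbb E[\aleph(\mathrm dx)]$, and assume $\mu(\mathbb R)>1$ (supercriticality; $\mu(\mathbb R)=\infty$ is not excluded). Let $\mathcal S$ be the event that $\mathcal T$ is infinite (non-extinction) and $\mathbb P^*:=\mathbb P(\cdot\mid\mathcal S)$. Put $\varphi(t):=\log\int_{\mathbb R}e^{-tx}\mu(\mathrm dx)\in(-\infty,\infty]$ for $t\in\mathbb R$. A ray $\xi$ of $\mathcal T$ is either the finite shortest path from the root to a leaf of $\mathcal T$, or an infinite path $\xi=(\xi_0=\varnothing,\xi_1,\xi_2,\dots)$ with $\xi_n$ the parent of $\xi_{n+1}$ for all $n$. $\partial\mathcal T$ is the set of all rays (finite or infinite); for a finite ray, sums over $n$ run only over the vertices of the ray. The integral $\int_{\mathbb R}xe^{-t^*x}\mu(\mathrm dx)$ is called well-defined if at least one of $\int_{(-\infty,0)}|x|e^{-t^*x}\mu(\mathrm dx)$, $\int_{(0,\infty)}xe^{-t^*x}\mu(\mathrm dx)$ is finite. (H1'): there exists $t>0$ with $\varphi(t)=0$;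 $t^*$ denotes the minimal such $t$; the integral $\int_{\mathbb R}xe^{-t^*x}\mu(\mathrm dx)$ is well-defined and strictly positive; and $\mu((-\infty,0))>0$. (H2): there exists $t^*>0$ with $\varphi(t^* )=0$, and $\varphi(t)\in[0,\infty]$ for all $t>0$; the integral $\int_{\mathbb R}xe^{-t^*x}\mu(\mathrm dx)$ is well-defined and equal to $0$, and $\int_{\mathbb R}x^2e^{-t^*x}\mu(\mathrm dx)\in(0,\infty)$. Associated random walk: $(S_k)_{k\ge0}$ is the random walk with $S_0=0$ and i.i.d. steps of law $e^{-t^*x}\mu(\mathrm dx)$ (a probability measure since $\varphi(t^* )=0$), i.e. $\mathbb E[h(S_1)]=\mathbb E[\sum_{|u|=1}e^{-t^*V(u)}h(V(u))]$ for bounded Borel $h$. Let $\sigma_1:=\inf\{k\ge1:S_k=0\}$, with $\inf\emptyset=\infty$. Under (H2) and the support assumption, the limit $\theta=\lim_{n\to\infty}n\,\mathbb P(\min_{0\le i\le\sigma_1}S_i\le-n)$ exists in $(0,\infty)$. The notation $a_n\sim b_n$ means $a_n/b_n\to1$. *)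

theory Defs
  imports "HOL-Probability.Probability"
begin

text \<open>
  Particles carry Ulam--Harris labels: the root is \<^term>\<open>[]\<close> and the \<open>i\<close>-th child of \<open>u\<close> (counting
  from \<open>0\<close>) is \<open>u @ [i]\<close>. The potential particle \<open>u\<close> has \<open>N u\<close> children (possibly infinitely many),
  displaced from it by \<open>X u i\<close> for \<open>i < N u\<close>. The displacements \<open>X u i\<close> with \<open>i \<ge> N u\<close> never enter.
  Independent copies of the point process are rendered by i.i.d. enumerations of its atoms; the law
  of the enumeration is arbitrary.
\<close>

locale branching_random_walk = prob_space M
  for M :: "'a measure" and N :: "nat list \<Rightarrow> 'a \<Rightarrow> enat" and X :: "nat list \<Rightarrow> nat \<Rightarrow> 'a \<Rightarrow> real" +
  assumes indep_reproduction:
      "indep_vars (\<lambda>_. count_space UNIV \<Otimes>\<^sub>M (\<Pi>\<^sub>M i\<in>UNIV. borel))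
         (\<lambda>u \<omega>. (N u \<omega>, \<lambda>i. X u i \<omega>)) UNIV"
    and reproduction_law:
      "distr M (count_space UNIV \<Otimes>\<^sub>M (\<Pi>\<^sub>M i\<in>UNIV. borel)) (\<lambda>\<omega>. (N u \<omega>, \<lambda>i. X u i \<omega>)) =
       distr M (count_space UNIV \<Otimes>\<^sub>M (\<Pi>\<^sub>M i\<in>UNIV. borel)) (\<lambda>\<omega>. (N [] \<omega>, \<lambda>i. X [] i \<omega>))"

definition tree :: "(nat list \<Rightarrow> 'a \<Rightarrow> enat) \<Rightarrow> 'a \<Rightarrow> nat list set" where
  "tree N \<omega> = {u. \<forall>k<length u. enat (u ! k) < N (take k u) \<omega>}"

definition generation :: "(nat list \<Rightarrow> 'a \<Rightarrow> enat) \<Rightarrow> 'a \<Rightarrow> nat \<Rightarrow> nat list set" where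
  "generation N \<omega> n = {u \<in> tree N \<omega>. length u = n}"

definition position :: "(nat list \<Rightarrow> nat \<Rightarrow> 'a \<Rightarrow> real) \<Rightarrow> 'a \<Rightarrow> nat list \<Rightarrow> real" where
  "position X \<omega> u = (\<Sum>k<length u. X (take k u) (u ! k) \<omega>)"

text \<open>The point process \<open>\<Sum>\<^bsub>|u|=1\<^esub> \<delta>\<^bsub>V(u)\<^esub>\<close>, as a counting measure with multiplicities.\<close>

definition reproduction_process ::
    "(nat list \<Rightarrow> 'a \<Rightarrow> enat) \<Rightarrow> (nat list \<Rightarrow> nat \<Rightarrow> 'a \<Rightarrow> real) \<Rightarrow> 'a \<Rightarrow> real measure" where
  "reproduction_process N X \<omega> = distr (count_space (generation N \<omega> 1)) borel (position X \<omega>)"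

definition intensity ::
    "'a measure \<Rightarrow> (nat list \<Rightarrow> 'a \<Rightarrow> enat) \<Rightarrow> (nat list \<Rightarrow> nat \<Rightarrow> 'a \<Rightarrow> real) \<Rightarrow> real measure" where
  "intensity M N X =
     measure_of UNIV (sets borel) (\<lambda>A. \<integral>\<^sup>+\<omega>. emeasure (reproduction_process N X \<omega>) A \<partial>M)"

definition survival :: "'a measure \<Rightarrow> (nat list \<Rightarrow> 'a \<Rightarrow> enat) \<Rightarrow> 'a set" where
  "survival M N = {\<omega> \<in> space M. infinite (tree N \<omega>)}"

lemma generation_1: "generation N \<omega> 1 = (\<lambda>i. [i]) ` {i. enat i < N [] \<omega>}"
  by (auto simp: generation_def tree_def length_Suc_conv)

lemma emeasure_reproduction_process:
  assumes "A \<in> sets borel"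
  shows "emeasure (reproduction_process N X \<omega>) A =
    (\<Sum>i. if enat i < N [] \<omega> \<and> X [] i \<omega> \<in> A then 1 else 0)"
proof -
  have "emeasure (reproduction_process N X \<omega>) A =
      emeasure (count_space (generation N \<omega> 1)) (position X \<omega> -` A \<inter> generation N \<omega> 1)"
    using assms by (simp add: reproduction_process_def emeasure_distr)
  also have "\<dots> = emeasure (count_space UNIV) (position X \<omega> -` A \<inter> generation N \<omega> 1)"
    by (simp add: emeasure_count_space)
  also have "position X \<omega> -` A \<inter> generation N \<omega> 1 =
      (\<lambda>i. [i]) ` {i. enat i < N [] \<omega> \<and> X [] i \<omega> \<in> A}"
    unfolding generation_1 by (auto simp: position_def)
  also have "emeasure (count_space UNIV) \<dots> =
      emeasure (count_space UNIV) {i. enat i < N [] \<omega> \<and> X [] i \<omega> \<in> A}"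
    by (simp add: emeasure_count_space finite_image_iff card_image inj_on_def)
  also have "\<dots> = (\<integral>\<^sup>+i. indicator {i. enat i < N [] \<omega> \<and> X [] i \<omega> \<in> A} i \<partial>count_space UNIV)"
    by simp
  also have "\<dots> = (\<Sum>i. indicator {i. enat i < N [] \<omega> \<and> X [] i \<omega> \<in> A} i)"
    by (rule nn_integral_count_space_nat)
  finally show ?thesis by (simp add: indicator_def of_bool_def)
qed

lemma (in branching_random_walk) emeasure_intensity:
  assumes A: "A \<in> sets borel"
  shows "emeasure (intensity M N X) A = (\<integral>\<^sup>+\<omega>. emeasure (reproduction_process N X \<omega>) A \<partial>M)"
proof -
  have m: "(\<lambda>\<omega>. (N [] \<omega>, \<lambda>i. X [] i \<omega>)) \<in> M \<rightarrow>\<^sub>M count_space UNIV \<Otimes>\<^sub>M (\<Pi>\<^sub>M i\<in>UNIV. borel)"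
    using indep_reproduction by (auto simp: indep_vars_def)
  have [measurable]: "N [] \<in> M \<rightarrow>\<^sub>M count_space UNIV"
    using measurable_compose[OF m measurable_fst] by simp
  have [measurable]: "X [] i \<in> borel_measurable M" for i
    using measurable_compose[OF measurable_compose[OF m measurable_snd]
        measurable_component_singleton[of i UNIV "\<lambda>_. borel"]] by simp
  have meas: "(\<lambda>\<omega>. emeasure (reproduction_process N X \<omega>) B) \<in> borel_measurable M"
    if [measurable]: "B \<in> sets borel" for B
    using that by (simp add: emeasure_reproduction_process)
  have sa: "sigma_algebra (UNIV::real set) (sets borel)"
    using sets.sigma_algebra_axioms[of "borel :: real measure"] by simp
  show ?thesis
  proof (rule emeasure_measure_of[OF intensity_def])
    show "positive (sets (intensity M N X))
       (\<lambda>A. \<integral>\<^sup>+\<omega>. emeasure (reproduction_process N X \<omega>) A \<partial>M)"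
      by (simp add: positive_def)
    show "countably_additive (sets (intensity M N X))
       (\<lambda>A. \<integral>\<^sup>+\<omega>. emeasure (reproduction_process N X \<omega>) A \<partial>M)"
    proof (rule countably_additiveI)
      fix F :: "nat \<Rightarrow> real set"
      assume "range F \<subseteq> sets (intensity M N X)" and d: "disjoint_family F"
      then have F: "range F \<subseteq> sets borel"
        by (simp add: intensity_def sigma_algebra.sigma_sets_eq[OF sa])
      then have "(\<Sum>n. \<integral>\<^sup>+\<omega>. emeasure (reproduction_process N X \<omega>) (F n) \<partial>M) =
          (\<integral>\<^sup>+\<omega>. (\<Sum>n. emeasure (reproduction_process N X \<omega>) (F n)) \<partial>M)"
        by (intro nn_integral_suminf[symmetric] meas) auto
      also have "\<dots> = (\<integral>\<^sup>+\<omega>. emeasure (reproduction_process N X \<omega>) (\<Union>n. F n) \<partial>M)"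
        using F d by (simp add: suminf_emeasure reproduction_process_def)
      finally show "(\<Sum>n. \<integral>\<^sup>+\<omega>. emeasure (reproduction_process N X \<omega>) (F n) \<partial>M) =
          (\<integral>\<^sup>+\<omega>. emeasure (reproduction_process N X \<omega>) (\<Union>n. F n) \<partial>M)" .
    qed
  qed (use A in \<open>auto simp: intensity_def sigma_algebra.sigma_sets_eq[OF sa]\<close>)
qed

definition is_leaf :: "nat list set \<Rightarrow> nat list \<Rightarrow> bool" where
  "is_leaf T u \<longleftrightarrow> u \<in> T \<and> (\<forall>i. u @ [i] \<notin> T)"

text \<open>
  A ray is the sequence of its vertices, padded with \<^term>\<open>None\<close> behind the leaf if it is finite.
\<close>

definition rays :: "nat list set \<Rightarrow> (nat \<Rightarrow> nat list option) set" where
  "rays T = {\<xi>. \<xi> 0 = Some [] \<and>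
     (\<forall>n. case \<xi> n of
        None \<Rightarrow> \<xi> (Suc n) = None
      | Some u \<Rightarrow> if is_leaf T u then \<xi> (Suc n) = None
                  else (\<exists>i. u @ [i] \<in> T \<and> \<xi> (Suc n) = Some (u @ [i])))}"

definition visits :: "(nat list \<Rightarrow> real) \<Rightarrow> (nat \<Rightarrow> nat list option) \<Rightarrow> nat \<Rightarrow> ereal" where
  "visits V \<xi> k = (\<Sum>n. case \<xi> n of None \<Rightarrow> 0 | Some u \<Rightarrow> if V u = real k then 1 else 0)"

definition log_laplace :: "real measure \<Rightarrow> real \<Rightarrow> ereal" where
  "log_laplace \<mu> t =
     (let I = \<integral>\<^sup>+x. ennreal (exp (- t * x)) \<partial>\<mu> in
      if I = \<infinity> then \<infinity> else if I = 0 then -\<infinity> else ereal (ln (enn2real I)))"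

definition tilted_mean_pos :: "real measure \<Rightarrow> real \<Rightarrow> ennreal" where
  "tilted_mean_pos \<mu> t = (\<integral>\<^sup>+x\<in>{0<..}. ennreal (x * exp (- t * x)) \<partial>\<mu>)"

definition tilted_mean_neg :: "real measure \<Rightarrow> real \<Rightarrow> ennreal" where
  "tilted_mean_neg \<mu> t = (\<integral>\<^sup>+x\<in>{..<0}. ennreal (\<bar>x\<bar> * exp (- t * x)) \<partial>\<mu>)"

definition tilted_mean_well_defined :: "real measure \<Rightarrow> real \<Rightarrow> bool" where
  "tilted_mean_well_defined \<mu> t \<longleftrightarrow> tilted_mean_neg \<mu> t < \<infinity> \<or> tilted_mean_pos \<mu> t < \<infinity>"

text \<open>The extended-real value of \<open>\<integral> x e\<^bsup>-tx\<^esup> \<mu>(dx)\<close>; meaningful only when it is well-defined.\<close>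

definition tilted_mean :: "real measure \<Rightarrow> real \<Rightarrow> ereal" where
  "tilted_mean \<mu> t = enn2ereal (tilted_mean_pos \<mu> t) - enn2ereal (tilted_mean_neg \<mu> t)"

definition H1' :: "real measure \<Rightarrow> real \<Rightarrow> bool" where
  "H1' \<mu> t \<longleftrightarrow>
     t > 0 \<and> log_laplace \<mu> t = 0 \<and> (\<forall>s>0. log_laplace \<mu> s = 0 \<longrightarrow> t \<le> s) \<and>
     tilted_mean_well_defined \<mu> t \<and> tilted_mean \<mu> t > 0 \<and>
     emeasure \<mu> {..<0} > 0"

definition H2 :: "real measure \<Rightarrow> real \<Rightarrow> bool" where
  "H2 \<mu> t \<longleftrightarrow>
     t > 0 \<and> log_laplace \<mu> t = 0 \<and> (\<forall>s>0. log_laplace \<mu> s \<ge> 0) \<and>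
     tilted_mean_well_defined \<mu> t \<and> tilted_mean \<mu> t = 0 \<and>
     0 < (\<integral>\<^sup>+x. ennreal (x\<^sup>2 * exp (- t * x)) \<partial>\<mu>) \<and>
     (\<integral>\<^sup>+x. ennreal (x\<^sup>2 * exp (- t * x)) \<partial>\<mu>) < \<infinity>"

locale random_walk = prob_space P
  for P :: "'b measure" and \<nu> :: "real measure" and S :: "nat \<Rightarrow> 'b \<Rightarrow> real" +
  assumes start: "\<omega> \<in> space P \<Longrightarrow> S 0 \<omega> = 0"
    and indep_steps: "indep_vars (\<lambda>_. borel) (\<lambda>k \<omega>. S (Suc k) \<omega> - S k \<omega>) UNIV"
    and step_law: "distr P borel (\<lambda>\<omega>. S (Suc k) \<omega> - S k \<omega>) = \<nu>"

definition tilted_law :: "real measure \<Rightarrow> real \<Rightarrow> real measure" where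
  "tilted_law \<mu> t = density \<mu> (\<lambda>x. ennreal (exp (- t * x)))"

definition return_time :: "(nat \<Rightarrow> 'b \<Rightarrow> real) \<Rightarrow> 'b \<Rightarrow> enat" where
  "return_time S \<omega> = (INF k\<in>{k. 1 \<le> k \<and> S k \<omega> = 0}. enat k)"

definition excursion_min :: "(nat \<Rightarrow> 'b \<Rightarrow> real) \<Rightarrow> 'b \<Rightarrow> ereal" where
  "excursion_min S \<omega> = (INF i\<in>{i. enat i \<le> return_time S \<omega>}. ereal (S i \<omega>))"

end

theory Submission
  imports Defs "HOL-Real_Asymp.Real_Asymp"
begin

text \<open>
  Since upward steps equal \<open>1\<close>, the particles that are the first of their line at level \<open>n\<close> form a
  Galton--Watson process in \<open>n\<close> with mean \<open>e\<^bsup>t\<^esup>\<close>, and the number of visits to level \<open>n\<close> below each of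
  them is governed by the process of successive returns to the starting level. If \<open>p\<^sub>m\<close> is the
  probability that the latter survives \<open>m\<close> generations, the supremum is the largest \<open>m\<close> with
  \<open>p\<^sub>m \<ge> e\<^bsup>-tn\<^esup>\<close>, approximately. Both processes are encoded by iterates of the monotone
  operator \<open>T g x = E (\<Prod>\<^bsub>|u|=1\<^esub> g (x + V u))\<close>.

  Linearising \<open>T\<close> (many-to-one) compares \<open>p\<^sub>m\<close> with harmonic functions of the associated walk, which
  are explicit: the renewal function \<open>U\<close> of the weights \<open>P(step \<le> -j) / P(step = 1)\<close> is harmonic on the
  positive integers, and \<open>(U(x + L) - U x) / U L\<close> is the probability of hitting \<open>0\<close> before \<open>-L\<close>.
  This gives \<open>q\<close> and \<open>\<theta>\<close> (through the elementary renewal theorem). In the first case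
  \<open>p\<^bsub>m+1\<^esub> / p\<^sub>m\<close> tends to \<open>q\<close>. In the second one a particle at \<open>-L\<close> with \<open>tL = -ln p\<close> has about \<open>1/p\<close>
  descendants at \<open>0\<close>, so that the loss per generation is \<open>1 - p\<^bsub>m+1\<^esub> / p\<^sub>m \<approx> \<theta> t / (-ln p\<^sub>m)\<close>,
  whence \<open>(ln p\<^sub>m)\<^sup>2 \<approx> 2 \<theta> t m\<close>.
\<close>

section \<open>Renewal functions and skip-free walks\<close>

text \<open>Three points shape the work. A particle may have infinitely many children, so generating
  functions are handled as expectations of infinite products: convexity comes from an inequality for
  ordered families, and limits of the operator are taken along decreasing sequences. The pair
  condition bounds the gap between \<open>T\<close> and its linearisation by a term of order p^2 exp
  (-t x), which blows up to the left; comparisons are therefore made on a finite window, where an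
  explicit barrier absorbs this error, and the window is tuned to p. Finally, a lower bound on
  survival needs more than a large expectation. The bad event is that level n is visited, but by no
  line more than m times; its probability is the difference of the n-th iterates of
  \<open>phi\<close> at 1 and at the probability of m returns. Concavity makes it summable: a start
  above exp (-(t - e) n) grows by a factor near exp t per level up to constant size, and the
  remaining levels contract geometrically. That survival forces visits to all levels follows by
  comparing the probability of an unvisited level with that of extinction through strict
  convexity.\<close>

fun renewal :: "(nat \<Rightarrow> real) \<Rightarrow> nat \<Rightarrow> real" where
  "renewal \<beta> 0 = 0"
| "renewal \<beta> (Suc n) = 1 + (\<Sum>j<n. \<beta> (Suc j) * renewal \<beta> (n - j))"

declare renewal.simps(2) [simp del]

lemma renewal_1 [simp]: "renewal \<beta> (Suc 0) = 1"
  by (simp add: renewal.simps)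

lemma renewal_nonneg:
  assumes "\<And>j. 0 \<le> \<beta> j"
  shows "0 \<le> renewal \<beta> n"
proof (induction n rule: less_induct)
  case (less n)
  then show ?case
    by (cases n) (auto simp: renewal.simps assms intro!: add_nonneg_nonneg sum_nonneg mult_nonneg_nonneg)
qed

lemma renewal_Suc_mono:
  assumes \<beta>: "\<And>j. 0 \<le> \<beta> j"
  shows "renewal \<beta> n \<le> renewal \<beta> (Suc n)"
proof (induction n rule: less_induct)
  case (less n)
  show ?case
  proof (cases n)
    case (Suc n')
    have "(\<Sum>j<n'. \<beta> (Suc j) * renewal \<beta> (n' - j)) \<le> (\<Sum>j<n'. \<beta> (Suc j) * renewal \<beta> (n - j))"
    proof (rule sum_mono)
      fix j assume "j \<in> {..<n'}"
      then have "n - j = Suc (n' - j)" "n' - j < n" using Suc by auto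
      then show "\<beta> (Suc j) * renewal \<beta> (n' - j) \<le> \<beta> (Suc j) * renewal \<beta> (n - j)"
        using less[of "n' - j"] \<beta> by (simp add: mult_left_mono)
    qed
    also have "\<dots> \<le> (\<Sum>j<n. \<beta> (Suc j) * renewal \<beta> (n - j))"
      using Suc \<beta> renewal_nonneg[of \<beta>, OF \<beta>] by (simp add: mult_nonneg_nonneg)
    finally show ?thesis using Suc by (simp add: renewal.simps)
  qed simp
qed

lemma renewal_mono:
  assumes "\<And>j. 0 \<le> \<beta> j"
  shows "m \<le> n \<Longrightarrow> renewal \<beta> m \<le> renewal \<beta> n"
  using lift_Suc_mono_le[of "renewal \<beta>", OF renewal_Suc_mono[of \<beta>, OF assms]] by blast

lemma renewal_pos:
  assumes "\<And>j. 0 \<le> \<beta> j" "0 < n"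
  shows "1 \<le> renewal \<beta> n"
  using renewal_mono[of \<beta> 1 n, OF assms(1)] assms(2) by simp

text \<open>\<open>renewal \<beta> n\<close> is the expected number of renewal epochs in [0, n), the
  one at 0 included, for the possibly defective step law \<beta> on the positive integers. An
  interval of length L, seen from its first epoch, contains on average at most as many epochs as [0,
  L); conditioning on the first step turns this into an induction.\<close>

lemma renewal_subadditive:
  assumes \<beta>: "\<And>j. 0 \<le> \<beta> j" and s: "\<And>n. (\<Sum>j<n. \<beta> (Suc j)) \<le> 1"
  shows "renewal \<beta> (n + L) \<le> renewal \<beta> n + renewal \<beta> L"
proof (induction n rule: less_induct)
  case (less n)
  show ?case
  proof (cases n)
    case (Suc n')
    have nn: "0 \<le> renewal \<beta> k" for k by (rule renewal_nonneg[OF \<beta>])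
    have "(\<Sum>j<n' + L. \<beta> (Suc j) * renewal \<beta> (n' + L - j))
        \<le> (\<Sum>j<n' + L. \<beta> (Suc j) * (renewal \<beta> (n' - j) + renewal \<beta> L))"
    proof (rule sum_mono)
      fix j assume "j \<in> {..<n' + L}"
      have "renewal \<beta> (n' + L - j) \<le> renewal \<beta> (n' - j) + renewal \<beta> L"
      proof (cases "j \<le> n'")
        case True
        then show ?thesis using less[of "n' - j"] Suc by simp
      next
        case False
        then show ?thesis using renewal_mono[of \<beta> "n' + L - j" L, OF \<beta>] by simp
      qed
      then show "\<beta> (Suc j) * renewal \<beta> (n' + L - j) \<le> \<beta> (Suc j) * (renewal \<beta> (n' - j) + renewal \<beta> L)"
        using \<beta> by (simp add: mult_left_mono)
    qed
    also have "\<dots> = (\<Sum>j<n' + L. \<beta> (Suc j) * renewal \<beta> (n' - j)) + (\<Sum>j<n' + L. \<beta> (Suc j)) * renewal \<beta> L"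
      by (simp add: algebra_simps sum.distrib sum_distrib_left)
    also have "(\<Sum>j<n' + L. \<beta> (Suc j) * renewal \<beta> (n' - j)) = (\<Sum>j<n'. \<beta> (Suc j) * renewal \<beta> (n' - j))"
      by (rule sum.mono_neutral_right) auto
    also have "(\<Sum>j<n' + L. \<beta> (Suc j)) * renewal \<beta> L \<le> 1 * renewal \<beta> L"
      using s nn by (intro mult_right_mono) auto
    finally show ?thesis using Suc by (simp add: renewal.simps)
  qed simp
qed

text \<open>Wald's inequality for steps truncated at A: c is the truncated mean, and the last step
  overshoots by at most A. In terms of the recursion, (n + A) / c is a supersolution.\<close>

lemma renewal_upper:
  assumes \<beta>: "\<And>j. 0 \<le> \<beta> j" and s: "\<And>n. (\<Sum>j<n. \<beta> (Suc j)) \<le> 1"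
    and c: "c = (\<Sum>j<A. real (Suc j) * \<beta> (Suc j))" "c > 0"
  shows "renewal \<beta> n \<le> (real n + real A) / c"
proof (induction n rule: less_induct)
  case (less n)
  show ?case
  proof (cases n)
    case 0
    then show ?thesis using c by simp
  next
    case (Suc n')
    let ?m = "max n' A"
    have "(\<Sum>j<n'. \<beta> (Suc j) * renewal \<beta> (n' - j)) \<le> (\<Sum>j<n'. \<beta> (Suc j) * ((real n + real A - real (Suc j)) / c))"
    proof (intro sum_mono mult_left_mono \<beta>)
      fix j assume "j \<in> {..<n'}"
      then have "real (n' - j) + real A = real n + real A - real (Suc j)" "n' - j < n" using Suc by auto
      then show "renewal \<beta> (n' - j) \<le> (real n + real A - real (Suc j)) / c"
        using less[of "n' - j"] by metis
    qed
    \<comment> \<open>The sum may be prolonged up to A because n + A - (j + 1) stays nonnegative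
      there; this makes the whole truncated mean available.\<close>
    also have "\<dots> \<le> (\<Sum>j<?m. \<beta> (Suc j) * ((real n + real A - real (Suc j)) / c))"
    proof (rule sum_mono2)
      fix j assume "j \<in> {..<?m} - {..<n'}"
      then have "j < A" by auto
      then show "0 \<le> \<beta> (Suc j) * ((real n + real A - real (Suc j)) / c)"
        using \<beta> c by (intro mult_nonneg_nonneg divide_nonneg_nonneg) auto
    qed auto
    also have "\<dots> = ((\<Sum>j<?m. \<beta> (Suc j)) * (real n + real A) - (\<Sum>j<?m. real (Suc j) * \<beta> (Suc j))) / c"
      by (simp only: sum_divide_distrib[symmetric] sum_subtractf sum_distrib_right[symmetric]
          times_divide_eq_right right_diff_distrib mult.commute[of "real (Suc _)"])
    also have "\<dots> \<le> ((real n + real A) - c) / c"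
    proof (intro divide_right_mono diff_mono)
      show "(\<Sum>j<?m. \<beta> (Suc j)) * (real n + real A) \<le> real n + real A"
        using mult_right_mono[OF s[of ?m], of "real n + real A"] by simp
      show "c \<le> (\<Sum>j<?m. real (Suc j) * \<beta> (Suc j))"
        unfolding c by (rule sum_mono2) (auto intro!: mult_nonneg_nonneg \<beta>)
    qed (use c in auto)
    finally have "renewal \<beta> n \<le> 1 + ((real n + real A) - c) / c"
      using Suc by (simp add: renewal.simps)
    then show ?thesis using c by (simp add: field_simps)
  qed
qed

text \<open>Wald's identity with the nonnegative overshoot dropped: n / m is a subsolution of the
  recursion. The sum over all steps evaluates to (n - m) / m, and the steps of size at least n
  contribute nonpositive terms to it.\<close>

lemma renewal_lower:
  assumes \<beta>: "\<And>j. 0 \<le> \<beta> j" and s: "(\<lambda>j. \<beta> (Suc j)) sums 1"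
    and m: "(\<lambda>j. real (Suc j) * \<beta> (Suc j)) sums m" "m > 0"
  shows "real n / m \<le> renewal \<beta> n"
proof (induction n rule: less_induct)
  case (less n)
  show ?case
  proof (cases n)
    case (Suc n')
    have "(\<lambda>j. (real n * \<beta> (Suc j) - real (Suc j) * \<beta> (Suc j)) / m) sums ((real n * 1 - m) / m)"
      by (intro sums_divide sums_diff sums_mult s m)
    then have "(real n - m) / m = (\<Sum>j. (real n * \<beta> (Suc j) - real (Suc j) * \<beta> (Suc j)) / m)"
      by (simp add: sums_iff)
    also have "\<dots> \<le> (\<Sum>j. if j < n' then \<beta> (Suc j) * renewal \<beta> (n' - j) else 0)"
    proof (rule suminf_le)
      fix j
      show "(real n * \<beta> (Suc j) - real (Suc j) * \<beta> (Suc j)) / m \<le> (if j < n' then \<beta> (Suc j) * renewal \<beta> (n' - j) else 0)"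
      proof (cases "j < n'")
        case True
        have "(real n * \<beta> (Suc j) - real (Suc j) * \<beta> (Suc j)) / m = \<beta> (Suc j) * (real (n' - j) / m)"
          using True Suc by (simp add: of_nat_diff algebra_simps)
        also have "\<dots> \<le> \<beta> (Suc j) * renewal \<beta> (n' - j)"
          using less[of "n' - j"] Suc by (intro mult_left_mono \<beta>) auto
        finally show ?thesis using True by simp
      next
        case False
        have "real n * \<beta> (Suc j) \<le> real (Suc j) * \<beta> (Suc j)"
          using False Suc by (intro mult_right_mono \<beta>) auto
        then show ?thesis using False m by (simp add: divide_nonpos_pos)
      qed
      show "summable (\<lambda>j. (real n * \<beta> (Suc j) - real (Suc j) * \<beta> (Suc j)) / m)"
        using m s by (intro summable_divide summable_diff summable_mult) (auto simp: sums_iff)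
      show "summable (\<lambda>j. if j < n' then \<beta> (Suc j) * renewal \<beta> (n' - j) else 0)"
        by (rule summable_finite[of "{..<n'}"]) auto
    qed
    also have "\<dots> = (\<Sum>j<n'. \<beta> (Suc j) * renewal \<beta> (n' - j))"
      by (subst suminf_finite[of "{..<n'}"]) auto
    finally have "1 + (real n - m) / m \<le> renewal \<beta> n" using Suc by (simp add: renewal.simps)
    then show ?thesis using m by (simp add: field_simps)
  qed simp
qed

text \<open>The lower bound for the renewal function already has the right slope. The upper one
  attains it as the truncation level A grows, at the cost of an additive constant that is negligible
  against n.\<close>

lemma elementary_renewal:
  assumes \<beta>: "\<And>j. 0 \<le> \<beta> j" and s: "(\<lambda>j. \<beta> (Suc j)) sums 1"
    and m: "(\<lambda>j. real (Suc j) * \<beta> (Suc j)) sums m" "m > 0"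
  shows "(\<lambda>n. real n / renewal \<beta> n) \<longlonglongrightarrow> m"
proof (rule order_tendstoI)
  fix a assume "m < a"
  have "real n / renewal \<beta> n \<le> m" if "n > 0" for n
    using renewal_lower[OF \<beta> s m, of n] renewal_pos[of \<beta> n, OF \<beta> that] m by (simp add: field_simps)
  then show "\<forall>\<^sub>F n in sequentially. real n / renewal \<beta> n < a"
    using \<open>m < a\<close> by (intro eventually_sequentiallyI[of 1]) (meson dual_order.strict_trans2 dual_order.strict_trans1 less_le_trans zero_less_one)
next
  fix a assume "a < m"
  have part: "(\<Sum>j<n. \<beta> (Suc j)) \<le> 1" for n
    using sum_le_suminf[of "\<lambda>j. \<beta> (Suc j)" "{..<n}"] s \<beta> by (auto simp: sums_iff)
  \<comment> \<open>The maximum with m / 2 keeps the truncated mean positive, as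
    \<open>renewal_upper\<close> demands, even if a is negative.\<close>
  define a' where "a' = max a (m / 2)"
  have a': "a' < m" "0 < a'" "a \<le> a'" using \<open>a < m\<close> m by (auto simp: a'_def)
  have "\<forall>\<^sub>F A in sequentially. a' < (\<Sum>j<A. real (Suc j) * \<beta> (Suc j))"
    using m(1) a' order_tendstoD(1) unfolding sums_def by blast
  then obtain A where A: "a' < (\<Sum>j<A. real (Suc j) * \<beta> (Suc j))"
    unfolding eventually_sequentially by auto
  define c where "c = (\<Sum>j<A. real (Suc j) * \<beta> (Suc j))"
  have c: "a' < c" using A by (simp add: c_def)
  have "(\<lambda>n. c * (real n / (real n + real A))) \<longlonglongrightarrow> c * 1"
    by (intro tendsto_intros) real_asymp
  then have "\<forall>\<^sub>F n in sequentially. a' < c * (real n / (real n + real A))"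
    using c order_tendstoD(1) by fastforce
  then show "\<forall>\<^sub>F n in sequentially. a < real n / renewal \<beta> n"
    using eventually_gt_at_top[of 0]
  proof eventually_elim
    case (elim n)
    have "renewal \<beta> n \<le> (real n + real A) / c"
      by (rule renewal_upper[OF \<beta> part c_def]) (use a' c in auto)
    then have "real n / ((real n + real A) / c) \<le> real n / renewal \<beta> n"
      using renewal_pos[of \<beta> n, OF \<beta> elim(2)] elim(2) c a'
      by (intro divide_left_mono) (auto intro!: mult_pos_pos divide_pos_pos)
    then have "c * (real n / (real n + real A)) \<le> real n / renewal \<beta> n"
      by (simp add: mult.commute)
    then show ?case using elim(1) a' by linarith
  qed
qed


section \<open>Skip-free walks: transition operator, maximum principle, barrier\<close>

locale skip_free_walk =
  fixes D :: "nat pmf"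
  assumes up: "0 < pmf D 0"
    and integrable_D: "integrable (measure_pmf D) real"
    and drift: "measure_pmf.expectation D real \<le> 1"
begin

text \<open>The steps are 1 - k with k of law \<open>D\<close>, so \<open>pmf D 0\<close> is the
  probability of an upward step and \<open>drift\<close> says that the mean step is
  nonnegative.\<close>

definition Q :: "(int \<Rightarrow> real) \<Rightarrow> int \<Rightarrow> real" where
  "Q g x = measure_pmf.expectation D (\<lambda>k. g (x + 1 - int k))"

text \<open>\<open>Q\<close> at x looks only at points up to x + 1, while functions such as
  \<open>U\<close> may grow to the right. Boundedness on left half-lines is thus the natural
  integrability condition.\<close>

definition left_bounded :: "(int \<Rightarrow> real) \<Rightarrow> bool" where
  "left_bounded g \<longleftrightarrow> (\<forall>x. \<exists>B. \<forall>y\<le>x. \<bar>g y\<bar> \<le> B)"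

lemma left_boundedI: "(\<And>x. \<bar>g x\<bar> \<le> B) \<Longrightarrow> left_bounded g"
  unfolding left_bounded_def by blast

lemma left_bounded_const: "left_bounded (\<lambda>x. c)"
  by (rule left_boundedI[of _ "\<bar>c\<bar>"]) simp

lemma left_bounded_diff:
  assumes "left_bounded f" "left_bounded g" shows "left_bounded (\<lambda>x. f x - g x)"
  unfolding left_bounded_def
proof
  fix x
  obtain A B where "\<forall>y\<le>x. \<bar>f y\<bar> \<le> A" "\<forall>y\<le>x. \<bar>g y\<bar> \<le> B"
    using assms unfolding left_bounded_def by meson
  then have "\<forall>y\<le>x. \<bar>f y - g y\<bar> \<le> A + B" by (smt (verit))
  then show "\<exists>B. \<forall>y\<le>x. \<bar>f y - g y\<bar> \<le> B" by blast
qed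

lemma left_bounded_add:
  assumes "left_bounded f" "left_bounded g" shows "left_bounded (\<lambda>x. f x + g x)"
  using left_bounded_diff[OF assms(1) left_bounded_diff[OF left_bounded_const[of 0] assms(2)]] by simp

lemma left_bounded_cmult:
  assumes "left_bounded f" shows "left_bounded (\<lambda>x. c * f x)"
  unfolding left_bounded_def
proof
  fix x
  obtain A where "\<forall>y\<le>x. \<bar>f y\<bar> \<le> A" using assms unfolding left_bounded_def by meson
  then have "\<forall>y\<le>x. \<bar>c * f y\<bar> \<le> \<bar>c\<bar> * A" by (simp add: abs_mult mult_left_mono)
  then show "\<exists>B. \<forall>y\<le>x. \<bar>c * f y\<bar> \<le> B" by blast
qed

lemmas left_bounded_intros = left_bounded_const left_bounded_diff left_bounded_add left_bounded_cmult

lemma Q_integrable: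
  assumes "left_bounded g" shows "integrable (measure_pmf D) (\<lambda>k. g (x + 1 - int k))"
proof -
  obtain B where "\<forall>y\<le>x + 1. \<bar>g y\<bar> \<le> B" using assms unfolding left_bounded_def by meson
  then show ?thesis by (intro measure_pmf.integrable_const_bound[where B = B]) auto
qed

lemma Q_mono:
  assumes "left_bounded f" "left_bounded g" "\<And>y. y \<le> x + 1 \<Longrightarrow> f y \<le> g y"
  shows "Q f x \<le> Q g x"
  unfolding Q_def using assms by (intro integral_mono Q_integrable) auto

lemma Q_cong: "(\<And>y. y \<le> x + 1 \<Longrightarrow> f y = g y) \<Longrightarrow> Q f x = Q g x"
  unfolding Q_def by (intro Bochner_Integration.integral_cong) auto

lemma Q_diff: "left_bounded f \<Longrightarrow> left_bounded g \<Longrightarrow> Q (\<lambda>x. f x - g x) x = Q f x - Q g x"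
  unfolding Q_def by (intro Bochner_Integration.integral_diff Q_integrable)

lemma Q_add: "left_bounded f \<Longrightarrow> left_bounded g \<Longrightarrow> Q (\<lambda>x. f x + g x) x = Q f x + Q g x"
  unfolding Q_def by (intro Bochner_Integration.integral_add Q_integrable)

lemma Q_cmult: "Q (\<lambda>x. c * f x) x = c * Q f x"
  unfolding Q_def by simp

lemma Q_const [simp]: "Q (\<lambda>x. c) x = c"
  unfolding Q_def by simp

lemma Q_nonneg: "(\<And>y. y \<le> x + 1 \<Longrightarrow> 0 \<le> g y) \<Longrightarrow> 0 \<le> Q g x"
  unfolding Q_def by (intro integral_nonneg_AE) auto

lemma Q_tendsto:
  assumes "\<And>n y. \<bar>f n y\<bar> \<le> B" "\<And>y. (\<lambda>n. f n y) \<longlonglongrightarrow> g y"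
  shows "(\<lambda>n. Q (f n) x) \<longlonglongrightarrow> Q g x"
  unfolding Q_def by (rule integral_dominated_convergence[where w = "\<lambda>_. B"]) (use assms in auto)

text \<open>
  At the rightmost maximum the walk moves, with positive probability, to a strictly smaller value.
\<close>

lemma max_principle:
  assumes e: "left_bounded e" and A: "finite A"
    and sub: "\<And>x. x \<in> A \<Longrightarrow> e x \<le> Q e x" and off: "\<And>x. x \<notin> A \<Longrightarrow> e x \<le> 0"
  shows "e x \<le> 0"
proof (rule ccontr)
  assume "\<not> e x \<le> 0"
  then have x: "x \<in> A" "0 < e x" using off[of x] by auto
  define m where "m = Max (e ` A)"
  have m: "e y \<le> m" if "y \<in> A" for y using A that by (simp add: m_def)
  have m0: "0 < m" using m[of x] x by linarith
  have mall: "e y \<le> m" for y using m[of y] off[of y] m0 by (cases "y \<in> A") auto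
  have "m \<in> e ` A" unfolding m_def using A x by (intro Max_in) auto
  then have S: "finite {y \<in> A. e y = m}" "{y \<in> A. e y = m} \<noteq> {}" using A by auto
  define z where "z = Max {y \<in> A. e y = m}"
  have z: "z \<in> A" "e z = m" using Max_in[OF S] by (auto simp: z_def)
  have "z + 1 \<notin> {y \<in> A. e y = m}" using Max_ge[OF S(1), of "z + 1"] by (auto simp: z_def[symmetric])
  then have lt: "e (z + 1) < m" using m[of "z + 1"] off[of "z + 1"] m0 by fastforce
  have "Q e z \<le> measure_pmf.expectation D (\<lambda>k. m - indicator {0} k * (m - e (z + 1)))"
    unfolding Q_def
    by (intro integral_mono Q_integrable e Bochner_Integration.integrable_diff integrable_mult_left
        measure_pmf.integrable_const_bound[where B = 1])
      (auto simp: mall left_bounded_const split: split_indicator)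
  also have "\<dots> = m - pmf D 0 * (m - e (z + 1))"
    by (subst Bochner_Integration.integral_diff)
      (auto intro!: integrable_mult_left measure_pmf.integrable_const_bound[where B = 1] simp: pmf.rep_eq)
  also have "\<dots> < m" using up lt by simp
  finally show False using sub[OF z(1)] z by linarith
qed

text \<open>By convexity of exp, a walk with nonnegative drift makes this function lose an amount of
  order K^(-2) per step on the window. Its height stays below exp 1, so an error s per step on the
  window can be absorbed by a multiple of order s K^2.\<close>

definition barrier :: "nat \<Rightarrow> int \<Rightarrow> real" where
  "barrier K x = (if x \<le> int K then exp 1 - exp (of_int x / real K) else 0)"

lemma barrier_bounds: "0 < K \<Longrightarrow> 0 \<le> barrier K x" "barrier K x \<le> exp 1"
  by (auto simp: barrier_def)

lemma left_bounded_barrier: "0 < K \<Longrightarrow> left_bounded (barrier K)"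
  using barrier_bounds by (intro left_boundedI[of _ "exp 1"]) (auto simp: abs_le_iff intro: order_trans[of _ 0])

lemma barrier_decrease:
  assumes K: "0 < K" "- int K \<le> x" "x < int K"
  shows "Q (barrier K) x \<le> barrier K x - pmf D 0 * exp (- 1) / (2 * (real K)\<^sup>2)"
proof -
  define l where "l = 1 / real K"
  have l: "0 < l" using K by (simp add: l_def)
  \<comment> \<open>A minorant of exp (l (1 - k)): the tangent line everywhere, plus the quadratic
    Taylor term at the upward step k = 0. The linear part has nonnegative mean by the drift
    condition, which leaves the gain pmf D 0 * l^2 / 2.\<close>
  define f where "f k = 1 + l * (1 - real k) + indicator {0} k * (l\<^sup>2 / 2)" for k :: nat
  have fint: "integrable (measure_pmf D) f"
    unfolding f_def by (intro Bochner_Integration.integrable_add integrable_mult_right integrable_mult_left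
      Bochner_Integration.integrable_diff integrable_D measure_pmf.integrable_const_bound[where B = 1]) (auto split: split_indicator)
  have "1 + pmf D 0 * l\<^sup>2 / 2 \<le> measure_pmf.expectation D f"
  proof -
    have "measure_pmf.expectation D f = 1 + l * (1 - measure_pmf.expectation D real) + pmf D 0 * l\<^sup>2 / 2"
    proof -
      have i1: "integrable (measure_pmf D) (\<lambda>k. indicator {0} k * (l\<^sup>2 / 2))"
        by (intro integrable_mult_left measure_pmf.integrable_const_bound[where B = 1]) (auto split: split_indicator)
      have i2: "integrable (measure_pmf D) (\<lambda>k. l * (1 - real k))"
        by (intro integrable_mult_right Bochner_Integration.integrable_diff integrable_D) simp
      have i3: "integrable (measure_pmf D) (\<lambda>k. 1 + l * (1 - real k))"
        by (intro Bochner_Integration.integrable_add i2) simp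
      have "measure_pmf.expectation D (\<lambda>k. 1 + l * (1 - real k)) = 1 + l * (1 - measure_pmf.expectation D real)"
        using i2 by (simp add: integrable_D)
      then show ?thesis
        unfolding f_def by (subst Bochner_Integration.integral_add[OF i3 i1]) (simp add: pmf.rep_eq)
    qed
    then show ?thesis using drift l by simp
  qed
  also have "\<dots> \<le> measure_pmf.expectation D (\<lambda>k. exp (l * (1 - real k)))"
  proof (rule integral_mono[OF fint])
    show "integrable (measure_pmf D) (\<lambda>k. exp (l * (1 - real k)))"
      using l by (intro measure_pmf.integrable_const_bound[where B = "exp l"]) (auto simp: algebra_simps)
    show "f k \<le> exp (l * (1 - real k))" for k
    proof (cases "k = 0")
      case True
      then show ?thesis using exp_lower_Taylor_quadratic[of l] l by (simp add: f_def)
    next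
      case False
      then show ?thesis using exp_ge_add_one_self[of "l * (1 - real k)"] by (simp add: f_def)
    qed
  qed
  finally have *: "1 + pmf D 0 * l\<^sup>2 / 2 \<le> measure_pmf.expectation D (\<lambda>k. exp (l * (1 - real k)))" .
  have "Q (barrier K) x = Q (\<lambda>y. exp 1 - exp (l * of_int x) * exp (l * of_int (y - x))) x"
    using K by (intro Q_cong) (auto simp: barrier_def l_def exp_add[symmetric] field_simps)
  also have "\<dots> = exp 1 - exp (l * of_int x) * measure_pmf.expectation D (\<lambda>k. exp (l * (1 - real k)))"
    unfolding Q_def using l
    by (subst Bochner_Integration.integral_diff)
     (auto intro!: integrable_mult_right measure_pmf.integrable_const_bound[where B = "exp l"] simp: algebra_simps)
  also have "\<dots> \<le> exp 1 - exp (l * of_int x) * (1 + pmf D 0 * l\<^sup>2 / 2)"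
    using * by simp
  also have "\<dots> = barrier K x - exp (l * of_int x) * (pmf D 0 * l\<^sup>2 / 2)"
    using K by (simp add: barrier_def l_def algebra_simps)
  also have "\<dots> \<le> barrier K x - exp (- 1) * (pmf D 0 * l\<^sup>2 / 2)"
  proof (intro diff_left_mono mult_right_mono)
    have "- 1 \<le> l * of_int x" using K by (simp add: l_def field_simps)
    then show "exp (- 1) \<le> exp (l * of_int x)" by simp
  qed (use up in auto)
  finally show ?thesis by (simp add: l_def power_divide field_simps)
qed

section \<open>The renewal function as a harmonic function of the walk\<close>

definition \<beta> :: "nat \<Rightarrow> real" where
  "\<beta> j = measure_pmf.prob D {j<..} / pmf D 0"

lemma \<beta>_nonneg: "0 \<le> \<beta> j"
  by (simp add: \<beta>_def)

text \<open>Layer-cake summation by Tonelli. It is applied with a j = 1 for the mean and with a j =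
  j for the second moment.\<close>

lemma tail_sums:
  assumes a: "\<And>j. 0 \<le> a j" and int: "integrable (measure_pmf D) (\<lambda>k. \<Sum>j<k. a j)"
  shows "(\<lambda>j. a j * measure_pmf.prob D {j<..}) sums measure_pmf.expectation D (\<lambda>k. \<Sum>j<k. a j)"
proof -
  have "(\<Sum>j. ennreal (a j * measure_pmf.prob D {j<..})) =
      (\<Sum>j. \<integral>\<^sup>+k. ennreal (a j) * indicator {j<..} k \<partial>measure_pmf D)"
    using a by (simp add: nn_integral_cmult measure_pmf.emeasure_eq_measure ennreal_mult)
  also have "\<dots> = (\<integral>\<^sup>+k. (\<Sum>j. ennreal (a j) * indicator {j<..} k) \<partial>measure_pmf D)"
    by (rule nn_integral_suminf[symmetric]) simp
  also have "\<dots> = (\<integral>\<^sup>+k. ennreal (\<Sum>j<k. a j) \<partial>measure_pmf D)"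
  proof (rule nn_integral_cong)
    fix k :: nat
    have "(\<Sum>j. ennreal (a j) * indicator {j<..} k) = (\<Sum>j<k. ennreal (a j) * indicator {j<..} k)"
      by (rule suminf_finite) auto
    also have "\<dots> = (\<Sum>j<k. ennreal (a j))" by (intro sum.cong) auto
    finally show "(\<Sum>j. ennreal (a j) * indicator {j<..} k) = ennreal (\<Sum>j<k. a j)"
      using a by (simp add: sum_ennreal)
  qed
  also have "\<dots> = ennreal (measure_pmf.expectation D (\<lambda>k. \<Sum>j<k. a j))"
    using a by (intro nn_integral_eq_integral int) (auto intro: sum_nonneg)
  finally have eq: "(\<Sum>j. ennreal (a j * measure_pmf.prob D {j<..})) = ennreal (measure_pmf.expectation D (\<lambda>k. \<Sum>j<k. a j))" .
  have s: "summable (\<lambda>j. a j * measure_pmf.prob D {j<..})"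
    using a by (intro summable_suminf_not_top) (auto simp: eq)
  have "ennreal (\<Sum>j. a j * measure_pmf.prob D {j<..}) = ennreal (measure_pmf.expectation D (\<lambda>k. \<Sum>j<k. a j))"
    using suminf_ennreal2[OF _ s] a eq by simp
  then have "(\<Sum>j. a j * measure_pmf.prob D {j<..}) = measure_pmf.expectation D (\<lambda>k. \<Sum>j<k. a j)"
    using a s by (subst (asm) ennreal_inj) (auto intro!: suminf_nonneg integral_nonneg_AE sum_nonneg)
  then show ?thesis using s by (simp add: sums_iff)
qed

lemma prob_pos: "measure_pmf.prob D {0<..} = 1 - pmf D 0"
proof -
  have "measure_pmf.prob D {0<..} = measure_pmf.prob D (UNIV - {0})"
    by (intro arg_cong[where f = "measure_pmf.prob D"]) auto
  also have "\<dots> = 1 - measure_pmf.prob D {0}" using measure_pmf.prob_compl[of "{0}" D] by simp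
  finally show ?thesis by (simp add: pmf.rep_eq)
qed

text \<open>Total mass 1 is equivalent to zero drift; a positive drift makes the renewal process
  defective and \<open>U\<close> bounded.\<close>

lemma \<beta>_sums: "(\<lambda>j. \<beta> (Suc j)) sums (1 - (1 - measure_pmf.expectation D real) / pmf D 0)"
proof -
  have "(\<lambda>j. 1 * measure_pmf.prob D {j<..}) sums measure_pmf.expectation D (\<lambda>k. \<Sum>j<k. 1)"
    by (rule tail_sums) (simp_all add: integrable_D)
  then have "(\<lambda>j. measure_pmf.prob D {Suc j<..}) sums (measure_pmf.expectation D real - (1 - pmf D 0))"
    by (subst sums_Suc_iff) (simp add: prob_pos)
  from sums_divide[OF this, of "pmf D 0"] show ?thesis
    using up unfolding \<beta>_def by (simp add: field_simps)
qed

lemma \<beta>_part: "(\<Sum>j<n. \<beta> (Suc j)) \<le> 1"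
proof -
  have "(\<Sum>j<n. \<beta> (Suc j)) \<le> (\<Sum>j. \<beta> (Suc j))"
    using \<beta>_sums by (intro sum_le_suminf) (auto simp: sums_iff \<beta>_nonneg)
  also have "\<dots> \<le> 1" using \<beta>_sums up drift by (simp add: sums_iff)
  finally show ?thesis .
qed

definition U :: "int \<Rightarrow> real" where
  "U x = renewal \<beta> (nat x)"

lemma U_nonneg: "0 \<le> U x" by (simp add: U_def renewal_nonneg \<beta>_nonneg)
lemma U_nonpos [simp]: "x \<le> 0 \<Longrightarrow> U x = 0" by (simp add: U_def)
lemma U_1 [simp]: "U 1 = 1" by (simp add: U_def)
lemma U_mono: "x \<le> y \<Longrightarrow> U x \<le> U y" by (simp add: U_def renewal_mono \<beta>_nonneg)
lemma U_pos: "0 < x \<Longrightarrow> 1 \<le> U x" by (simp add: U_def renewal_pos \<beta>_nonneg)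

lemma U_eq_0_iff: "U x = 0 \<longleftrightarrow> x \<le> 0"
  using U_pos[of x] by fastforce

lemma U_subadditive: "0 \<le> x \<Longrightarrow> 0 \<le> y \<Longrightarrow> U (x + y) \<le> U x + U y"
  unfolding U_def using renewal_subadditive[of \<beta> "nat x" "nat y", OF \<beta>_nonneg \<beta>_part]
  by (simp add: nat_add_distrib)

lemma left_bounded_U: "left_bounded U"
  unfolding left_bounded_def using U_mono U_nonneg by (intro allI) (metis abs_of_nonneg)

text \<open>Summation by parts: pmf D (j + 1) is a difference of tails, and the two resulting tail
  sums are those in the recursions for consecutive values of the renewal function. The boundary term
  1 - pmf D 0 closes the identity.\<close>

lemma renewal_harmonic:
  "(\<Sum>k\<le>Suc n. pmf D k * renewal \<beta> (Suc (Suc n) - k)) = renewal \<beta> (Suc n)"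
proof -
  let ?u = "renewal \<beta>" and ?b = "\<lambda>j. measure_pmf.prob D {j<..}"
  have rec: "pmf D 0 * ?u (Suc n) = pmf D 0 + (\<Sum>j<n. ?b (Suc j) * ?u (n - j))" for n
    using up by (simp add: renewal.simps \<beta>_def distrib_left sum_distrib_left)
  have bd: "pmf D (Suc j) = ?b j - ?b (Suc j)" for j
  proof -
    have "?b j = measure_pmf.prob D ({Suc j} \<union> {Suc j<..})"
      by (intro arg_cong[where f = "measure_pmf.prob D"]) auto
    also have "\<dots> = measure_pmf.prob D {Suc j} + ?b (Suc j)"
      by (intro measure_pmf.finite_measure_Union) auto
    finally show ?thesis by (simp add: pmf.rep_eq)
  qed
  have "(\<Sum>k\<le>Suc n. pmf D k * ?u (Suc (Suc n) - k)) =
      pmf D 0 * ?u (Suc (Suc n)) + (\<Sum>j\<le>n. pmf D (Suc j) * ?u (Suc n - j))"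
    by (subst sum.atMost_Suc_shift) simp
  also have "(\<Sum>j\<le>n. pmf D (Suc j) * ?u (Suc n - j)) =
      (\<Sum>j\<le>n. ?b j * ?u (Suc n - j)) - (\<Sum>j\<le>n. ?b (Suc j) * ?u (Suc n - j))"
    by (simp add: bd left_diff_distrib sum_subtractf)
  also have "(\<Sum>j\<le>n. ?b j * ?u (Suc n - j)) = ?b 0 * ?u (Suc n) + (\<Sum>j<n. ?b (Suc j) * ?u (n - j))"
    by (subst sum.lessThan_Suc[symmetric] lessThan_Suc_atMost[symmetric], subst sum.lessThan_Suc_shift) simp
  finally show ?thesis
    using rec[of "Suc n"] rec[of n] by (simp add: prob_pos lessThan_Suc_atMost left_diff_distrib)
qed

lemma Q_U_pos: assumes "1 \<le> x" shows "Q U x = U x"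
proof -
  obtain n where n: "x = int (Suc n)" using assms by (metis One_nat_def Suc_pred nat_0_le nat_le_iff int_one_le_iff_zero_less pos_int_cases)
  have "Q U x = (\<Sum>k\<le>Suc n. pmf D k * U (x + 1 - int k))"
    unfolding Q_def by (subst integral_measure_pmf[of "{..Suc n}"]) (auto simp: n U_eq_0_iff)
  also have "\<dots> = (\<Sum>k\<le>Suc n. pmf D k * renewal \<beta> (Suc (Suc n) - k))"
  proof (rule sum.cong)
    fix k assume "k \<in> {..Suc n}"
    then have "nat (x + 1 - int k) = Suc (Suc n) - k" using n by auto
    then show "pmf D k * U (x + 1 - int k) = pmf D k * renewal \<beta> (Suc (Suc n) - k)" by (simp add: U_def)
  qed simp
  also have "\<dots> = renewal \<beta> (Suc n)" by (rule renewal_harmonic)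
  finally show ?thesis unfolding U_def n nat_int .
qed

lemma Q_U_neg: "x < 0 \<Longrightarrow> Q U x = 0"
  using Q_cong[of x U "\<lambda>_. 0"] by simp

text \<open>The only failure of harmonicity: from 0 just the upward step reaches a point where
  \<open>U\<close> is positive. Both q and \<theta> stem from this defect.\<close>

lemma Q_U_0: "Q U 0 = pmf D 0"
  unfolding Q_def by (subst integral_measure_pmf[of "{0}"]) (auto simp: U_eq_0_iff)

lemma Q_U_off: "x \<noteq> 0 \<Longrightarrow> Q U x = U x"
  by (cases "0 < x") (auto simp: Q_U_pos Q_U_neg)

lemma Q_shift: "Q (\<lambda>y. g (y + c)) x = Q g (x + c)"
  unfolding Q_def by (simp add: algebra_simps)

text \<open>The probability, starting from \<open>x\<close>, of hitting \<open>0\<close> before \<open>{..- L}\<close>.\<close>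

definition h :: "nat \<Rightarrow> int \<Rightarrow> real" where
  "h L x = (U (x + int L) - U x) / U (int L)"

lemma h_low: "x \<le> - int L \<Longrightarrow> h L x = 0" by (simp add: h_def)
lemma h_0: "0 < L \<Longrightarrow> h L 0 = 1" using U_pos[of "int L"] by (simp add: h_def)

lemma h_nonneg: "0 \<le> h L x"
  by (auto simp: h_def U_nonneg U_mono intro!: divide_nonneg_nonneg)

lemma h_le_1: assumes "0 < L" shows "h L x \<le> 1"
proof -
  have "U (x + int L) - U x \<le> U (int L)"
  proof (cases "0 \<le> x")
    case True
    then show ?thesis using U_subadditive[of x "int L"] by simp
  next
    case False
    then show ?thesis using U_mono[of "x + int L" "int L"] by simp
  qed
  then show ?thesis using U_pos[of "int L"] assms by (simp add: h_def)
qed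

lemma left_bounded_h: "0 < L \<Longrightarrow> left_bounded (h L)"
  using h_nonneg h_le_1 by (intro left_boundedI[of _ 1]) simp

lemma Q_h_eq: "Q (h L) x = (Q U (x + int L) - Q U x) / U (int L)"
proof -
  have lb: "left_bounded (\<lambda>y. U (y + int L))"
    unfolding left_bounded_def
  proof
    fix x show "\<exists>B. \<forall>y\<le>x. \<bar>U (y + int L)\<bar> \<le> B"
      using U_mono U_nonneg by (intro exI[of _ "U (x + int L)"]) auto
  qed
  have "Q (h L) x = Q (\<lambda>y. inverse (U (int L)) * (U (y + int L) - U y)) x"
    by (intro Q_cong) (simp add: h_def field_simps)
  also have "\<dots> = inverse (U (int L)) * (Q (\<lambda>y. U (y + int L)) x - Q U x)"
    by (simp only: Q_cmult Q_diff[OF lb left_bounded_U])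
  finally show ?thesis
    by (simp add: Q_shift[of U] field_simps)
qed

text \<open>The two translates of \<open>U\<close> in \<open>h L\<close> fail to be harmonic only at
  - L and at 0.\<close>

lemma Q_h: "- int L < x \<Longrightarrow> x \<noteq> 0 \<Longrightarrow> Q (h L) x = h L x"
  by (simp add: Q_h_eq Q_U_off h_def)

text \<open>By the first-step formula this is the probability of returning to 0 before reaching {..-
  L}.\<close>

lemma Q_h_0: "0 < L \<Longrightarrow> Q (h L) 0 = 1 - pmf D 0 / U (int L)"
  using U_pos[of "int L"] by (simp add: Q_h_eq Q_U_off Q_U_0 field_simps)


text \<open>The probability, from x, of entering B within n steps without an earlier visit to C.
  Since B is tested first, a point of both sets counts as success.\<close>

primrec reach :: "int set \<Rightarrow> int set \<Rightarrow> nat \<Rightarrow> int \<Rightarrow> real" where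
  "reach B C 0 x = of_bool (x \<in> B)"
| "reach B C (Suc n) x = (if x \<in> B then 1 else if x \<in> C then 0 else Q (reach B C n) x)"

lemma reach_bounds: "0 \<le> reach B C n x \<and> reach B C n x \<le> 1"
proof (induction n arbitrary: x)
  case (Suc n)
  have lb: "left_bounded (reach B C n)" using Suc by (intro left_boundedI[of _ 1]) auto
  have "0 \<le> Q (reach B C n) x" using Suc by (intro Q_nonneg) auto
  moreover have "Q (reach B C n) x \<le> Q (\<lambda>_. 1) x"
    using Suc by (intro Q_mono lb left_bounded_const) auto
  ultimately show ?case by simp
qed simp

lemma left_bounded_reach: "left_bounded (reach B C n)"
  using reach_bounds by (intro left_boundedI[of _ 1]) auto

lemma reach_Suc_mono: "reach B C n x \<le> reach B C (Suc n) x"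
proof (induction n arbitrary: x)
  case 0
  show ?case using reach_bounds[of B C 0] by (auto intro!: Q_nonneg)
next
  case (Suc n)
  then have "Q (reach B C n) x \<le> Q (reach B C (Suc n)) x"
    by (intro Q_mono left_bounded_reach)
  then show ?case by (simp del: reach.simps add: reach.simps(2)[of B C n] reach.simps(2)[of B C "Suc n"])
qed

definition reach_lim :: "int set \<Rightarrow> int set \<Rightarrow> int \<Rightarrow> real" where
  "reach_lim B C x = lim (\<lambda>n. reach B C n x)"

lemma reach_tendsto: "(\<lambda>n. reach B C n x) \<longlonglongrightarrow> reach_lim B C x"
proof -
  have "incseq (\<lambda>n. reach B C n x)" by (rule incseq_SucI) (rule reach_Suc_mono)
  then have "convergent (\<lambda>n. reach B C n x)"
    using reach_bounds incseq_convergent[of "\<lambda>n. reach B C n x" 1] by (metis convergent_def)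
  then show ?thesis unfolding reach_lim_def by (simp add: convergent_LIMSEQ_iff)
qed

lemma reach_lim_bounds: "0 \<le> reach_lim B C x" "reach_lim B C x \<le> 1"
  using reach_bounds[of B C _ x]
  by (auto intro!: LIMSEQ_le_const[OF reach_tendsto] LIMSEQ_le_const2[OF reach_tendsto])

lemma left_bounded_reach_lim: "left_bounded (reach_lim B C)"
  using reach_lim_bounds by (intro left_boundedI[of _ 1]) auto

lemma Q_reach_tendsto: "(\<lambda>n. Q (reach B C n) x) \<longlonglongrightarrow> Q (reach_lim B C) x"
  by (rule Q_tendsto[where B = 1]) (use reach_bounds reach_tendsto in auto)

lemma reach_lim_in: "x \<in> B \<Longrightarrow> reach_lim B C x = 1"
proof -
  assume "x \<in> B"
  then have "reach B C n x = 1" for n by (cases n) auto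
  then show ?thesis using reach_tendsto[of B C x] LIMSEQ_unique[OF _ tendsto_const] by simp
qed

lemma reach_lim_dead: "x \<notin> B \<Longrightarrow> x \<in> C \<Longrightarrow> reach_lim B C x = 0"
proof -
  assume "x \<notin> B" "x \<in> C"
  then have "reach B C n x = 0" for n by (cases n) auto
  then show ?thesis using reach_tendsto[of B C x] LIMSEQ_unique[OF _ tendsto_const] by simp
qed

lemma reach_lim_harmonic:
  assumes "x \<notin> B" "x \<notin> C" shows "Q (reach_lim B C) x = reach_lim B C x"
proof -
  have "(\<lambda>n. reach B C (Suc n) x) \<longlonglongrightarrow> Q (reach_lim B C) x"
    using Q_reach_tendsto assms by simp
  then show ?thesis using LIMSEQ_Suc[OF reach_tendsto] LIMSEQ_unique by blast
qed

lemma U_ratio_small: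
  assumes "filterlim (\<lambda>n. U (int n)) at_top sequentially"
  shows "(\<lambda>K. U x / U (int K)) \<longlonglongrightarrow> 0"
  using assms by (intro tendsto_divide_0[OF tendsto_const] filterlim_at_top_imp_at_infinity)

text \<open>When \<open>U\<close> is unbounded the walk cannot escape to the right, so hitting {..-
  n} before 0 and hitting 0 before {..- n} are complementary and the probability is 1 - h n. The
  maximum principle needs a finite set: the window is cut at K and U / U K is subtracted, which
  dominates beyond K and vanishes pointwise as K grows.\<close>

lemma reach_below:
  assumes inf: "filterlim (\<lambda>n. U (int n)) at_top sequentially" and n: "0 < n"
  shows "Q (reach_lim {..- int n} {0}) 0 = pmf D 0 / U (int n)"
proof -
  let ?r = "reach_lim {..- int n} {0}"
  have r0: "?r 0 = 0" using n by (intro reach_lim_dead) auto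
  \<comment> \<open>The sign c, equal to 1 or -1, treats both inequalities at once.\<close>
  have lb: "left_bounded (\<lambda>y. c * (?r y - 1 + h n y) - U y / U (int K))" for c K
    using left_bounded_cmult[OF left_bounded_U, of "1 / U (int K)"]
    by (intro left_bounded_diff left_bounded_cmult left_bounded_add left_bounded_reach_lim
        left_bounded_const left_bounded_h n) simp
  have Qe: "Q (\<lambda>y. c * (?r y - 1 + h n y) - U y / U (int K)) x = c * (Q ?r x - 1 + Q (h n) x) - Q U x / U (int K)" for c K x
  proof -
    have "Q (\<lambda>y. c * (?r y - 1 + h n y) - 1 / U (int K) * U y) x =
        Q (\<lambda>y. c * (?r y - 1 + h n y)) x - Q (\<lambda>y. 1 / U (int K) * U y) x"
      by (intro Q_diff left_bounded_intros left_bounded_reach_lim left_bounded_h n left_bounded_U)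
    also have "Q (\<lambda>y. c * (?r y - 1 + h n y)) x = c * Q (\<lambda>y. ?r y - 1 + h n y) x" by (rule Q_cmult)
    also have "Q (\<lambda>y. ?r y - 1 + h n y) x = Q (\<lambda>y. ?r y - 1) x + Q (h n) x"
      by (intro Q_add left_bounded_intros left_bounded_reach_lim left_bounded_h n)
    also have "Q (\<lambda>y. ?r y - 1) x = Q ?r x - Q (\<lambda>y. 1) x"
      by (intro Q_diff left_bounded_intros left_bounded_reach_lim)
    also have "Q (\<lambda>y. 1 / U (int K) * U y) x = 1 / U (int K) * Q U x" by (rule Q_cmult)
    finally show ?thesis by simp
  qed
  have main: "c * (?r x - 1 + h n x) - U x / U (int K) \<le> 0" if c: "\<bar>c\<bar> = 1" and K: "0 < K" for c x K
  proof (rule max_principle[OF lb, where A = "{- int n<..<int K} - {0}"])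
    fix x assume "x \<in> {- int n<..<int K} - {0}"
    then show "c * (?r x - 1 + h n x) - U x / U (int K) \<le> Q (\<lambda>y. c * (?r y - 1 + h n y) - U y / U (int K)) x"
      unfolding Qe by (simp add: reach_lim_harmonic Q_h Q_U_off)
  next
    fix x assume "x \<notin> {- int n<..<int K} - {0}"
    then consider "x \<le> - int n" | "x = 0" | "int K \<le> x" by fastforce
    then show "c * (?r x - 1 + h n x) - U x / U (int K) \<le> 0"
    proof cases
      case 1
      then show ?thesis by (simp add: reach_lim_in h_low)
    next
      case 2
      then show ?thesis using r0 n by (simp add: h_0)
    next
      case 3
      have "1 \<le> U x / U (int K)" using U_mono[OF 3] U_pos[of "int K"] K by simp
      moreover have "\<bar>?r x - 1 + h n x\<bar> \<le> 1"
        using reach_lim_bounds[of "{..- int n}" "{0}" x] h_nonneg[of n x] h_le_1[OF n, of x] by linarith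
      then have "c * (?r x - 1 + h n x) \<le> 1"
        using abs_mult[of c "?r x - 1 + h n x"] c abs_ge_self[of "c * (?r x - 1 + h n x)"] unfolding c mult_1_left by linarith
      ultimately show ?thesis by linarith
    qed
  qed auto
  have key: "c * (?r x - 1 + h n x) \<le> 0" if "\<bar>c\<bar> = 1" for c x
  proof (rule LIMSEQ_le_const[OF U_ratio_small[OF inf, of x]])
    show "\<exists>N. \<forall>K\<ge>N. c * (?r x - 1 + h n x) \<le> U x / U (int K)"
      using main[OF that] by (intro exI[of _ 1]) fastforce
  qed
  have "?r x = 1 - h n x" for x
    using key[of 1 x] key[of "- 1" x] by simp
  then have "?r = (\<lambda>x. 1 - h n x)" by auto
  then have "Q ?r 0 = Q (\<lambda>x. 1 - h n x) 0" by simp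
  also have "\<dots> = 1 - Q (h n) 0" by (simp add: Q_diff left_bounded_const left_bounded_h n)
  finally show ?thesis by (simp add: Q_h_0 n)
qed

lemma h_tendsto:
  assumes "(\<lambda>n. U (int n)) \<longlonglongrightarrow> u"
  shows "(\<lambda>L. h L x) \<longlonglongrightarrow> 1 - U x / u"
proof -
  have "u \<ge> 1" using U_pos by (intro LIMSEQ_le_const[OF assms] exI[of _ 1]) auto
  have "(\<lambda>L. U (x + int L)) \<longlonglongrightarrow> u"
  proof (rule LIMSEQ_offset[where k = "nat (- x)"])
    have "(\<lambda>n. U (int (n + nat x))) \<longlonglongrightarrow> u" by (rule LIMSEQ_ignore_initial_segment[OF assms])
    moreover have "(\<lambda>n. U (x + int (n + nat (- x)))) = (\<lambda>n. U (int (n + nat x)))"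
      by (intro ext arg_cong[where f = U]) auto
    ultimately show "(\<lambda>n. U (x + int (n + nat (- x)))) \<longlonglongrightarrow> u" by (simp only:)
  qed
  then have "(\<lambda>L. h L x) \<longlonglongrightarrow> (u - U x) / u"
    unfolding h_def using \<open>u \<ge> 1\<close> by (intro tendsto_intros assms) auto
  then show ?thesis using \<open>u \<ge> 1\<close> by (simp add: diff_divide_distrib)
qed

lemma U_le_lim:
  assumes "(\<lambda>n. U (int n)) \<longlonglongrightarrow> u"
  shows "U x \<le> u" "1 \<le> u"
proof -
  have "U x \<le> U (int m)" if "nat x \<le> m" for m using that by (intro U_mono) linarith
  then show "U x \<le> u" by (intro LIMSEQ_le_const[OF assms] exI[of _ "nat x"]) auto
  show "1 \<le> u" using U_pos by (intro LIMSEQ_le_const[OF assms] exI[of _ 1]) auto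
qed

lemma Q_minimal:
  assumes u: "(\<lambda>n. U (int n)) \<longlonglongrightarrow> u"
  shows "Q (\<lambda>x. 1 - U x / u) x = 1 - Q U x / u"
  using left_bounded_cmult[OF left_bounded_U, of "1 / u"] Q_cmult[of "1 / u" U x]
  by (subst Q_diff) (simp_all add: left_bounded_const)

lemma left_bounded_minimal: "left_bounded (\<lambda>x. 1 - U x / u)"
  using left_bounded_cmult[OF left_bounded_U, of "1 / u"] by (intro left_bounded_diff left_bounded_const) simp

text \<open>A bounded monotone function has vanishing increments.\<close>

lemma h_small_at_infinity:
  assumes u: "(\<lambda>n. U (int n)) \<longlonglongrightarrow> u" and L: "0 < L" and e: "0 < e"
  shows "\<exists>K>0. \<forall>x\<ge>int K. h L x \<le> e"
proof -
  have "\<forall>\<^sub>F n in sequentially. u - e < U (int n)"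
    using order_tendstoD(1)[OF u, of "u - e"] e by simp
  then obtain K0 where K0: "u - e < U (int n)" if "n \<ge> K0" for n
    unfolding eventually_sequentially by blast
  define K where "K = Suc K0"
  have "h L x \<le> e" if "int K \<le> x" for x
  proof -
    have "u - e < U x" using K0[of "nat x"] that by (simp add: K_def)
    then have "U (x + int L) - U x \<le> e" using U_le_lim(1)[OF u, of "x + int L"] by linarith
    also have "e \<le> e * U (int L)" using U_pos[of "int L"] L e by simp
    finally show ?thesis using U_pos[of "int L"] L by (simp add: h_def divide_le_eq)
  qed
  then show ?thesis by (intro exI[of _ K]) (auto simp: K_def)
qed

text \<open>The candidate 1 - U / u dominates every finite-horizon probability by induction.
  Conversely, the maximum principle puts h L, up to any e > 0, below the hitting probability, and h
  L tends to the candidate.\<close>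

lemma return_prob:
  assumes u: "(\<lambda>n. U (int n)) \<longlonglongrightarrow> u"
  shows "Q (reach_lim {0} {}) 0 = 1 - pmf D 0 / u"
proof -
  let ?r = "reach_lim {0} {}"
  have u1: "1 \<le> u" by (rule U_le_lim[OF u])
  have "reach {0} {} n x \<le> 1 - U x / u" for n x
  proof (induction n arbitrary: x)
    case 0
    show ?case using U_le_lim(1)[OF u, of x] u1 by (auto simp: divide_le_eq)
  next
    case (Suc n)
    have "Q (reach {0} {} n) x \<le> Q (\<lambda>x. 1 - U x / u) x"
      by (intro Q_mono left_bounded_reach left_bounded_minimal Suc)
    then show ?case using Q_U_off[of x] by (auto simp: Q_minimal[OF u])
  qed
  then have up: "?r x \<le> 1 - U x / u" for x by (intro LIMSEQ_le_const2[OF reach_tendsto]) auto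
  have main: "h L x - e - ?r x \<le> 0" if L: "0 < L" and e: "0 < e" for L e x
  proof -
    obtain K where K: "0 < K" "\<And>x. x \<ge> int K \<Longrightarrow> h L x \<le> e"
      using h_small_at_infinity[OF u L e] by auto
    show ?thesis
    proof (rule max_principle[where A = "{- int L<..<int K} - {0}"])
      show "left_bounded (\<lambda>x. h L x - e - ?r x)"
        by (intro left_bounded_intros left_bounded_h left_bounded_reach_lim L)
      fix x assume "x \<in> {- int L<..<int K} - {0}"
      then show "h L x - e - ?r x \<le> Q (\<lambda>x. h L x - e - ?r x) x"
        by (simp add: Q_diff left_bounded_intros left_bounded_h left_bounded_reach_lim L Q_h reach_lim_harmonic)
    next
      fix x assume "x \<notin> {- int L<..<int K} - {0}"
      then consider "x \<le> - int L" | "x = 0" | "int K \<le> x" by fastforce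
      then show "h L x - e - ?r x \<le> 0"
        using K(2)[of x] e reach_lim_bounds[of "{0}" "{}" x] L
        by cases (auto simp: h_low h_0 reach_lim_in)
    qed auto
  qed
  have "h L x \<le> ?r x" if "0 < L" for L x
  proof (rule field_le_epsilon)
    show "h L x \<le> ?r x + e" if "0 < e" for e
      using main[OF \<open>0 < L\<close> that, of x] by simp
  qed
  then have "1 - U x / u \<le> ?r x" for x
    by (intro LIMSEQ_le_const2[OF h_tendsto[OF u]] exI[of _ 1]) auto
  with up have "?r = (\<lambda>x. 1 - U x / u)" by (intro ext antisym)
  then show ?thesis by (simp add: Q_minimal[OF u] Q_U_0)
qed

text \<open>With total mass at most s < 1 the renewal function is bounded by the geometric series 1
  / (1 - s).\<close>

lemma U_tendsto_of_drift:
  assumes "measure_pmf.expectation D real < 1"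
  shows "\<exists>u. (\<lambda>n. U (int n)) \<longlonglongrightarrow> u"
proof -
  define s where "s = 1 - (1 - measure_pmf.expectation D real) / pmf D 0"
  have s: "s < 1" using assms up by (simp add: s_def)
  have part: "(\<Sum>j<n. \<beta> (Suc j)) \<le> s" for n
  proof -
    have "(\<Sum>j<n. \<beta> (Suc j)) \<le> (\<Sum>j. \<beta> (Suc j))"
      using \<beta>_sums by (intro sum_le_suminf) (auto simp: sums_iff \<beta>_nonneg)
    then show ?thesis using \<beta>_sums by (simp add: sums_iff s_def)
  qed
  have "renewal \<beta> n \<le> 1 / (1 - s)" for n
  proof (induction n rule: less_induct)
    case (less n)
    show ?case
    proof (cases n)
      case (Suc n')
      have "(\<Sum>j<n'. \<beta> (Suc j) * renewal \<beta> (n' - j)) \<le> (\<Sum>j<n'. \<beta> (Suc j) * (1 / (1 - s)))"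
        using less Suc by (intro sum_mono mult_left_mono \<beta>_nonneg) auto
      also have "\<dots> \<le> s * (1 / (1 - s))"
        unfolding sum_distrib_right[symmetric] using part[of n'] s by (intro mult_right_mono) auto
      finally show ?thesis using Suc s by (simp add: renewal.simps field_simps)
    qed (use s in simp)
  qed
  moreover have "incseq (renewal \<beta>)" by (intro incseq_SucI renewal_Suc_mono \<beta>_nonneg)
  ultimately obtain u where "renewal \<beta> \<longlonglongrightarrow> u"
    using incseq_convergent[of "renewal \<beta>" "1 / (1 - s)"] by blast
  then show ?thesis by (auto simp: U_def)
qed

text \<open>The second moment of \<open>D\<close> gives the weights \<beta> a finite mean, which is
  at least 1 because they have mass 1 on the positive integers; then the elementary renewal theorem
  applies.\<close>

lemma U_critical:
  assumes c: "measure_pmf.expectation D real = 1" and sq: "integrable (measure_pmf D) (\<lambda>k. (real k)\<^sup>2)"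
    and lt: "pmf D 0 < 1"
  shows "\<exists>m>0. (\<lambda>n. real n / U (int n)) \<longlonglongrightarrow> m"
    and "filterlim (\<lambda>n. U (int n)) at_top sequentially"
proof -
  have s: "(\<lambda>j. \<beta> (Suc j)) sums 1" using \<beta>_sums by (simp add: c)
  have int: "integrable (measure_pmf D) (\<lambda>k. \<Sum>j<k. real j)"
  proof (rule Bochner_Integration.integrable_bound[OF sq])
    have "(\<Sum>j<k. real j) \<le> (\<Sum>j<k. real k)" for k by (intro sum_mono) auto
    then show "AE k in measure_pmf D. norm (\<Sum>j<k. real j) \<le> norm ((real k)\<^sup>2)"
      by (auto simp: power2_eq_square sum_nonneg abs_of_nonneg)
  qed simp
  define e where "e = measure_pmf.expectation D (\<lambda>k. \<Sum>j<k. real j)"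
  have "(\<lambda>j. real j * measure_pmf.prob D {j<..}) sums e"
    unfolding e_def by (intro tail_sums int) simp
  then have "(\<lambda>j. real (Suc j) * measure_pmf.prob D {Suc j<..}) sums e"
    by (subst sums_Suc_iff) simp
  from sums_divide[OF this, of "pmf D 0"]
  have m: "(\<lambda>j. real (Suc j) * \<beta> (Suc j)) sums (e / pmf D 0)" by (simp add: \<beta>_def)
  have "1 \<le> e / pmf D 0"
    using s m by (rule sums_le[rotated]) (simp add: \<beta>_nonneg distrib_right)
  then have m0: "0 < e / pmf D 0" by simp
  have *: "(\<lambda>n. real n / U (int n)) \<longlonglongrightarrow> e / pmf D 0"
    using elementary_renewal[OF \<beta>_nonneg s m m0] by (simp add: U_def)
  then show "\<exists>m>0. (\<lambda>n. real n / U (int n)) \<longlonglongrightarrow> m" using m0 by blast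
  show "filterlim (\<lambda>n. U (int n)) at_top sequentially"
  proof (rule filterlim_at_top_mono)
    show "filterlim (\<lambda>n. real n / (e / pmf D 0)) at_top sequentially"
    proof -
      have "filterlim (\<lambda>n. inverse (e / pmf D 0) * real n) at_top sequentially"
        by (rule filterlim_tendsto_pos_mult_at_top[OF tendsto_const _ filterlim_real_sequentially])
          (use m0 in \<open>simp only: inverse_positive_iff_positive\<close>)
      then show ?thesis by (simp add: field_simps)
    qed
    show "\<forall>\<^sub>F n in sequentially. real n / (e / pmf D 0) \<le> U (int n)"
      using renewal_lower[OF \<beta>_nonneg s m m0] by (intro always_eventually) (simp add: U_def)
  qed
qed

end

section \<open>The branching operator\<close>

text \<open>For factors in [0, 1] the partial products decrease, so the infimum is the infinite
  product. It exists also when infinitely many factors stay away from 1.\<close>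

definition iprod :: "(nat \<Rightarrow> real) \<Rightarrow> real" where
  "iprod a = (INF n. \<Prod>i<n. a i)"

context
  fixes a :: "nat \<Rightarrow> real"
  assumes a: "\<And>i. 0 \<le> a i" "\<And>i. a i \<le> 1"
begin

lemma partial_prod_bounds: "0 \<le> (\<Prod>i<n. a i)" "(\<Prod>i<n. a i) \<le> 1"
  using a by (auto intro!: prod_nonneg prod_le_1)

lemma partial_prod_bdd: "bdd_below (range (\<lambda>n. \<Prod>i<n. a i))"
  using partial_prod_bounds by (intro bdd_belowI[of _ 0]) auto

lemma iprod_le: "iprod a \<le> (\<Prod>i<n. a i)"
  unfolding iprod_def by (rule cINF_lower[OF partial_prod_bdd]) simp

lemma iprod_greatest: "(\<And>n. c \<le> (\<Prod>i<n. a i)) \<Longrightarrow> c \<le> iprod a"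
  unfolding iprod_def by (rule cINF_greatest) auto

lemma iprod_bounds: "0 \<le> iprod a" "iprod a \<le> 1"
  using iprod_greatest[of 0] partial_prod_bounds iprod_le[of 0] by auto

lemma iprod_tendsto: "(\<lambda>n. \<Prod>i<n. a i) \<longlonglongrightarrow> iprod a"
  unfolding iprod_def
proof (rule LIMSEQ_decseq_INF[OF partial_prod_bdd])
  show "decseq (\<lambda>n. \<Prod>i<n. a i)"
    using a partial_prod_bounds by (intro decseq_SucI) (simp add: mult_left_le)
qed

lemma one_minus_sum_le_prod: "1 - (\<Sum>i<n. 1 - a i) \<le> (\<Prod>i<n. a i)"
proof (induction n)
  case (Suc n)
  have "(1 - a n) * (\<Prod>i<n. a i) \<le> (1 - a n) * 1"
    using a partial_prod_bounds by (intro mult_left_mono) auto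
  then show ?case using Suc by (simp add: algebra_simps)
qed simp

lemma one_minus_iprod_le: "ennreal (1 - iprod a) \<le> (\<Sum>i. ennreal (1 - a i))"
proof (rule LIMSEQ_le_const2)
  show "(\<lambda>n. ennreal (1 - (\<Prod>i<n. a i))) \<longlonglongrightarrow> ennreal (1 - iprod a)"
    by (intro tendsto_intros iprod_tendsto)
  have "ennreal (1 - (\<Prod>i<n. a i)) \<le> (\<Sum>i. ennreal (1 - a i))" for n
  proof -
    have "ennreal (1 - (\<Prod>i<n. a i)) \<le> ennreal (\<Sum>i<n. 1 - a i)"
      using one_minus_sum_le_prod[of n] by (intro ennreal_leI) simp
    also have "\<dots> = (\<Sum>i<n. ennreal (1 - a i))" using a by (intro sum_ennreal[symmetric]) auto
    also have "\<dots> \<le> (\<Sum>i. ennreal (1 - a i))" by (intro sum_le_suminf) auto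
    finally show ?thesis .
  qed
  then show "\<exists>N. \<forall>n\<ge>N. ennreal (1 - (\<Prod>i<n. a i)) \<le> (\<Sum>i. ennreal (1 - a i))" by blast
qed

text \<open>The second Bonferroni inequality, in \<open>ennreal\<close> so that divergent sums are
  allowed. The induction step multiplies the first-order bound by 1 - a n.\<close>

lemma one_minus_iprod_ge:
  "(\<Sum>i. ennreal (1 - a i)) \<le> ennreal (1 - iprod a) + (\<Sum>i. \<Sum>j<i. ennreal ((1 - a i) * (1 - a j)))"
proof (rule suminf_le_const)
  fix n
  have "(\<Prod>i<n. a i) \<le> 1 - (\<Sum>i<n. 1 - a i) + (\<Sum>i<n. \<Sum>j<i. (1 - a i) * (1 - a j))"
  proof (induction n)
    case (Suc n)
    have "(1 - a n) * (1 - (\<Sum>i<n. 1 - a i)) \<le> (1 - a n) * (\<Prod>i<n. a i)"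
      using a one_minus_sum_le_prod[of n] by (intro mult_left_mono) auto
    then have "(\<Prod>i<n. a i) * a n \<le> (\<Prod>i<n. a i) - (1 - a n) + (1 - a n) * (\<Sum>i<n. 1 - a i)"
      by (simp add: algebra_simps)
    then show ?case using Suc by (simp add: sum_distrib_left)
  qed simp
  then have "(\<Sum>i<n. 1 - a i) \<le> (1 - iprod a) + (\<Sum>i<n. \<Sum>j<i. (1 - a i) * (1 - a j))"
    using iprod_le[of n] by linarith
  then have "ennreal (\<Sum>i<n. 1 - a i) \<le> ennreal ((1 - iprod a) + (\<Sum>i<n. \<Sum>j<i. (1 - a i) * (1 - a j)))"
    by (rule ennreal_leI)
  also have "\<dots> = ennreal (1 - iprod a) + (\<Sum>i<n. \<Sum>j<i. ennreal ((1 - a i) * (1 - a j)))"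
  proof -
    have "(\<Sum>i<n. \<Sum>j<i. ennreal ((1 - a i) * (1 - a j))) = (\<Sum>i<n. ennreal (\<Sum>j<i. (1 - a i) * (1 - a j)))"
      using a by (intro sum.cong refl sum_ennreal) auto
    also have "\<dots> = ennreal (\<Sum>i<n. \<Sum>j<i. (1 - a i) * (1 - a j))"
      using a by (intro sum_ennreal sum_nonneg) auto
    finally show ?thesis
      using a iprod_bounds by (subst ennreal_plus) (auto intro!: sum_nonneg)
  qed
  also have "\<dots> \<le> ennreal (1 - iprod a) + (\<Sum>i. \<Sum>j<i. ennreal ((1 - a i) * (1 - a j)))"
    by (intro add_left_mono sum_le_suminf) auto
  also have "ennreal (\<Sum>i<n. 1 - a i) = (\<Sum>i<n. ennreal (1 - a i))"
    using a by (intro sum_ennreal[symmetric]) auto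
  finally show "(\<Sum>i<n. ennreal (1 - a i)) \<le> ennreal (1 - iprod a) + (\<Sum>i. \<Sum>j<i. ennreal ((1 - a i) * (1 - a j)))" .
qed simp

end

lemma iprod_mono:
  assumes "\<And>i. 0 \<le> a i" "\<And>i. a i \<le> b i" "\<And>i. b i \<le> 1"
  shows "iprod a \<le> iprod b"
proof (rule iprod_greatest)
  fix n
  have "(\<Prod>i<n. a i) \<le> (\<Prod>i<n. b i)" using assms by (intro prod_mono) auto
  then show "iprod a \<le> (\<Prod>i<n. b i)"
    using iprod_le[of a n] assms order_trans by (metis (no_types, lifting))
qed (use assms order_trans in blast)+

text \<open>Two infima are exchanged. Monotonicity in this direction is essential: constant factors
  1 - 1/n increase to 1 while their infinite products are all 0. For this reason the iterations of
  \<open>T\<close> below start from above.\<close>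

lemma iprod_tendsto_decseq:
  assumes a: "\<And>n i. 0 \<le> a n i" "\<And>n i. a n i \<le> 1" and dec: "\<And>n i. a (Suc n) i \<le> a n i"
    and lim: "\<And>i. (\<lambda>n. a n i) \<longlonglongrightarrow> b i"
  shows "(\<lambda>n. iprod (a n)) \<longlonglongrightarrow> iprod b"
proof -
  have dec': "decseq (\<lambda>n. a n i)" for i using dec by (intro decseq_SucI) auto
  have b: "0 \<le> b i" "b i \<le> a n i" "b i \<le> 1" for i n
  proof -
    show "0 \<le> b i" using a by (intro LIMSEQ_le_const[OF lim]) auto
    show "b i \<le> a n i" for n using decseq_ge[OF dec' lim] .
    then show "b i \<le> 1" using a(2)[of 0 i] order_trans by blast
  qed
  have d: "decseq (\<lambda>n. iprod (a n))" using a dec by (intro decseq_SucI iprod_mono) auto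
  have "0 \<le> iprod (a n)" for n by (rule iprod_bounds(1)[OF a])
  then obtain l where l: "(\<lambda>n. iprod (a n)) \<longlonglongrightarrow> l"
    using decseq_convergent[OF d, of 0] by blast
  have "l \<le> iprod b"
  proof (rule iprod_greatest[OF b(1) b(3)])
    fix m
    show "l \<le> (\<Prod>i<m. b i)"
    proof (rule LIMSEQ_le[OF l])
      show "(\<lambda>n. \<Prod>i<m. a n i) \<longlonglongrightarrow> (\<Prod>i<m. b i)" by (intro tendsto_prod lim)
      show "\<exists>N. \<forall>n\<ge>N. iprod (a n) \<le> (\<Prod>i<m. a n i)" by (intro exI[of _ 0] allI impI iprod_le a)
    qed
  qed
  moreover have "iprod b \<le> l" using a b by (intro LIMSEQ_le_const[OF l] exI[of _ 0]) (auto intro!: iprod_mono)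
  ultimately show ?thesis using l by simp
qed

text \<open>One more factor produces the cross term l (1 - l) (B - A) (b - a) with a minus sign, and
  for ordered families this term is nonnegative. The inequality replaces the convexity of power
  series.\<close>

lemma prod_convex_comonotone:
  fixes a b :: "nat \<Rightarrow> real"
  assumes "\<And>i. 0 \<le> a i" "\<And>i. a i \<le> b i" and l: "0 \<le> l" "l \<le> 1"
  shows "(\<Prod>i<n. (1 - l) * a i + l * b i) \<le> (1 - l) * (\<Prod>i<n. a i) + l * (\<Prod>i<n. b i)"
proof (induction n)
  case (Suc n)
  let ?A = "\<Prod>i<n. a i" and ?B = "\<Prod>i<n. b i"
  have AB: "?A \<le> ?B" using assms by (intro prod_mono) auto
  have "(\<Prod>i<Suc n. (1 - l) * a i + l * b i) \<le> ((1 - l) * ?A + l * ?B) * ((1 - l) * a n + l * b n)"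
    using Suc assms l by (simp, intro mult_right_mono) (auto intro!: add_nonneg_nonneg mult_nonneg_nonneg intro: order_trans)
  also have "\<dots> = (1 - l) * (?A * a n) + l * (?B * b n) - l * (1 - l) * ((?B - ?A) * (b n - a n))"
    by (simp add: algebra_simps)
  also have "\<dots> \<le> (1 - l) * (?A * a n) + l * (?B * b n)"
    using AB assms l by (simp add: mult_nonneg_nonneg)
  finally show ?case by simp
qed simp

lemma iprod_convex_comonotone:
  assumes "\<And>i. 0 \<le> a i" "\<And>i. a i \<le> b i" "\<And>i. b i \<le> 1" and l: "0 \<le> l" "l \<le> 1"
  shows "iprod (\<lambda>i. (1 - l) * a i + l * b i) \<le> (1 - l) * iprod a + l * iprod b"
proof -
  have a1: "a i \<le> 1" and b0: "0 \<le> b i" for i using assms order_trans by blast+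
  have c: "0 \<le> (1 - l) * a i + l * b i" "(1 - l) * a i + l * b i \<le> 1" for i
  proof -
    show "0 \<le> (1 - l) * a i + l * b i" using assms b0 by (intro add_nonneg_nonneg mult_nonneg_nonneg) auto
    have "(1 - l) * a i + l * b i \<le> (1 - l) * 1 + l * 1"
      using assms a1 by (intro add_mono mult_left_mono) auto
    then show "(1 - l) * a i + l * b i \<le> 1" by simp
  qed
  show ?thesis
    by (rule LIMSEQ_le[OF iprod_tendsto[OF c] tendsto_add[OF tendsto_mult[OF tendsto_const iprod_tendsto[OF assms(1) a1]]
          tendsto_mult[OF tendsto_const iprod_tendsto[OF b0 assms(3)]]]])
      (use prod_convex_comonotone[of a b l] assms in blast)
qed

lemma measurable_iprod:
  assumes "\<And>i. f i \<in> borel_measurable M" "\<And>i x. 0 \<le> f i x" "\<And>i x. f i x \<le> 1"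
  shows "(\<lambda>x. iprod (\<lambda>i. f i x)) \<in> borel_measurable M"
proof (rule borel_measurable_LIMSEQ_real)
  show "(\<lambda>n. \<Prod>i<n. f i x) \<longlonglongrightarrow> iprod (\<lambda>i. f i x)" for x using assms by (intro iprod_tendsto)
  show "(\<lambda>x. \<Prod>i<n. f i x) \<in> borel_measurable M" for n using assms(1) by measurable
qed

text \<open>Child i exists when \<open>A i\<close> holds and is displaced by \<open>Y i\<close>. The
  assumption \<open>many_to_one\<close> encodes that the tilted step law is the law of 1 - k under
  \<open>D\<close>; \<open>C\<close> bounds the pair moment, each pair being taken once.\<close>

locale offspring = prob_space M + skip_free_walk D
  for M :: "'a measure" and D :: "nat pmf" +
  fixes A :: "nat \<Rightarrow> 'a \<Rightarrow> bool" and Y :: "nat \<Rightarrow> 'a \<Rightarrow> int" and t C :: real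
  assumes A_measurable [measurable]: "\<And>i. Measurable.pred M (A i)"
    and Y_measurable [measurable]: "\<And>i. Y i \<in> M \<rightarrow>\<^sub>M count_space UNIV"
    and t_pos: "0 < t" and C_nonneg: "0 \<le> C"
    and many_to_one: "\<And>f. (\<integral>\<^sup>+\<omega>. (\<Sum>i. if A i \<omega> then f (Y i \<omega>) else 0) \<partial>M) =
        (\<integral>\<^sup>+k. f (1 - int k) * ennreal (exp (t * (1 - real k))) \<partial>measure_pmf D)"
    and pairs: "(\<integral>\<^sup>+\<omega>. (\<Sum>i. \<Sum>j<i. if A i \<omega> \<and> A j \<omega>
          then ennreal (exp (- t * of_int (Y i \<omega>)) * exp (- t * of_int (Y j \<omega>))) else 0) \<partial>M) \<le> ennreal C"
begin

definition T :: "(int \<Rightarrow> real) \<Rightarrow> int \<Rightarrow> real" where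
  "T g x = expectation (\<lambda>\<omega>. iprod (\<lambda>i. if A i \<omega> then g (x + Y i \<omega>) else 1))"

definition unit_valued :: "(int \<Rightarrow> real) \<Rightarrow> bool" where
  "unit_valued g \<longleftrightarrow> (\<forall>x. 0 \<le> g x \<and> g x \<le> 1)"

lemma unit_valuedD: "unit_valued g \<Longrightarrow> 0 \<le> g x" "unit_valued g \<Longrightarrow> g x \<le> 1"
  by (auto simp: unit_valued_def)

lemma weight_measurable [measurable]:
  "(\<lambda>\<omega>. if A i \<omega> then (f :: int \<Rightarrow> ennreal) (Y i \<omega>) else 0) \<in> borel_measurable M"
  by measurable

lemma iprod_child_measurable:
  "unit_valued g \<Longrightarrow> (\<lambda>\<omega>. iprod (\<lambda>i. if A i \<omega> then g (x + Y i \<omega>) else 1)) \<in> borel_measurable M"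
  by (rule measurable_iprod) (auto simp: unit_valuedD)

lemma iprod_child_bounds:
  "unit_valued g \<Longrightarrow> 0 \<le> iprod (\<lambda>i. if A i \<omega> then g (x + Y i \<omega>) else 1)"
  "unit_valued g \<Longrightarrow> iprod (\<lambda>i. if A i \<omega> then g (x + Y i \<omega>) else 1) \<le> 1"
  by (rule iprod_bounds; simp add: unit_valuedD)+

lemma iprod_child_integrable:
  "unit_valued g \<Longrightarrow> integrable M (\<lambda>\<omega>. iprod (\<lambda>i. if A i \<omega> then g (x + Y i \<omega>) else 1))"
  by (intro integrable_const_bound[where B = 1] iprod_child_measurable)
    (auto simp: iprod_child_bounds abs_of_nonneg)

lemma T_bounds: "unit_valued g \<Longrightarrow> 0 \<le> T g x" "unit_valued g \<Longrightarrow> T g x \<le> 1"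
proof -
  assume g: "unit_valued g"
  show "0 \<le> T g x" unfolding T_def by (intro integral_nonneg_AE) (simp add: iprod_child_bounds g)
  have "T g x \<le> expectation (\<lambda>_. 1)"
    unfolding T_def by (intro integral_mono iprod_child_integrable g) (auto simp: iprod_child_bounds g)
  then show "T g x \<le> 1" by (simp add: prob_space)
qed

text \<open>Apply \<open>many_to_one\<close> to the indicator of {2..}: the associated walk makes no
  such step.\<close>

lemma steps_le_1: "AE \<omega> in M. \<forall>i. A i \<omega> \<longrightarrow> Y i \<omega> \<le> 1"
proof -
  have "(\<integral>\<^sup>+\<omega>. (\<Sum>i. if A i \<omega> then indicator {2..} (Y i \<omega>) else 0) \<partial>M) =
      (\<integral>\<^sup>+k. indicator {2..} (1 - int k) * ennreal (exp (t * (1 - real k))) \<partial>measure_pmf D)"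
    by (rule many_to_one)
  also have "\<dots> = (\<integral>\<^sup>+k. 0 \<partial>measure_pmf D)" by (intro nn_integral_cong) auto
  finally have "(\<integral>\<^sup>+\<omega>. (\<Sum>i. if A i \<omega> then indicator {2..} (Y i \<omega>) else 0) \<partial>M) = 0" by simp
  then have "AE \<omega> in M. (\<Sum>i. if A i \<omega> then indicator {2..} (Y i \<omega>) else 0 :: ennreal) = 0"
    by (subst (asm) nn_integral_0_iff_AE) (auto intro!: borel_measurable_suminf weight_measurable)
  then show ?thesis
  proof eventually_elim
    case (elim \<omega>)
    have "(if A i \<omega> then indicator {2..} (Y i \<omega>) else 0 :: ennreal) = 0" for i
      using elim by (subst (asm) suminf_eq_zero_iff) auto
    then show ?case by (metis atLeast_iff indicator_simps(1) not_less one_add_one zless_iff_Suc_zadd zero_neq_one add1_zle_eq)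
  qed
qed

lemma T_mono:
  assumes "unit_valued f" "unit_valued g" "\<And>y. y \<le> x + 1 \<Longrightarrow> f y \<le> g y"
  shows "T f x \<le> T g x"
  unfolding T_def
proof (rule integral_mono_AE)
  show "AE \<omega> in M. iprod (\<lambda>i. if A i \<omega> then f (x + Y i \<omega>) else 1) \<le> iprod (\<lambda>i. if A i \<omega> then g (x + Y i \<omega>) else 1)"
    using steps_le_1
  proof eventually_elim
    case (elim \<omega>)
    show ?case by (rule iprod_mono) (use elim assms in \<open>auto simp: unit_valuedD\<close>)
  qed
qed (intro iprod_child_integrable assms)+

lemma T_cong:
  assumes "unit_valued f" "unit_valued g" "\<And>y. y \<le> x + 1 \<Longrightarrow> f y = g y"
  shows "T f x = T g x"
  using assms by (intro antisym T_mono) auto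

lemma T_shift: "T (\<lambda>y. g (y + c)) x = T g (x + c)"
  by (simp add: T_def add_ac cong: if_cong)

lemma T_tendsto:
  assumes f: "\<And>n. unit_valued (f n)" and dec: "\<And>n y. f (Suc n) y \<le> f n y"
    and lim: "\<And>y. (\<lambda>n. f n y) \<longlonglongrightarrow> g y"
  shows "(\<lambda>n. T (f n) x) \<longlonglongrightarrow> T g x"
  unfolding T_def
proof (rule integral_dominated_convergence[where w = "\<lambda>_. 1"])
  have g: "unit_valued g" unfolding unit_valued_def
    using f by (auto intro!: LIMSEQ_le_const[OF lim] LIMSEQ_le_const2[OF lim] simp: unit_valuedD)
  then show "(\<lambda>\<omega>. iprod (\<lambda>i. if A i \<omega> then g (x + Y i \<omega>) else 1)) \<in> borel_measurable M"
    by (rule iprod_child_measurable)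
  show "AE \<omega> in M. (\<lambda>n. iprod (\<lambda>i. if A i \<omega> then f n (x + Y i \<omega>) else 1)) \<longlonglongrightarrow> iprod (\<lambda>i. if A i \<omega> then g (x + Y i \<omega>) else 1)"
    by (intro AE_I2 iprod_tendsto_decseq) (auto simp: unit_valuedD f dec lim)
qed (auto simp: f iprod_child_measurable iprod_child_bounds abs_of_nonneg)

lemma T_convex_comonotone:
  assumes f: "unit_valued f" and g: "unit_valued g" and le: "\<And>y. f y \<le> g y" and l: "0 \<le> l" "l \<le> 1"
  shows "T (\<lambda>y. (1 - l) * f y + l * g y) x \<le> (1 - l) * T f x + l * T g x"
proof -
  have fg: "unit_valued (\<lambda>y. (1 - l) * f y + l * g y)"
    unfolding unit_valued_def
  proof
    fix y
    have "(1 - l) * f y + l * g y \<le> (1 - l) * 1 + l * 1"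
      using f g l by (intro add_mono mult_left_mono) (auto simp: unit_valuedD)
    then show "0 \<le> (1 - l) * f y + l * g y \<and> (1 - l) * f y + l * g y \<le> 1"
      using f g l by (auto simp: unit_valuedD)
  qed
  have "T (\<lambda>y. (1 - l) * f y + l * g y) x \<le> expectation (\<lambda>\<omega>.
      (1 - l) * iprod (\<lambda>i. if A i \<omega> then f (x + Y i \<omega>) else 1) + l * iprod (\<lambda>i. if A i \<omega> then g (x + Y i \<omega>) else 1))"
    unfolding T_def
  proof (intro integral_mono iprod_child_integrable fg Bochner_Integration.integrable_add integrable_mult_right f g)
    fix \<omega>
    have "iprod (\<lambda>i. if A i \<omega> then (1 - l) * f (x + Y i \<omega>) + l * g (x + Y i \<omega>) else 1) =
        iprod (\<lambda>i. (1 - l) * (if A i \<omega> then f (x + Y i \<omega>) else 1) + l * (if A i \<omega> then g (x + Y i \<omega>) else 1))"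
      by (intro arg_cong[where f = iprod]) auto
    also have "\<dots> \<le> (1 - l) * iprod (\<lambda>i. if A i \<omega> then f (x + Y i \<omega>) else 1) + l * iprod (\<lambda>i. if A i \<omega> then g (x + Y i \<omega>) else 1)"
      by (rule iprod_convex_comonotone) (auto simp: unit_valuedD f g le l)
    finally show "iprod (\<lambda>i. if A i \<omega> then (1 - l) * f (x + Y i \<omega>) + l * g (x + Y i \<omega>) else 1) \<le> \<dots>" .
  qed
  also have "\<dots> = (1 - l) * T f x + l * T g x"
    unfolding T_def by (subst Bochner_Integration.integral_add) (auto intro!: iprod_child_integrable f g)
  finally show ?thesis .
qed

text \<open>The change of measure by exp (t x): in these coordinates the linearisation of
  \<open>T\<close> at the constant 1 is the transition operator \<open>Q\<close>.\<close>

definition hat :: "(int \<Rightarrow> real) \<Rightarrow> int \<Rightarrow> real" where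
  "hat g x = exp (t * of_int x) * (1 - g x)"

lemma hat_nonneg: "unit_valued g \<Longrightarrow> 0 \<le> hat g x"
  by (simp add: hat_def unit_valuedD)

lemma hat_le_exp: "unit_valued g \<Longrightarrow> hat g x \<le> exp (t * of_int x)"
  unfolding hat_def by (intro mult_left_le) (auto simp: unit_valuedD)

lemma left_bounded_hat: "unit_valued g \<Longrightarrow> left_bounded (hat g)"
  unfolding left_bounded_def
proof
  fix x assume g: "unit_valued g"
  have "\<bar>hat g y\<bar> \<le> exp (t * of_int x)" if "y \<le> x" for y
  proof -
    have "exp (t * of_int y) \<le> exp (t * of_int x)" using that t_pos by simp
    then show ?thesis using hat_nonneg[OF g, of y] hat_le_exp[OF g, of y] by linarith
  qed
  then show "\<exists>B. \<forall>y\<le>x. \<bar>hat g y\<bar> \<le> B" by blast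
qed

lemma many_to_one_hat:
  assumes g: "unit_valued g"
  shows "(\<integral>\<^sup>+\<omega>. (\<Sum>i. ennreal (1 - (if A i \<omega> then g (x + Y i \<omega>) else 1))) \<partial>M) =
    ennreal (exp (- t * of_int x) * Q (hat g) x)"
proof -
  have "(\<integral>\<^sup>+\<omega>. (\<Sum>i. ennreal (1 - (if A i \<omega> then g (x + Y i \<omega>) else 1))) \<partial>M) =
      (\<integral>\<^sup>+\<omega>. (\<Sum>i. if A i \<omega> then ennreal (1 - g (x + Y i \<omega>)) else 0) \<partial>M)"
    by (intro nn_integral_cong suminf_cong) auto
  also have "\<dots> = (\<integral>\<^sup>+k. ennreal (1 - g (x + (1 - int k))) * ennreal (exp (t * (1 - real k))) \<partial>measure_pmf D)"
    by (rule many_to_one)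
  also have "\<dots> = (\<integral>\<^sup>+k. ennreal (exp (- t * of_int x) * hat g (x + 1 - int k)) \<partial>measure_pmf D)"
  proof (rule nn_integral_cong)
    fix k
    have "exp (- t * of_int x) * exp (t * of_int (x + 1 - int k)) = exp (t * (1 - real k))"
      by (simp add: exp_add[symmetric] algebra_simps)
    then have "exp (- t * of_int x) * hat g (x + 1 - int k) = (1 - g (x + (1 - int k))) * exp (t * (1 - real k))"
      by (simp add: hat_def mult.assoc[symmetric] add_diff_eq)
    then show "ennreal (1 - g (x + (1 - int k))) * ennreal (exp (t * (1 - real k))) =
        ennreal (exp (- t * of_int x) * hat g (x + 1 - int k))"
      using g by (simp add: ennreal_mult unit_valuedD)
  qed
  also have "\<dots> = ennreal (exp (- t * of_int x) * Q (hat g) x)"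
    unfolding Q_def using hat_nonneg[OF g]
    by (subst nn_integral_eq_integral) (auto intro!: integrable_mult_right Q_integrable left_bounded_hat g)
  finally show ?thesis .
qed

lemma nn_integral_one_minus:
  assumes g: "unit_valued g"
  shows "(\<integral>\<^sup>+\<omega>. ennreal (1 - iprod (\<lambda>i. if A i \<omega> then g (x + Y i \<omega>) else 1)) \<partial>M) = ennreal (1 - T g x)"
proof -
  note i = iprod_child_integrable[OF g, of x]
  have "expectation (\<lambda>\<omega>. 1 - iprod (\<lambda>i. if A i \<omega> then g (x + Y i \<omega>) else 1)) = 1 - T g x"
    unfolding T_def by (subst Bochner_Integration.integral_diff) (auto simp: i prob_space)
  then show ?thesis
    by (subst nn_integral_eq_integral)
      (auto intro!: i Bochner_Integration.integrable_diff simp: iprod_child_bounds g)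
qed

text \<open>Union bound over the children, then the many-to-one formula.\<close>

lemma T_upper_linear:
  assumes g: "unit_valued g"
  shows "exp (t * of_int x) * (1 - T g x) \<le> Q (hat g) x"
proof -
  have "ennreal (1 - T g x) \<le> (\<integral>\<^sup>+\<omega>. (\<Sum>i. ennreal (1 - (if A i \<omega> then g (x + Y i \<omega>) else 1))) \<partial>M)"
    unfolding nn_integral_one_minus[OF g, symmetric]
    by (intro nn_integral_mono one_minus_iprod_le) (auto simp: unit_valuedD g)
  also have "\<dots> = ennreal (exp (- t * of_int x) * Q (hat g) x)" by (rule many_to_one_hat[OF g])
  finally have "1 - T g x \<le> exp (- t * of_int x) * Q (hat g) x"
    by (subst (asm) ennreal_le_iff) (auto intro!: mult_nonneg_nonneg Q_nonneg hat_nonneg g)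
  then have "exp (t * of_int x) * (1 - T g x) \<le> exp (t * of_int x) * (exp (- t * of_int x) * Q (hat g) x)"
    by (intro mult_left_mono) auto
  then show ?thesis by (simp add: mult.assoc[symmetric] exp_add[symmetric])
qed

text \<open>Second Bonferroni inequality: if hat g is at most p, a child displaced by Y contributes
  at most p exp (-t (x + Y)), so the pairs cost p^2 exp (-2 t x) C before the rescaling by exp (t
  x).\<close>

lemma T_lower_linear:
  assumes g: "unit_valued g" and p: "\<And>y. hat g y \<le> p"
  shows "Q (hat g) x \<le> exp (t * of_int x) * (1 - T g x) + p\<^sup>2 * exp (- t * of_int x) * C"
proof -
  let ?c = "\<lambda>\<omega> i. if A i \<omega> then g (x + Y i \<omega>) else 1"
  let ?E = "\<lambda>\<omega> i. exp (- t * of_int (Y i \<omega>))"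
  define B where "B = p\<^sup>2 * exp (- 2 * t * of_int x)"
  have p0: "0 \<le> p" using p[of 0] hat_nonneg[OF g, of 0] by linarith
  have B0: "0 \<le> B" by (simp add: B_def)
  have sec: "(\<Sum>i. \<Sum>j<i. ennreal ((1 - ?c \<omega> i) * (1 - ?c \<omega> j))) \<le>
      ennreal B * (\<Sum>i. \<Sum>j<i. if A i \<omega> \<and> A j \<omega> then ennreal (?E \<omega> i * ?E \<omega> j) else 0)" for \<omega>
  proof -
    have one: "1 - g (x + Y i \<omega>) \<le> p * exp (- t * of_int x) * ?E \<omega> i" for i
    proof -
      have "1 - g (x + Y i \<omega>) = exp (- t * of_int (x + Y i \<omega>)) * hat g (x + Y i \<omega>)"
        by (simp add: hat_def mult.assoc[symmetric] exp_add[symmetric])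
      also have "\<dots> \<le> exp (- t * of_int (x + Y i \<omega>)) * p" by (intro mult_left_mono p) auto
      also have "\<dots> = p * exp (- t * of_int x) * ?E \<omega> i" by (simp add: exp_add[symmetric] algebra_simps)
      finally show ?thesis .
    qed
    have "ennreal ((1 - ?c \<omega> i) * (1 - ?c \<omega> j)) \<le>
        ennreal B * (if A i \<omega> \<and> A j \<omega> then ennreal (?E \<omega> i * ?E \<omega> j) else 0)" for i j
    proof (cases "A i \<omega> \<and> A j \<omega>")
      case True
      have "(1 - g (x + Y i \<omega>)) * (1 - g (x + Y j \<omega>)) \<le>
          (p * exp (- t * of_int x) * ?E \<omega> i) * (p * exp (- t * of_int x) * ?E \<omega> j)"
        using p0 by (intro mult_mono one) (auto simp: unit_valuedD g)
      also have "\<dots> = B * (?E \<omega> i * ?E \<omega> j)"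
        by (simp add: B_def power2_eq_square algebra_simps flip: exp_add)
      finally show ?thesis using True B0 by (simp add: ennreal_mult[symmetric] ennreal_leI)
    qed auto
    then show ?thesis
      by (simp only: ennreal_suminf_cmult[symmetric] sum_distrib_left) (intro suminf_le sum_mono; simp)
  qed
  have "ennreal (exp (- t * of_int x) * Q (hat g) x) = (\<integral>\<^sup>+\<omega>. (\<Sum>i. ennreal (1 - ?c \<omega> i)) \<partial>M)"
    by (rule many_to_one_hat[OF g, symmetric])
  also have "\<dots> \<le> (\<integral>\<^sup>+\<omega>. ennreal (1 - iprod (?c \<omega>)) + ennreal B *
      (\<Sum>i. \<Sum>j<i. if A i \<omega> \<and> A j \<omega> then ennreal (?E \<omega> i * ?E \<omega> j) else 0) \<partial>M)"
  proof (rule nn_integral_mono)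
    fix \<omega>
    have "(\<Sum>i. ennreal (1 - ?c \<omega> i)) \<le> ennreal (1 - iprod (?c \<omega>)) + (\<Sum>i. \<Sum>j<i. ennreal ((1 - ?c \<omega> i) * (1 - ?c \<omega> j)))"
      by (rule one_minus_iprod_ge) (auto simp: unit_valuedD g)
    then show "(\<Sum>i. ennreal (1 - ?c \<omega> i)) \<le> ennreal (1 - iprod (?c \<omega>)) + ennreal B *
      (\<Sum>i. \<Sum>j<i. if A i \<omega> \<and> A j \<omega> then ennreal (?E \<omega> i * ?E \<omega> j) else 0)"
      using add_left_mono[OF sec] order_trans by fast
  qed
  also have "\<dots> = ennreal (1 - T g x) + ennreal B *
      (\<integral>\<^sup>+\<omega>. (\<Sum>i. \<Sum>j<i. if A i \<omega> \<and> A j \<omega> then ennreal (?E \<omega> i * ?E \<omega> j) else 0) \<partial>M)"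
    using iprod_child_measurable[OF g, of x]
    by (subst nn_integral_add) (auto simp: nn_integral_cmult nn_integral_one_minus[OF g])
  also have "\<dots> \<le> ennreal (1 - T g x) + ennreal B * ennreal C"
    by (intro add_left_mono mult_left_mono pairs) auto
  also have "\<dots> = ennreal (1 - T g x + B * C)"
    using B0 C_nonneg T_bounds[OF g] by (simp add: ennreal_mult)
  finally have "exp (- t * of_int x) * Q (hat g) x \<le> 1 - T g x + B * C"
    using B0 C_nonneg T_bounds[OF g, of x] by (subst (asm) ennreal_le_iff) auto
  then have "exp (t * of_int x) * (exp (- t * of_int x) * Q (hat g) x) \<le> exp (t * of_int x) * (1 - T g x + B * C)"
    by (intro mult_left_mono) auto
  then show ?thesis
    by (simp add: B_def mult.assoc[symmetric] distrib_left flip: exp_add) (simp add: algebra_simps flip: exp_add)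
qed

end

section \<open>First passage to level 0: generating functions and comparison with the walk\<close>

context offspring begin

text \<open>Off 0 the iteration starts at 1: lines that have not reached 0 after n generations are
  treated as never reaching it. This start makes the iterates decrease in n.\<close>

primrec psin :: "real \<Rightarrow> nat \<Rightarrow> int \<Rightarrow> real" where
  "psin s 0 x = (if x = 0 then s else 1)"
| "psin s (Suc n) x = (if x = 0 then s else T (psin s n) x)"

lemma psin_unit_valued: "0 \<le> s \<Longrightarrow> s \<le> 1 \<Longrightarrow> unit_valued (psin s n)"
  by (induction n) (auto simp: unit_valued_def T_bounds)

lemma psin_decreasing: "0 \<le> s \<Longrightarrow> s \<le> 1 \<Longrightarrow> psin s (Suc n) x \<le> psin s n x"
proof (induction n arbitrary: x)
  case 0
  then have "unit_valued (psin s 0)" by (rule psin_unit_valued)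
  from T_bounds(2)[OF this, of x] show ?case by simp
next
  case (Suc n)
  then have "T (psin s (Suc n)) x \<le> T (psin s n) x"
    by (intro T_mono psin_unit_valued)
  then show ?case by (simp del: psin.simps add: psin.simps(2)[of s n] psin.simps(2)[of s "Suc n"])
qed

text \<open>
  \<open>Psi s x\<close> is the generating function, at \<open>s\<close>, of the number of particles that are the first of
  their line at \<open>0\<close>, for the branching random walk started at \<open>x\<close>.
\<close>

definition Psi :: "real \<Rightarrow> int \<Rightarrow> real" where
  "Psi s x = lim (\<lambda>n. psin s n x)"

text \<open>If every first return to 0 is marked independently with probability p, then R p is the
  probability that a particle at 0 has a marked one. The m-fold iterate at 1 is the probability of m
  successive returns along some line.\<close>

definition R :: "real \<Rightarrow> real" where
  "R p = 1 - T (Psi (1 - p)) 0"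

definition F :: "real \<Rightarrow> real" where
  "F s = Psi s (- 1)"

text \<open>The analogue of \<open>R\<close> for the passage one level up: the n-fold iterate at p
  is the probability that some first visitor of level n is marked.\<close>

definition phi :: "real \<Rightarrow> real" where
  "phi p = 1 - F (1 - p)"

definition v :: "real \<Rightarrow> int \<Rightarrow> real" where
  "v p = hat (Psi (1 - p))"

context
  fixes s :: real
  assumes s: "0 \<le> s" "s \<le> 1"
begin

lemma Psi_tendsto: "(\<lambda>n. psin s n x) \<longlonglongrightarrow> Psi s x"
proof -
  have "decseq (\<lambda>n. psin s n x)" by (rule decseq_SucI) (rule psin_decreasing[OF s])
  moreover have "0 \<le> psin s n x" for n by (rule unit_valuedD(1)[OF psin_unit_valued[OF s]])
  ultimately have "convergent (\<lambda>n. psin s n x)"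
    using decseq_convergent[of "\<lambda>n. psin s n x" 0] by (metis convergent_def)
  then show ?thesis unfolding Psi_def by (simp add: convergent_LIMSEQ_iff)
qed

lemma Psi_unit_valued: "unit_valued (Psi s)"
  unfolding unit_valued_def
  using psin_unit_valued[OF s]
  by (auto intro!: LIMSEQ_le_const[OF Psi_tendsto] LIMSEQ_le_const2[OF Psi_tendsto] simp: unit_valuedD)

lemma Psi_0: "Psi s 0 = s"
proof -
  have "psin s n 0 = s" for n by (cases n) auto
  then show ?thesis using LIMSEQ_unique[OF Psi_tendsto[of 0]] by simp
qed

lemma Psi_fixed_point: assumes "x \<noteq> 0" shows "T (Psi s) x = Psi s x"
proof -
  have "(\<lambda>n. T (psin s n) x) \<longlonglongrightarrow> T (Psi s) x"
    by (rule T_tendsto) (auto simp: psin_unit_valued s Psi_tendsto psin_decreasing simp del: psin.simps)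
  moreover have "(\<lambda>n. T (psin s n) x) \<longlonglongrightarrow> Psi s x"
    using LIMSEQ_Suc[OF Psi_tendsto[of x]] assms by simp
  ultimately show ?thesis by (rule LIMSEQ_unique)
qed

text \<open>The iteration starts at the top, so its limit dominates every subsolution. Later
  identifications of fixed points with \<open>Psi\<close> rest on this.\<close>

lemma Psi_greatest:
  assumes g: "unit_valued g" "g 0 \<le> s" "\<And>x. x \<noteq> 0 \<Longrightarrow> g x \<le> T g x"
  shows "g x \<le> Psi s x"
proof -
  have "g x \<le> psin s n x" for n x
  proof (induction n arbitrary: x)
    case (Suc n)
    show ?case
    proof (cases "x = 0")
      case False
      then have "g x \<le> T g x" using g by simp
      also have "\<dots> \<le> T (psin s n) x" by (intro T_mono g psin_unit_valued s Suc)
      finally show ?thesis using False by simp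
    qed (use g in simp)
  qed (use g in \<open>auto simp: unit_valuedD\<close>)
  then show ?thesis by (intro LIMSEQ_le_const[OF Psi_tendsto]) auto
qed

lemma F_bounds: "0 \<le> F s" "F s \<le> 1"
  using Psi_unit_valued by (auto simp: F_def unit_valuedD)

end

lemma Psi_mono: "0 \<le> a \<Longrightarrow> a \<le> b \<Longrightarrow> b \<le> 1 \<Longrightarrow> Psi a x \<le> Psi b x"
  by (rule Psi_greatest) (auto simp: Psi_unit_valued Psi_0 Psi_fixed_point)

text \<open>Proved for the iterates, which are ordered in s, so that
  \<open>T_convex_comonotone\<close> applies at every stage.\<close>

lemma Psi_convex:
  assumes a: "0 \<le> a" "a \<le> b" "b \<le> 1" and l: "0 \<le> l" "l \<le> 1"
  shows "Psi ((1 - l) * a + l * b) x \<le> (1 - l) * Psi a x + l * Psi b x"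
proof -
  let ?c = "(1 - l) * a + l * b"
  have "?c \<le> (1 - l) * 1 + l * 1" using a l by (intro add_mono mult_left_mono) auto
  then have c: "0 \<le> ?c" "?c \<le> 1" using a l by auto
  have ab: "b \<ge> 0" "a \<le> 1" using a by auto
  have le: "psin a n y \<le> psin b n y" for n y
  proof (induction n arbitrary: y)
    case (Suc n)
    then show ?case using a ab by (auto intro!: T_mono psin_unit_valued)
  qed (use a in auto)
  have "psin ?c n x \<le> (1 - l) * psin a n x + l * psin b n x" for n x
  proof (induction n arbitrary: x)
    case (Suc n)
    show ?case
    proof (cases "x = 0")
      case False
      have u: "unit_valued (\<lambda>y. (1 - l) * psin a n y + l * psin b n y)"
        unfolding unit_valued_def
      proof
        fix y
        have "(1 - l) * psin a n y + l * psin b n y \<le> (1 - l) * 1 + l * 1"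
          using l a ab by (intro add_mono mult_left_mono) (auto simp: unit_valuedD psin_unit_valued)
        then show "0 \<le> (1 - l) * psin a n y + l * psin b n y \<and> (1 - l) * psin a n y + l * psin b n y \<le> 1"
          using l a ab by (auto simp: unit_valuedD psin_unit_valued)
      qed
      have "T (psin ?c n) x \<le> T (\<lambda>y. (1 - l) * psin a n y + l * psin b n y) x"
        by (intro T_mono psin_unit_valued c u Suc)
      also have "\<dots> \<le> (1 - l) * T (psin a n) x + l * T (psin b n) x"
        using a ab l le by (intro T_convex_comonotone psin_unit_valued)
      finally show ?thesis using False by simp
    qed simp
  qed simp
  then show ?thesis
    using a ab c by (intro LIMSEQ_le[OF Psi_tendsto tendsto_add[OF tendsto_mult[OF tendsto_const Psi_tendsto]
          tendsto_mult[OF tendsto_const Psi_tendsto]]]) auto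
qed

text \<open>
  By skip-freeness, a line started at \<open>x - 1\<close> must visit \<open>-1\<close> before \<open>0\<close>.
\<close>

lemma Psi_shift:
  assumes s: "0 \<le> s" "s \<le> 1" and x: "x \<le> 0"
  shows "Psi s (x - 1) = Psi (F s) x"
proof -
  note u = Psi_unit_valued[OF s] and uF = Psi_unit_valued[OF F_bounds[OF s]]
  have le: "Psi s (x - 1) \<le> Psi (F s) x" if "x \<le> 0" for x
  proof -
    \<comment> \<open>From y < 0 only points up to 0 are seen, so the values to the right are free;
      choosing 0 makes the subsolution property trivial there.\<close>
    define g where "g y = (if y \<le> 0 then Psi s (y - 1) else 0)" for y
    have ug: "unit_valued g" using u by (auto simp: g_def unit_valued_def)
    have us: "unit_valued (\<lambda>z. Psi s (z + (- 1)))" using u by (auto simp: unit_valued_def)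
    have "g x \<le> Psi (F s) x"
    proof (rule Psi_greatest[OF F_bounds[OF s] ug])
      show "g 0 \<le> F s" by (simp add: g_def F_def)
      fix y :: int assume "y \<noteq> 0"
      show "g y \<le> T g y"
      proof (cases "0 < y")
        case True
        then show ?thesis using T_bounds(1)[OF ug, of y] by (simp add: g_def)
      next
        case False
        have "T g y = T (\<lambda>z. Psi s (z + (- 1))) y"
          using False \<open>y \<noteq> 0\<close> by (intro T_cong ug us) (simp add: g_def)
        also have "\<dots> = T (Psi s) (y + (- 1))" by (rule T_shift)
        also have "\<dots> = Psi s (y + (- 1))" using False by (intro Psi_fixed_point s) auto
        finally show ?thesis using False by (simp add: g_def)
      qed
    qed
    then show ?thesis using that by (simp add: g_def)
  qed
  define h where "h y = (if 0 < y then 0 else if y = 0 then s else Psi (F s) (y + 1))" for y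
  have uh: "unit_valued h" using uF s by (auto simp: h_def unit_valued_def)
  have us: "unit_valued (\<lambda>z. Psi (F s) (z + 1))" using uF by (auto simp: unit_valued_def)
  have "h (x - 1) \<le> Psi s (x - 1)"
  proof (rule Psi_greatest[OF s uh])
    show "h 0 \<le> s" by (simp add: h_def)
    fix y :: int assume y: "y \<noteq> 0"
    consider "0 < y" | "y = - 1" | "y < - 1" using y by linarith
    then show "h y \<le> T h y"
    proof cases
      case 1
      then show ?thesis using T_bounds(1)[OF uh, of y] by (simp add: h_def)
    next
      case 2
      \<comment> \<open>At -1 the operator sees the point 0, where h has the prescribed value s. The
        inequality just proved, shifted by one, supplies the comparison at all other points below
        0.\<close>
      have "Psi s z \<le> h z" if "z \<le> 0" for z
        using le[of "z + 1"] that by (auto simp: h_def Psi_0[OF s])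
      then have "T (Psi s) (- 1) \<le> T h (- 1)" by (intro T_mono u uh) auto
      moreover have "h (- 1) = T (Psi s) (- 1)"
        by (simp add: h_def Psi_0[OF F_bounds[OF s]]) (simp add: F_def Psi_fixed_point[OF s])
      ultimately show ?thesis using 2 by simp
    next
      case 3
      have "T h y = T (\<lambda>z. Psi (F s) (z + 1)) y"
        using 3 by (intro T_cong uh us) (auto simp: h_def)
      also have "\<dots> = T (Psi (F s)) (y + 1)" by (rule T_shift)
      also have "\<dots> = Psi (F s) (y + 1)" using 3 by (intro Psi_fixed_point F_bounds s) auto
      finally show ?thesis using 3 by (simp add: h_def)
    qed
  qed
  then have "Psi (F s) x \<le> Psi s (x - 1)" using x by (simp add: h_def split: if_splits)
  then show ?thesis using le[OF x] by simp
qed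

lemma Psi_neg: "0 \<le> s \<Longrightarrow> s \<le> 1 \<Longrightarrow> Psi s (- int n) = (F ^^ n) s"
proof (induction n arbitrary: s)
  case (Suc n)
  have "Psi s (- int (Suc n)) = Psi (F s) (- int n)"
  proof -
    have "- int (Suc n) = - int n - 1" by simp
    then show ?thesis using Psi_shift[of s "- int n"] Suc.prems by (simp only:)
  qed
  then show ?case using Suc.IH[of "F s"] Suc.prems F_bounds[of s] by (simp add: funpow_swap1)
qed (simp add: Psi_0)

lemma phi_pow: "(phi ^^ n) p = 1 - (F ^^ n) (1 - p)"
  by (induction n) (auto simp: phi_def)

lemma phi_bounds: "0 \<le> p \<Longrightarrow> p \<le> 1 \<Longrightarrow> 0 \<le> phi p \<and> phi p \<le> 1"
  using F_bounds[of "1 - p"] by (auto simp: phi_def)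

lemma phi_mono: "0 \<le> p \<Longrightarrow> p \<le> p' \<Longrightarrow> p' \<le> 1 \<Longrightarrow> phi p \<le> phi p'"
  using Psi_mono[of "1 - p'" "1 - p" "- 1"] by (simp add: phi_def F_def)

lemma phi_concave:
  assumes "0 \<le> a" "a \<le> b" "b \<le> 1" "0 \<le> l" "l \<le> 1"
  shows "(1 - l) * phi a + l * phi b \<le> phi ((1 - l) * a + l * b)"
proof -
  have "Psi ((1 - (1 - l)) * (1 - b) + (1 - l) * (1 - a)) (- 1) \<le>
      (1 - (1 - l)) * Psi (1 - b) (- 1) + (1 - l) * Psi (1 - a) (- 1)"
    using assms by (intro Psi_convex) auto
  moreover have "(1 - (1 - l)) * (1 - b) + (1 - l) * (1 - a) = 1 - ((1 - l) * a + l * b)"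
    by (simp add: algebra_simps)
  ultimately show ?thesis by (simp add: phi_def F_def algebra_simps)
qed

text \<open>Chosen so that \<open>error p L K\<close> times the decrease in
  \<open>barrier_decrease\<close> equals p^2 exp (t L) C, a bound on (-L, K) for the second-order
  term of \<open>v_superharmonic\<close>.\<close>

definition error :: "real \<Rightarrow> nat \<Rightarrow> nat \<Rightarrow> real" where
  "error p L K = p\<^sup>2 * (exp (t * real L) * C * (2 * (real K)\<^sup>2) * exp 1 / pmf D 0)"

context
  fixes p :: real
  assumes p: "0 \<le> p" "p \<le> 1"
begin

lemma unit_valued_Psi': "unit_valued (Psi (1 - p))"
  using p by (intro Psi_unit_valued) auto

lemma left_bounded_v: "left_bounded (v p)"
  unfolding v_def by (rule left_bounded_hat[OF unit_valued_Psi'])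

lemma v_nonneg: "0 \<le> v p x"
  unfolding v_def by (rule hat_nonneg[OF unit_valued_Psi'])

lemma v_le_exp: "v p x \<le> exp (t * of_int x)"
  unfolding v_def by (rule hat_le_exp[OF unit_valued_Psi'])

lemma v_0: "v p 0 = p"
  using p by (simp add: v_def hat_def Psi_0)

lemma v_subharmonic: "x \<noteq> 0 \<Longrightarrow> v p x \<le> Q (v p) x"
  using T_upper_linear[OF unit_valued_Psi', of x] p by (simp add: v_def hat_def Psi_fixed_point)

lemma R_le_Q: "R p \<le> Q (v p) 0"
  using T_upper_linear[OF unit_valued_Psi', of 0] by (simp add: v_def R_def)

text \<open>Holds for every iterate \<open>psin\<close>, whose hat starts as p at 0 and 0 elsewhere;
  a further step is the union bound followed by superharmonicity of g.\<close>

lemma v_le_superharmonic: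
  assumes g: "left_bounded g" "\<And>x. 0 \<le> g x" "g 0 = p" "\<And>x. x \<noteq> 0 \<Longrightarrow> Q g x \<le> g x"
  shows "v p x \<le> g x"
proof -
  have u: "unit_valued (psin (1 - p) n)" for n using p by (intro psin_unit_valued) auto
  have "hat (psin (1 - p) n) x \<le> g x" for n x
  proof (induction n arbitrary: x)
    case 0
    show ?case using g by (simp add: hat_def)
  next
    case (Suc n)
    show ?case
    proof (cases "x = 0")
      case True
      then show ?thesis using g by (simp add: hat_def)
    next
      case False
      then have "hat (psin (1 - p) (Suc n)) x = exp (t * of_int x) * (1 - T (psin (1 - p) n) x)"
        by (simp add: hat_def)
      also have "\<dots> \<le> Q (hat (psin (1 - p) n)) x" by (rule T_upper_linear[OF u])
      also have "\<dots> \<le> Q g x" by (intro Q_mono left_bounded_hat u g Suc)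
      also have "\<dots> \<le> g x" by (rule g(4)[OF False])
      finally show ?thesis .
    qed
  qed
  moreover have "(\<lambda>n. hat (psin (1 - p) n) x) \<longlonglongrightarrow> v p x"
    unfolding v_def hat_def using p by (intro tendsto_intros Psi_tendsto) auto
  ultimately show ?thesis by (intro LIMSEQ_le_const2) auto
qed

lemma v_le: "v p x \<le> p"
  using v_le_superharmonic[of "\<lambda>_. p"] p by (simp add: left_bounded_const)

lemma v_superharmonic: "x \<noteq> 0 \<Longrightarrow> Q (v p) x \<le> v p x + p\<^sup>2 * exp (- t * of_int x) * C"
  using T_lower_linear[OF unit_valued_Psi', of p x] v_le p by (simp add: v_def Psi_fixed_point) (simp add: hat_def)

lemma R_ge_Q: "Q (v p) 0 - p\<^sup>2 * C \<le> R p"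
  using T_lower_linear[OF unit_valued_Psi', of p 0] v_le by (simp add: v_def R_def)

lemma R_bounds: "0 \<le> R p" "R p \<le> p"
proof -
  show "0 \<le> R p" using T_bounds[OF unit_valued_Psi', of 0] by (simp add: R_def)
  have "Q (v p) 0 \<le> Q (\<lambda>_. p) 0" by (intro Q_mono left_bounded_v left_bounded_const v_le)
  then show "R p \<le> p" using R_le_Q by simp
qed

text \<open>First-moment bound: the mean number of first visitors of level n is at most exp (t n),
  and v \<le> p is this bound in tilted coordinates.\<close>

lemma hit_prob_le: "1 - (F ^^ n) (1 - p) \<le> exp (t * real n) * p"
proof -
  have "exp (t * real n) * v p (- int n) \<le> exp (t * real n) * p" by (intro mult_left_mono v_le) auto
  also have "exp (t * real n) * v p (- int n) = 1 - (F ^^ n) (1 - p)"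
    using p by (simp add: v_def hat_def Psi_neg mult.assoc[symmetric] flip: exp_add)
  finally show ?thesis .
qed

text \<open>The comparison function is p times the probability that the walk ever hits 0.\<close>

lemma R_upper_drift:
  assumes u: "(\<lambda>n. U (int n)) \<longlonglongrightarrow> u"
  shows "R p \<le> p * (1 - pmf D 0 / u)"
proof -
  let ?g = "\<lambda>x. p * (1 - U x / u)"
  have lb: "left_bounded ?g" by (intro left_bounded_cmult left_bounded_minimal)
  have Qg: "Q ?g x = p * (1 - Q U x / u)" for x by (simp add: Q_cmult Q_minimal[OF u])
  have "v p x \<le> ?g x" for x
    using U_le_lim[OF u] p
    by (intro v_le_superharmonic lb) (auto simp: Qg Q_U_off divide_le_eq)
  then have "Q (v p) 0 \<le> Q ?g 0" by (intro Q_mono left_bounded_v lb)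
  then show ?thesis using R_le_Q by (simp add: Qg Q_U_0)
qed

text \<open>Below - L the trivial bound v \<le> exp (t x) already gives exp (-t L); above it, p h L
  solves the linear problem with killing at - L. The linearisation is thus trusted only down to -
  L.\<close>

lemma R_upper_critical:
  assumes inf: "filterlim (\<lambda>n. U (int n)) at_top sequentially" and L: "0 < L"
  shows "R p \<le> p * (1 - pmf D 0 / U (int L)) + exp (- t * real L)"
proof -
  define d where "d = exp (- t * real L)"
  have lbU: "left_bounded (\<lambda>x. U x / U (int K))" for K
    using left_bounded_cmult[OF left_bounded_U, of "1 / U (int K)"] by simp
  have main: "v p x - (p * h L x + d) - U x / U (int K) \<le> 0" if K: "0 < K" for x K
  proof (rule max_principle[where e = "\<lambda>x. v p x - (p * h L x + d) - U x / U (int K)" and A = "{- int L<..<int K} - {0}"])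
    show "left_bounded (\<lambda>x. v p x - (p * h L x + d) - U x / U (int K))"
      by (intro left_bounded_intros left_bounded_v left_bounded_h L lbU)
    fix x assume x: "x \<in> {- int L<..<int K} - {0}"
    have "Q (\<lambda>x. v p x - (p * h L x + d) - U x / U (int K)) x =
        Q (\<lambda>x. v p x - (p * h L x + d)) x - Q (\<lambda>x. U x / U (int K)) x"
      by (intro Q_diff left_bounded_intros left_bounded_v left_bounded_h L lbU)
    also have "Q (\<lambda>x. v p x - (p * h L x + d)) x = Q (v p) x - Q (\<lambda>x. p * h L x + d) x"
      by (intro Q_diff left_bounded_intros left_bounded_v left_bounded_h L)
    also have "Q (\<lambda>x. p * h L x + d) x = Q (\<lambda>x. p * h L x) x + Q (\<lambda>x. d) x"
      by (intro Q_add left_bounded_intros left_bounded_h L)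
    also have "Q (\<lambda>x. U x / U (int K)) x = Q U x / U (int K)"
      using Q_cmult[of "1 / U (int K)" U x] by simp
    finally show "v p x - (p * h L x + d) - U x / U (int K) \<le> Q (\<lambda>x. v p x - (p * h L x + d) - U x / U (int K)) x"
      using v_subharmonic[of x] x by (simp add: Q_cmult Q_h Q_U_off)
  next
    fix x assume "x \<notin> {- int L<..<int K} - {0}"
    then consider "x \<le> - int L" | "x = 0" | "int K \<le> x" by fastforce
    then show "v p x - (p * h L x + d) - U x / U (int K) \<le> 0"
    proof cases
      case 1
      have "exp (t * of_int x) \<le> d" using 1 t_pos unfolding d_def by simp (metis mult_left_mono_neg of_int_le_iff of_int_minus of_int_of_nat_eq mult_minus_right mult_left_mono less_imp_le)
      then show ?thesis using v_le_exp[of x] 1 by (simp add: h_low)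
    next
      case 2
      then show ?thesis by (simp add: v_0 h_0 L d_def)
    next
      case 3
      have "1 \<le> U x / U (int K)" using U_mono[OF 3] U_pos[of "int K"] K by simp
      moreover have "0 \<le> p * h L x" using p h_nonneg by simp
      moreover have "0 \<le> d" by (simp add: d_def)
      ultimately show ?thesis using v_le[of x] p by linarith
    qed
  qed auto
  have le: "v p x \<le> p * h L x + d" for x
  proof -
    have "v p x - (p * h L x + d) \<le> 0"
    proof (rule LIMSEQ_le_const[OF U_ratio_small[OF inf, of x]])
      show "\<exists>N. \<forall>K\<ge>N. v p x - (p * h L x + d) \<le> U x / U (int K)"
        using main by (intro exI[of _ 1]) fastforce
    qed
    then show ?thesis by simp
  qed
  have "Q (v p) 0 \<le> Q (\<lambda>x. p * h L x + d) 0"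
    by (intro Q_mono left_bounded_v left_bounded_intros left_bounded_h L le)
  also have "\<dots> = p * Q (h L) 0 + d"
    by (subst Q_add) (auto intro!: left_bounded_intros left_bounded_h L simp: Q_cmult)
  finally show ?thesis using R_le_Q by (simp add: Q_h_0 L d_def)
qed

context
  fixes L K :: nat and \<zeta> :: "int \<Rightarrow> real"
  assumes L: "0 < L" "L \<le> K" and lb: "left_bounded \<zeta>" and nonneg: "\<And>x. 0 \<le> \<zeta> x"
    and sup: "\<And>x. - int L < x \<Longrightarrow> x < int K \<Longrightarrow> x \<noteq> 0 \<Longrightarrow> Q \<zeta> x \<le> \<zeta> x"
    and top: "\<And>x. int K \<le> x \<Longrightarrow> h L x \<le> \<zeta> x"
begin

text \<open>The function \<zeta> pays for the escape to the right of K, the barrier for the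
  second-order error. Both only lower the candidate p h L, which the maximum principle compares with
  v on (-L, K) without 0.\<close>

lemma v_lower: "p * h L x - p * \<zeta> x - error p L K * barrier K x \<le> v p x"
proof -
  let ?c = "error p L K"
  have K: "0 < K" using L by simp
  have c0: "0 \<le> ?c" using C_nonneg up by (simp add: error_def)
  have lbs: "left_bounded (\<lambda>x. p * h L x - p * \<zeta> x)"
    by (intro left_bounded_intros left_bounded_h L lb)
  have "p * h L x - p * \<zeta> x - ?c * barrier K x - v p x \<le> 0"
  proof (rule max_principle[where A = "{- int L<..<int K} - {0}"])
    show "left_bounded (\<lambda>x. p * h L x - p * \<zeta> x - ?c * barrier K x - v p x)"
      by (intro left_bounded_intros left_bounded_h L lb left_bounded_barrier K left_bounded_v)
    fix x assume x: "x \<in> {- int L<..<int K} - {0}"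
    have "Q (\<lambda>x. p * h L x - p * \<zeta> x - ?c * barrier K x - v p x) x =
        Q (\<lambda>x. p * h L x - p * \<zeta> x - ?c * barrier K x) x - Q (v p) x"
      by (intro Q_diff left_bounded_intros left_bounded_h L lb left_bounded_barrier K left_bounded_v)
    also have "Q (\<lambda>x. p * h L x - p * \<zeta> x - ?c * barrier K x) x =
        Q (\<lambda>x. p * h L x - p * \<zeta> x) x - Q (\<lambda>x. ?c * barrier K x) x"
      by (intro Q_diff left_bounded_intros left_bounded_h L lb left_bounded_barrier K)
    also have "Q (\<lambda>x. p * h L x - p * \<zeta> x) x = Q (\<lambda>x. p * h L x) x - Q (\<lambda>x. p * \<zeta> x) x"
      by (intro Q_diff left_bounded_intros left_bounded_h L lb)
    finally have Qe: "Q (\<lambda>x. p * h L x - p * \<zeta> x - ?c * barrier K x - v p x) x =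
        p * h L x - p * Q \<zeta> x - ?c * Q (barrier K) x - Q (v p) x"
      using x by (simp add: Q_cmult Q_h)
    have 1: "p * Q \<zeta> x \<le> p * \<zeta> x" using sup[of x] x p by (intro mult_left_mono) auto
    have 2: "?c * Q (barrier K) x \<le> ?c * (barrier K x - pmf D 0 * exp (- 1) / (2 * (real K)\<^sup>2))"
      using x L K by (intro mult_left_mono barrier_decrease c0) auto
    have 3: "?c * (pmf D 0 * exp (- 1) / (2 * (real K)\<^sup>2)) = p\<^sup>2 * exp (t * real L) * C"
      using up K by (simp add: error_def field_simps exp_minus)
    have "exp (- t * of_int x) \<le> exp (t * real L)"
      using x t_pos mult_left_mono[of "- real_of_int x" "real L" t] by simp
    then have "p\<^sup>2 * exp (- t * of_int x) * C \<le> p\<^sup>2 * exp (t * real L) * C"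
      using C_nonneg by (intro mult_right_mono mult_left_mono) auto
    then show "p * h L x - p * \<zeta> x - ?c * barrier K x - v p x \<le> Q (\<lambda>x. p * h L x - p * \<zeta> x - ?c * barrier K x - v p x) x"
      using 1 2 3 v_superharmonic[of x] x unfolding Qe right_diff_distrib by auto
  next
    fix x assume "x \<notin> {- int L<..<int K} - {0}"
    then consider "x \<le> - int L" | "x = 0" | "int K \<le> x" by fastforce
    then show "p * h L x - p * \<zeta> x - ?c * barrier K x - v p x \<le> 0"
    proof cases
      case 1
      then show ?thesis
        using mult_nonneg_nonneg[OF c0 barrier_bounds(1)[OF K, of x]] mult_nonneg_nonneg[OF p(1) nonneg[of x]] v_nonneg[of x]
        by (simp add: h_low)
    next
      case 2
      then show ?thesis
        using mult_nonneg_nonneg[OF c0 barrier_bounds(1)[OF K, of x]] mult_nonneg_nonneg[OF p(1) nonneg[of x]]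
        by (simp add: h_0 L v_0)
    next
      case 3
      have "p * h L x \<le> p * \<zeta> x" using p top[OF 3] by (intro mult_left_mono)
      then show ?thesis
        using mult_nonneg_nonneg[OF c0 barrier_bounds(1)[OF K, of x]] v_nonneg[of x] by linarith
    qed
  qed auto
  then show ?thesis by simp
qed

lemma R_lower: "p * (1 - pmf D 0 / U (int L)) - p * Q \<zeta> 0 - error p L K * exp 1 - p\<^sup>2 * C \<le> R p"
proof -
  have K: "0 < K" using L by simp
  have c0: "0 \<le> error p L K" using C_nonneg up by (simp add: error_def)
  have "Q (\<lambda>x. p * h L x - p * \<zeta> x - error p L K * exp 1) 0 \<le> Q (v p) 0"
  proof (intro Q_mono left_bounded_intros left_bounded_h L lb left_bounded_v)
    fix y
    have "error p L K * barrier K y \<le> error p L K * exp 1" by (intro mult_left_mono barrier_bounds c0)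
    then show "p * h L y - p * \<zeta> y - error p L K * exp 1 \<le> v p y" using v_lower[of y] by linarith
  qed
  also have "Q (\<lambda>x. p * h L x - p * \<zeta> x - error p L K * exp 1) 0 =
      Q (\<lambda>x. p * h L x - p * \<zeta> x) 0 - Q (\<lambda>x. error p L K * exp 1) 0"
    by (intro Q_diff left_bounded_intros left_bounded_h L lb)
  also have "Q (\<lambda>x. p * h L x - p * \<zeta> x) 0 = Q (\<lambda>x. p * h L x) 0 - Q (\<lambda>x. p * \<zeta> x) 0"
    by (intro Q_diff left_bounded_intros left_bounded_h L lb)
  finally show ?thesis using R_ge_Q by (simp add: Q_cmult Q_h_0 L)
qed

end

end

end

section \<open>Decay of the return probabilities\<close>

lemma stolz_lower:
  fixes y :: "nat \<Rightarrow> real"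
  assumes lim: "(\<lambda>n. y (Suc n) - y n) \<longlonglongrightarrow> l" and a: "a < l"
  shows "\<forall>\<^sub>F n in sequentially. a < y n / real n"
proof -
  obtain a' where a': "a < a'" "a' < l" using dense[OF a] by auto
  obtain N where N: "a' < y (Suc n) - y n" if "n \<ge> N" for n
    using order_tendstoD(1)[OF lim a'(2)] unfolding eventually_sequentially by blast
  have lin: "y N + a' * (real n - real N) \<le> y n" if "n \<ge> N" for n
    using that
  proof (induction n rule: dec_induct)
    case (step n)
    then show ?case using N[of n] by (simp add: algebra_simps)
  qed simp
  have "(\<lambda>n. (y N + a' * (real n - real N)) / real n) \<longlonglongrightarrow> a'" by real_asymp
  from order_tendstoD(1)[OF this a'(1)] eventually_ge_at_top[of N] eventually_gt_at_top[of 0]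
  show ?thesis
  proof eventually_elim
    case (elim n)
    then have "(y N + a' * (real n - real N)) / real n \<le> y n / real n"
      by (intro divide_right_mono lin) auto
    then show ?case using elim by linarith
  qed
qed

text \<open>The Stolz-Cesaro theorem with denominators n. It reduces the asymptotics of ln (ret m),
  or of its square, to one-step increments.\<close>

lemma stolz:
  fixes y :: "nat \<Rightarrow> real"
  assumes lim: "(\<lambda>n. y (Suc n) - y n) \<longlonglongrightarrow> l"
  shows "(\<lambda>n. y n / real n) \<longlonglongrightarrow> l"
proof (rule order_tendstoI)
  fix a assume "l < a"
  have "(\<lambda>n. - y (Suc n) - - y n) \<longlonglongrightarrow> - l" using tendsto_minus[OF lim] by simp
  from stolz_lower[OF this, of "- a"] \<open>l < a\<close>
  show "\<forall>\<^sub>F n in sequentially. y n / real n < a" by simp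
qed (rule stolz_lower[OF lim])

section \<open>Iterates of a concave map whose slope at 0 is at least exp t\<close>

locale concave_iteration =
  fixes \<phi> :: "real \<Rightarrow> real" and t :: real
  assumes range: "\<And>p. 0 \<le> p \<Longrightarrow> p \<le> 1 \<Longrightarrow> 0 \<le> \<phi> p \<and> \<phi> p \<le> 1"
    and mono: "\<And>p p'. 0 \<le> p \<Longrightarrow> p \<le> p' \<Longrightarrow> p' \<le> 1 \<Longrightarrow> \<phi> p \<le> \<phi> p'"
    and concave: "\<And>a b l. 0 \<le> a \<Longrightarrow> a \<le> b \<Longrightarrow> b \<le> 1 \<Longrightarrow> 0 \<le> l \<Longrightarrow> l \<le> 1 \<Longrightarrow>
        (1 - l) * \<phi> a + l * \<phi> b \<le> \<phi> ((1 - l) * a + l * b)"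
    and growth: "\<And>\<eta>. 0 < \<eta> \<Longrightarrow> \<eta> < exp t \<Longrightarrow> \<exists>\<delta>>0. \<delta> \<le> 1 \<and> (\<forall>p. 0 \<le> p \<longrightarrow> p \<le> \<delta> \<longrightarrow> \<eta> * p \<le> \<phi> p)"
    and t_pos: "0 < t"
begin

lemma pow_range: "0 \<le> p \<Longrightarrow> p \<le> 1 \<Longrightarrow> 0 \<le> (\<phi> ^^ n) p \<and> (\<phi> ^^ n) p \<le> 1"
  by (induction n) (auto simp: range)

lemma pow_mono: "0 \<le> p \<Longrightarrow> p \<le> p' \<Longrightarrow> p' \<le> 1 \<Longrightarrow> (\<phi> ^^ n) p \<le> (\<phi> ^^ n) p'"
proof (induction n)
  case (Suc n)
  then show ?case using pow_range[of p n] pow_range[of p' n] by (auto intro!: mono)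
qed simp

text \<open>Chords of a concave function get flatter to the right. Denominators are cleared because
  b = a is allowed.\<close>

lemma slope:
  assumes "0 \<le> d" "d < a" "a \<le> b" "b \<le> 1"
  shows "(\<phi> b - \<phi> a) * (a - d) \<le> (\<phi> a - \<phi> d) * (b - a)"
proof -
  define l where "l = (a - d) / (b - d)"
  have bd: "d < b" "d \<le> a" using assms by (auto intro: less_le_trans)
  have l: "0 \<le> l" using bd by (simp add: l_def)
  have l1: "l \<le> 1" using bd assms by (simp add: l_def)
  have l2: "l * (b - d) = a - d" using bd by (simp add: l_def)
  have "(1 - l) * d + l * b = a" using l2 by (simp add: algebra_simps)
  then have "(1 - l) * \<phi> d + l * \<phi> b \<le> \<phi> a" using concave[of d b l] assms l l1 bd by simp
  then have "((1 - l) * \<phi> d + l * \<phi> b) * (b - d) \<le> \<phi> a * (b - d)" using bd by (intro mult_right_mono) auto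
  moreover have "((1 - l) * \<phi> d + l * \<phi> b) * (b - d) = (b - d) * \<phi> d + (l * (b - d)) * (\<phi> b - \<phi> d)"
    by (simp add: algebra_simps)
  ultimately have "(b - d) * \<phi> d + (a - d) * (\<phi> b - \<phi> d) \<le> \<phi> a * (b - d)"
    unfolding l2 by simp
  moreover have "(\<phi> a - \<phi> d) * (b - a) - (\<phi> b - \<phi> a) * (a - d) =
      \<phi> a * (b - d) - ((b - d) * \<phi> d + (a - d) * (\<phi> b - \<phi> d))"
    by (simp add: algebra_simps)
  ultimately show ?thesis by linarith
qed

text \<open>The orbit of \<delta> increases to a limit l. Beyond its point a j, chords of \<phi> are
  no steeper than the chord from d to a j, whose slope is at most (a (j + 1) - \<eta> d) / (a j -
  d). This tends to (l - \<eta> d) / (l - d), which is below 1 since \<eta> > 1.\<close>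

lemma geometric_contraction:
  assumes \<eta>: "1 < \<eta>" and \<delta>: "0 < \<delta>" "\<delta> \<le> 1" and gr: "\<And>p. 0 \<le> p \<Longrightarrow> p \<le> \<delta> \<Longrightarrow> \<eta> * p \<le> \<phi> p"
  shows "\<exists>C \<rho>. 0 < \<rho> \<and> \<rho> < 1 \<and> (\<forall>j. (\<phi> ^^ j) 1 - (\<phi> ^^ j) \<delta> \<le> C * \<rho> ^ j)"
proof -
  define a where "a j = (\<phi> ^^ j) \<delta>" for j
  define b where "b j = (\<phi> ^^ j) 1" for j
  define d where "d = \<delta> / 2"
  have d: "0 < d" "d < \<delta>" using \<delta> by (auto simp: d_def)
  have ab: "a j \<le> b j" "0 \<le> a j" "b j \<le> 1" for j
    using pow_mono[of \<delta> 1 j] pow_range[of \<delta> j] pow_range[of 1 j] \<delta> by (auto simp: a_def b_def)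
  have "1 * \<delta> \<le> \<eta> * \<delta>" using \<eta> \<delta> by (intro mult_right_mono) auto
  moreover have "\<eta> * \<delta> \<le> \<phi> \<delta>" using gr[of \<delta>] \<delta> by simp
  ultimately have "\<delta> \<le> \<phi> \<delta>" by linarith
  then have inc: "a j \<le> a (Suc j)" for j
    using pow_mono[of \<delta> "\<phi> \<delta>" j] \<delta> range[of \<delta>] by (simp add: a_def funpow_swap1)
  then have "incseq a" by (rule incseq_SucI)
  then obtain l where l: "a \<longlonglongrightarrow> l" "\<And>j. a j \<le> l"
    using incseq_convergent[of a 1] ab order_trans by metis
  have al: "\<delta> \<le> a j" for j using incseqD[OF \<open>incseq a\<close>, of 0 j] by (simp add: a_def)
  have ld: "d < l" using al[of 0] l(2)[of 0] d by linarith
  define x where "x = (l - \<eta> * d) / (l - d)"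
  have lim: "(\<lambda>j. (a (Suc j) - \<eta> * d) / (a j - d)) \<longlonglongrightarrow> x"
    unfolding x_def using ld by (intro tendsto_intros LIMSEQ_Suc l) auto
  have x1: "x < 1" using ld d \<eta> by (simp add: x_def field_simps)
  define \<rho> where "\<rho> = max (1 / 2) ((1 + x) / 2)"
  have \<rho>: "0 < \<rho>" "\<rho> < 1" "x < \<rho>"
    using x1 unfolding \<rho>_def by (auto simp: less_max_iff_disj)
  from order_tendstoD(2)[OF lim \<rho>(3)]
obtain J where J: "(a (Suc j) - \<eta> * d) / (a j - d) < \<rho>" if "j \<ge> J" for j
    unfolding eventually_sequentially by blast
  have contract: "b (Suc j) - a (Suc j) \<le> \<rho> * (b j - a j)" if "j \<ge> J" for j
  proof -
    have aj: "0 < a j - d" using al[of j] d by linarith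
    have "(b (Suc j) - a (Suc j)) * (a j - d) \<le> (a (Suc j) - \<phi> d) * (b j - a j)"
      using slope[of d "a j" "b j"] aj d ab[of j] by (simp add: a_def b_def)
    also have "\<dots> \<le> (a (Suc j) - \<eta> * d) * (b j - a j)"
      using gr[of d] d ab[of j] by (intro mult_right_mono) auto
    also have "\<dots> \<le> (\<rho> * (a j - d)) * (b j - a j)"
      using J[OF that] aj ab[of j] by (intro mult_right_mono) (auto simp: divide_less_eq)
    finally have "(b (Suc j) - a (Suc j)) * (a j - d) \<le> (\<rho> * (b j - a j)) * (a j - d)"
      by (simp add: mult_ac)
    then show ?thesis using aj by simp
  qed
  \<comment> \<open>The factor 1 / \<rho> ^ J covers the first J indices, where the gap is only
    known to be at most 1.\<close>
  have "b j - a j \<le> (1 / \<rho> ^ J) * \<rho> ^ j" for j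
  proof (cases "j \<ge> J")
    case True
    then show ?thesis
    proof (induction j rule: dec_induct)
      case base
      show ?case using ab[of J] \<rho> by simp
    next
      case (step n)
      have "b (Suc n) - a (Suc n) \<le> \<rho> * (b n - a n)" by (rule contract[OF step(1)])
      also have "\<dots> \<le> \<rho> * ((1 / \<rho> ^ J) * \<rho> ^ n)" using step \<rho> by (intro mult_left_mono) auto
      finally show ?case by (simp add: mult_ac)
    qed
  next
    case False
    have "b j - a j \<le> 1" using ab[of j] by linarith
    also have "1 \<le> (1 / \<rho> ^ J) * \<rho> ^ j"
      using power_decreasing[of j J \<rho>] False \<rho> by (simp add: field_simps)
    finally show ?thesis .
  qed
  then show ?thesis using \<rho> unfolding a_def b_def by blast
qed

text \<open>The n iterations are split: n - n div c of them lift P n from exp (-(t - e) n) to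
  \<delta> at rate \<eta> = exp (t - e / 2), and the last n div c contract the gap
  geometrically.\<close>

lemma summable_gap:
  assumes e: "0 < e" "e < t" and P: "\<And>n. 0 \<le> P n" "\<And>n. P n \<le> 1"
    and low: "\<forall>\<^sub>F n in sequentially. exp (- (t - e) * real n) \<le> P n"
  shows "summable (\<lambda>n. (\<phi> ^^ n) 1 - (\<phi> ^^ n) (P n))"
proof -
  define \<eta> where "\<eta> = exp (t - e / 2)"
  have \<eta>: "1 < \<eta>" "0 < \<eta>" "\<eta> < exp t" using e t_pos by (auto simp: \<eta>_def)
  obtain \<delta> where \<delta>: "0 < \<delta>" "\<delta> \<le> 1" and gr: "\<And>p. 0 \<le> p \<Longrightarrow> p \<le> \<delta> \<Longrightarrow> \<eta> * p \<le> \<phi> p"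
    using growth[OF \<eta>(2,3)] by auto
  obtain C \<rho> where \<rho>: "0 < \<rho>" "\<rho> < 1" and C: "\<And>j. (\<phi> ^^ j) 1 - (\<phi> ^^ j) \<delta> \<le> C * \<rho> ^ j"
    using geometric_contraction[OF \<eta>(1) \<delta> gr] by auto
  have C0: "0 \<le> C" using C[of 0] \<delta> by simp
  have grow: "min \<delta> (\<eta> ^ k * p) \<le> (\<phi> ^^ k) p" if "0 \<le> p" "p \<le> 1" for k p
  proof (induction k)
    case (Suc k)
    define a where "a = min \<delta> (\<eta> ^ k * p)"
    have a: "0 \<le> a" "a \<le> \<delta>" using \<delta> \<eta> that by (auto simp: a_def)
    have "\<phi> a \<le> \<phi> ((\<phi> ^^ k) p)" using Suc a pow_range[OF that, of k] by (intro mono) (auto simp: a_def)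
    moreover have "\<eta> * a \<le> \<phi> a" by (rule gr[OF a])
    moreover have "min \<delta> (\<eta> ^ Suc k * p) \<le> \<eta> * a"
    proof (cases "\<delta> \<le> \<eta> ^ k * p")
      case True
      have "1 * \<delta> \<le> \<eta> * \<delta>" using \<eta> \<delta> by (intro mult_right_mono) auto
      moreover have "a = \<delta>" using True by (simp add: a_def)
      ultimately show ?thesis by (simp add: min.coboundedI1)
    next
      case False
      then show ?thesis by (simp add: a_def min_def mult_ac)
    qed
    ultimately show ?case by simp
  qed (use \<delta> in simp)
  \<comment> \<open>Since c \<ge> 2 t / e, giving up a fraction 1 / c of the growth costs at most e
    n / 2 in the exponent, which is the margin between \<eta> and exp (t - e).\<close>
  define c where "c = Suc (nat \<lceil>2 * t / e\<rceil>)"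
  have c: "0 < c" "2 * t / e \<le> real c" unfolding c_def by (auto, linarith)
  define r where "r = \<rho> powr (1 / real c)"
  have r: "0 < r" "r < 1" using \<rho> c by (simp_all add: r_def powr_def divide_neg_pos)
  have bound: "(\<phi> ^^ n) 1 - (\<phi> ^^ n) (P n) \<le> (C / \<rho>) * r ^ n" if low: "exp (- (t - e) * real n) \<le> P n" for n
  proof -
    define j where "j = n div c"
    have jn: "j \<le> n" by (simp add: j_def)
    have jc: "real j \<le> real n / real c" unfolding j_def by (rule of_nat_div_le_of_nat)
    have jc': "real n / real c - 1 \<le> real j" 
    proof -
      have "real n = real c * real j + real (n mod c)"
        unfolding j_def of_nat_mult[symmetric] of_nat_add[symmetric] by simp
      moreover have "real (n mod c) \<le> real c" using c by (simp add: less_imp_le)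
      ultimately show ?thesis using c by (simp add: field_simps)
    qed
    have "\<delta> \<le> (\<phi> ^^ (n - j)) (P n)"
    proof -
      have "(t - e / 2) / real c \<le> e / 2"
      proof -
        have "t - e / 2 \<le> t" using e by simp
        then have "(t - e / 2) / real c \<le> t / real c" using c by (intro divide_right_mono) auto
        also have "\<dots> \<le> e / 2" using c e by (simp add: field_simps)
        finally show ?thesis .
      qed
      then have "(t - e / 2) / real c * real n \<le> e / 2 * real n" by (intro mult_right_mono) auto
      moreover have "(t - e / 2) * (real n - real n / real c) \<le> (t - e / 2) * real (n - j)"
        using jc jn e by (intro mult_left_mono) (auto simp: of_nat_diff)
      moreover have "(t - e / 2) * (real n - real n / real c) = (t - e / 2) * real n - (t - e / 2) / real c * real n"
        by (simp add: right_diff_distrib)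
      moreover have "(t - e / 2) * real n = (t - e) * real n + e / 2 * real n"
        by (simp add: algebra_simps)
      ultimately have "0 \<le> (t - e / 2) * real (n - j) - (t - e) * real n" by linarith
      then have "1 \<le> exp ((t - e / 2) * real (n - j) - (t - e) * real n)" by simp
      also have "\<dots> = \<eta> ^ (n - j) * exp (- (t - e) * real n)"
      proof -
        have "\<eta> ^ (n - j) = exp ((t - e / 2) * real (n - j))"
          by (simp add: \<eta>_def exp_of_nat_mult[symmetric] mult.commute)
        then show ?thesis by (simp add: exp_add[symmetric] algebra_simps)
      qed
      also have "\<dots> \<le> \<eta> ^ (n - j) * P n" using low \<eta> by (intro mult_left_mono) auto
      finally have "min \<delta> (\<eta> ^ (n - j) * P n) = \<delta>" using \<delta> by simp
      then show ?thesis using grow[OF P(1)[of n] P(2)[of n], of "n - j"] by simp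
    qed
    then have "(\<phi> ^^ j) \<delta> \<le> (\<phi> ^^ j) ((\<phi> ^^ (n - j)) (P n))"
      using \<delta> pow_range[OF P(1)[of n] P(2)[of n], of "n - j"] by (intro pow_mono) auto
    also have "\<dots> = (\<phi> ^^ n) (P n)" using jn by (simp add: funpow_add[symmetric, THEN fun_cong, unfolded o_apply])
    finally have "(\<phi> ^^ j) \<delta> \<le> (\<phi> ^^ n) (P n)" .
    moreover have "(\<phi> ^^ n) 1 = (\<phi> ^^ j) ((\<phi> ^^ (n - j)) 1)"
      using jn by (simp add: funpow_add[symmetric, THEN fun_cong, unfolded o_apply])
    then have "(\<phi> ^^ n) 1 \<le> (\<phi> ^^ j) 1"
      using pow_range[of 1 "n - j"] pow_mono[of "(\<phi> ^^ (n - j)) 1" 1 j] by simp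
    ultimately have "(\<phi> ^^ n) 1 - (\<phi> ^^ n) (P n) \<le> C * \<rho> ^ j" using C[of j] by linarith
    also have "\<rho> ^ j \<le> \<rho> powr (real n / real c - 1)"
      using \<rho> jc' by (simp add: powr_realpow[symmetric] powr_mono')
    also have "\<rho> powr (real n / real c - 1) = r ^ n / \<rho>"
      using \<rho> by (simp add: r_def powr_diff powr_powr powr_realpow[symmetric] mult.commute)
    finally show ?thesis using C0 by (simp add: mult_left_mono)
  qed
  show ?thesis
  proof (rule summable_comparison_test_ev)
    show "summable (\<lambda>n. (C / \<rho>) * r ^ n)" using r by (intro summable_mult summable_geometric) auto
    show "\<forall>\<^sub>F n in sequentially. norm ((\<phi> ^^ n) 1 - (\<phi> ^^ n) (P n)) \<le> (C / \<rho>) * r ^ n"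
      using low
    proof eventually_elim
      case (elim n)
      then show ?case using bound[of n] pow_mono[of "P n" 1 n] P by simp
    qed
  qed
qed

end

lemma linear_rounding:
  fixes L :: "real \<Rightarrow> nat" and \<alpha> :: real
  assumes \<alpha>: "0 < \<alpha>" and L: "\<And>y. 0 \<le> y \<Longrightarrow> \<bar>real (L y) - \<alpha> * y\<bar> \<le> 1"
  shows "filterlim L sequentially at_top" "((\<lambda>y. y / real (L y)) \<longlongrightarrow> 1 / \<alpha>) at_top"
proof -
  have b: "\<forall>\<^sub>F y in at_top. \<alpha> * y - 1 \<le> real (L y) \<and> real (L y) \<le> \<alpha> * y + 1"
    using eventually_ge_at_top[of 0] by eventually_elim (use L in \<open>fastforce simp: abs_le_iff\<close>)
  have "filterlim (\<lambda>y. \<alpha> * y - 1) at_top at_top" using \<alpha> by real_asymp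
  then have "filterlim (\<lambda>y. real (L y)) at_top at_top"
    by (rule filterlim_at_top_mono) (use b in eventually_elim, simp)
  then show fl: "filterlim L sequentially at_top"
    by (simp add: filterlim_sequentially_iff_filterlim_real)
  have "((\<lambda>y. real (L y) / y) \<longlongrightarrow> \<alpha>) at_top"
  proof (rule tendsto_sandwich)
    show "((\<lambda>y. (\<alpha> * y - 1) / y) \<longlongrightarrow> \<alpha>) at_top" "((\<lambda>y. (\<alpha> * y + 1) / y) \<longlongrightarrow> \<alpha>) at_top"
      by real_asymp+
    show "\<forall>\<^sub>F y in at_top. (\<alpha> * y - 1) / y \<le> real (L y) / y"
      using b eventually_gt_at_top[of 0] by eventually_elim (auto intro!: divide_right_mono)
    show "\<forall>\<^sub>F y in at_top. real (L y) / y \<le> (\<alpha> * y + 1) / y"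
      using b eventually_gt_at_top[of 0] by eventually_elim (auto intro!: divide_right_mono)
  qed
  from tendsto_inverse[OF this] \<alpha> show "((\<lambda>y. y / real (L y)) \<longlongrightarrow> 1 / \<alpha>) at_top"
    by (simp add: inverse_eq_divide)
qed

section \<open>Cut-off functions and lower bounds for small p\<close>

context skip_free_walk begin

lemma U_dichotomy:
  obtains u where "(\<lambda>n. U (int n)) \<longlonglongrightarrow> u" | "filterlim (\<lambda>n. U (int n)) at_top sequentially"
proof (cases "\<exists>B. \<forall>n. U (int n) \<le> B")
  case True
  then obtain B where B: "\<And>n. U (int n) \<le> B" by auto
  have "incseq (\<lambda>n. U (int n))" by (intro incseq_SucI U_mono) simp
  from incseq_convergent[OF this, of B] B show ?thesis using that(1) by blast
next
  case False
  have "filterlim (\<lambda>n. U (int n)) at_top sequentially"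
    unfolding filterlim_at_top eventually_sequentially
  proof
    fix Z
    obtain N where "Z < U (int N)" using False by (meson not_le)
    then show "\<exists>N. \<forall>n\<ge>N. Z \<le> U (int n)"
      using U_mono[of "int N"] by (intro exI[of _ N]) (metis of_nat_le_iff less_imp_le order_trans)
  qed
  then show ?thesis by (rule that(2))
qed

lemma U_ratio_superharmonic:
  fixes K :: nat
  assumes "0 < L" "0 < K"
  defines "\<zeta> \<equiv> \<lambda>x. U x / U (int K)"
  shows "left_bounded \<zeta>" "\<And>x. 0 \<le> \<zeta> x" "\<And>x. x \<noteq> 0 \<Longrightarrow> Q \<zeta> x \<le> \<zeta> x"
    "\<And>x. int K \<le> x \<Longrightarrow> h L x \<le> \<zeta> x" "Q \<zeta> 0 = pmf D 0 / U (int K)" "\<zeta> (- 1) = 0"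
proof -
  have Q\<zeta>: "Q \<zeta> x = Q U x / U (int K)" for x
    using Q_cmult[of "1 / U (int K)" U x] by (simp add: \<zeta>_def)
  show "left_bounded \<zeta>" using left_bounded_cmult[OF left_bounded_U, of "1 / U (int K)"] by (simp add: \<zeta>_def)
  show "0 \<le> \<zeta> x" for x by (simp add: \<zeta>_def U_nonneg)
  show "Q \<zeta> x \<le> \<zeta> x" if "x \<noteq> 0" for x by (simp add: Q\<zeta> Q_U_off that) (simp add: \<zeta>_def)
  show "Q \<zeta> 0 = pmf D 0 / U (int K)" by (simp add: Q\<zeta> Q_U_0)
  show "\<zeta> (- 1) = 0" by (simp add: \<zeta>_def)
  show "h L x \<le> \<zeta> x" if "int K \<le> x" for x
    using h_le_1[OF assms(1), of x] U_mono[OF that] U_pos[of "int K"] assms(2)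
    by (simp add: \<zeta>_def le_divide_eq)
      (meson mult_left_le_one_le h_nonneg order_trans U_nonneg mult_right_mono)
qed

text \<open>Two regimes. A bounded \<open>U\<close> makes h small far to the right, so that a
  constant serves; for an unbounded one U / U K is small near 0 and at least 1 beyond K.\<close>

lemma exists_cutoff:
  assumes L: "0 < L" and e: "0 < e"
  obtains K \<zeta> where "L \<le> K" "left_bounded \<zeta>" "\<And>x. 0 \<le> \<zeta> x" "\<And>x. x \<noteq> 0 \<Longrightarrow> Q \<zeta> x \<le> \<zeta> x"
    "\<And>x. int K \<le> x \<Longrightarrow> h L x \<le> \<zeta> x" "Q \<zeta> 0 \<le> e" "\<zeta> (- 1) \<le> e"
proof (cases rule: U_dichotomy)
  case (1 u)
  obtain K where K: "0 < K" "\<And>x. int K \<le> x \<Longrightarrow> h L x \<le> e"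
    using h_small_at_infinity[OF 1 L e] by auto
  show ?thesis
    by (rule that[of "max K L" "\<lambda>_. e"]) (use K e in \<open>auto simp: left_bounded_const\<close>)
next
  case 2
  have "(\<lambda>n. pmf D 0 / U (int n)) \<longlonglongrightarrow> 0"
    by (intro tendsto_divide_0[OF tendsto_const] filterlim_at_top_imp_at_infinity 2)
  from order_tendstoD(2)[OF this e] obtain N where N: "pmf D 0 / U (int n) < e" if "n \<ge> N" for n
    unfolding eventually_sequentially by blast
  have K: "0 < max N L" using L by simp
  note z = U_ratio_superharmonic[OF L K]
  show ?thesis
    by (rule that[of "max N L" "\<lambda>x. U x / U (int (max N L))"])
      (use z N[of "max N L"] e in auto)
qed

text \<open>With nonnegative drift the walk from -1 surely reaches 0. For unbounded
  \<open>U\<close>, subadditivity bounds the last increment by U 1 = 1.\<close>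

lemma h_minus_1_tendsto: "(\<lambda>L. h L (- 1)) \<longlonglongrightarrow> 1"
proof (cases rule: U_dichotomy)
  case (1 u)
  then show ?thesis using h_tendsto[OF 1, of "- 1"] by simp
next
  case 2
  have "(\<lambda>n. 1 - 1 / U (int n)) \<longlonglongrightarrow> 1 - 0"
    by (intro tendsto_intros tendsto_divide_0[OF tendsto_const] filterlim_at_top_imp_at_infinity 2)
  then have l: "(\<lambda>n. 1 - 1 / U (int n)) \<longlonglongrightarrow> 1" by simp
  show ?thesis
  proof (rule tendsto_sandwich[OF _ _ l tendsto_const])
    have "1 - 1 / U (int n) \<le> h n (- 1)" if "0 < n" for n
    proof -
      have "U (int n) \<le> U (int n - 1) + 1" using U_subadditive[of "int n - 1" 1] that by simp
      then have "(U (int n) - 1) / U (int n) \<le> U (int n - 1) / U (int n)"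
        using U_pos[of "int n"] that by (intro divide_right_mono) auto
      then show ?thesis using U_pos[of "int n"] that by (simp add: h_def diff_divide_distrib)
    qed
    then show "\<forall>\<^sub>F n in sequentially. 1 - 1 / U (int n) \<le> h n (- 1)"
      by (intro eventually_sequentiallyI[of 1]) auto
    show "\<forall>\<^sub>F n in sequentially. h n (- 1) \<le> 1"
      by (intro eventually_sequentiallyI[of 1] h_le_1) auto
  qed
qed

end

context offspring begin

lemma error_eq: "\<exists>c\<ge>0. \<forall>p. error p L K = p\<^sup>2 * c"
  using C_nonneg up unfolding error_def by (intro exI[of _ "exp (t * real L) * C * (2 * (real K)\<^sup>2) * exp 1 / pmf D 0"]) auto

lemma quadratic_absorb:
  fixes c e :: real
  assumes "0 \<le> c" "0 < e"
  obtains \<delta> where "0 < \<delta>" "\<delta> \<le> 1" "\<And>p. 0 \<le> p \<Longrightarrow> p \<le> \<delta> \<Longrightarrow> p\<^sup>2 * c \<le> p * e"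
proof (rule that[of "min 1 (e / (c + 1))"])
  fix p assume p: "0 \<le> p" "p \<le> min 1 (e / (c + 1))"
  have "p * c \<le> e / (c + 1) * c" using p assms by (intro mult_right_mono) auto
  also have "\<dots> \<le> e" using assms by (simp add: field_simps)
  finally show "p\<^sup>2 * c \<le> p * e" using p by (simp add: power2_eq_square mult.assoc mult_left_mono)
qed (use assms in auto)

text \<open>L and K are frozen before p is chosen, so the second-order error is a constant times p^2
  and is absorbed for small p.\<close>

lemma R_lower_near_0:
  assumes L: "0 < L" and e: "0 < e"
  obtains \<delta> where "0 < \<delta>" "\<delta> \<le> 1" "\<And>p. 0 \<le> p \<Longrightarrow> p \<le> \<delta> \<Longrightarrow> p * (1 - pmf D 0 / U (int L) - e) \<le> R p"
proof -
  have "0 < e / 2" using e by simp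
  from exists_cutoff[OF L this] obtain K \<zeta> where z: "L \<le> K" "left_bounded \<zeta>" "\<And>x. 0 \<le> \<zeta> x" "\<And>x. x \<noteq> 0 \<Longrightarrow> Q \<zeta> x \<le> \<zeta> x"
    "\<And>x. int K \<le> x \<Longrightarrow> h L x \<le> \<zeta> x" "Q \<zeta> 0 \<le> e / 2" by metis
  obtain c where c: "0 \<le> c" "\<And>p. error p L K = p\<^sup>2 * c" using error_eq by metis
  obtain \<delta> where \<delta>: "0 < \<delta>" "\<delta> \<le> 1" "\<And>p. 0 \<le> p \<Longrightarrow> p \<le> \<delta> \<Longrightarrow> p\<^sup>2 * (c * exp 1 + C) \<le> p * (e / 2)"
    using quadratic_absorb[of "c * exp 1 + C" "e / 2"] c C_nonneg e by auto
  show ?thesis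
  proof (rule that[OF \<delta>(1,2)])
    fix p assume p: "0 \<le> p" "p \<le> \<delta>"
    have "p * (1 - pmf D 0 / U (int L)) - p * Q \<zeta> 0 - error p L K * exp 1 - p\<^sup>2 * C \<le> R p"
      using p \<delta> by (intro R_lower L z) auto
    moreover have "p * Q \<zeta> 0 \<le> p * (e / 2)" using p z by (intro mult_left_mono)
    ultimately show "p * (1 - pmf D 0 / U (int L) - e) \<le> R p"
      using \<delta>(3)[OF p] by (simp add: c algebra_simps)
  qed
qed

text \<open>phi p is exp t times v p (-1), and v p (-1) is close to p h L (-1), hence to p. The
  available fraction 3 e is spent on h, on \<zeta> and on the quadratic error.\<close>

lemma phi_growth:
  assumes \<eta>: "0 < \<eta>" "\<eta> < exp t"
  shows "\<exists>\<delta>>0. \<delta> \<le> 1 \<and> (\<forall>p. 0 \<le> p \<longrightarrow> p \<le> \<delta> \<longrightarrow> \<eta> * p \<le> phi p)"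
proof -
  define r where "r = \<eta> * exp (- t)"
  have r: "r < 1" "0 < r" using \<eta> by (auto simp: r_def exp_minus field_simps)
  define e where "e = (1 - r) / 3"
  have e: "0 < e" "r + 3 * e = 1" using r by (simp_all add: e_def diff_divide_distrib)
  have "\<forall>\<^sub>F L in sequentially. r + 2 * e < h L (- 1)"
    using order_tendstoD(1)[OF h_minus_1_tendsto, of "r + 2 * e"] e by simp
  then obtain N where "\<forall>L\<ge>N. r + 2 * e < h L (- 1)" unfolding eventually_sequentially by blast
  then obtain L where L: "0 < L" "r + 2 * e < h L (- 1)" by (meson le_SucI order_refl zero_less_Suc)
  from exists_cutoff[OF L(1) e(1)] obtain K \<zeta> where z: "L \<le> K" "left_bounded \<zeta>" "\<And>x. 0 \<le> \<zeta> x" "\<And>x. x \<noteq> 0 \<Longrightarrow> Q \<zeta> x \<le> \<zeta> x"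
    "\<And>x. int K \<le> x \<Longrightarrow> h L x \<le> \<zeta> x" "\<zeta> (- 1) \<le> e" by metis
  obtain c where c: "0 \<le> c" "\<And>p. error p L K = p\<^sup>2 * c" using error_eq by metis
  obtain \<delta> where \<delta>: "0 < \<delta>" "\<delta> \<le> 1" "\<And>p. 0 \<le> p \<Longrightarrow> p \<le> \<delta> \<Longrightarrow> p\<^sup>2 * (c * exp 1) \<le> p * e"
    using quadratic_absorb[of "c * exp 1" e] c e by auto
  have "\<eta> * p \<le> phi p" if p: "0 \<le> p" "p \<le> \<delta>" for p
  proof -
    have p1: "p \<le> 1" using p \<delta> by linarith
    have "p * h L (- 1) - p * \<zeta> (- 1) - error p L K * barrier K (- 1) \<le> v p (- 1)"
      by (rule v_lower[OF p(1) p1]) (use L z in auto)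
    moreover have "p * \<zeta> (- 1) \<le> p * e" using p z by (intro mult_left_mono)
    moreover have "p * (r + 2 * e) \<le> p * h L (- 1)" using p L by (intro mult_left_mono) auto
    moreover have "error p L K * barrier K (- 1) \<le> p\<^sup>2 * (c * exp 1)"
      using c barrier_bounds(2)[of K "- 1"] by (simp add: mult.assoc mult_left_mono)
    ultimately have "p * r \<le> v p (- 1)" using \<delta>(3)[OF p] by (simp add: algebra_simps)
    also have "v p (- 1) = exp (- t) * phi p" by (simp add: v_def hat_def phi_def F_def)
    finally have "exp t * (p * r) \<le> exp t * (exp (- t) * phi p)" by (intro mult_left_mono) auto
    moreover have "exp t * (p * r) = (exp t * exp (- t)) * (\<eta> * p)" by (simp only: r_def mult_ac)
    moreover have "exp t * (exp (- t) * phi p) = (exp t * exp (- t)) * phi p" by (simp only: mult.assoc)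
    ultimately show ?thesis by (simp only: exp_minus_inverse mult_1_left)
  qed
  then show ?thesis using \<delta> by blast
qed

sublocale phi: concave_iteration phi t
  by unfold_locales (use phi_bounds phi_mono phi_concave phi_growth t_pos in auto)

lemma R_mono: "0 \<le> p \<Longrightarrow> p \<le> p' \<Longrightarrow> p' \<le> 1 \<Longrightarrow> R p \<le> R p'"
  unfolding R_def by (intro diff_left_mono T_mono Psi_unit_valued Psi_mono) auto

text \<open>For small p the bound with L = 1 has the positive factor 1 - pmf D 0 - e; monotonicity
  of \<open>R\<close> carries positivity to all p.\<close>

lemma R_pos:
  assumes lt: "pmf D 0 < 1" and p: "0 < p" "p \<le> 1"
  shows "0 < R p"
proof -
  define e where "e = (1 - pmf D 0) / 2"
  have e: "0 < e" "0 < 1 - pmf D 0 / U (int 1) - e" using lt by (auto simp: e_def)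
  obtain \<delta> where \<delta>: "0 < \<delta>" "\<delta> \<le> 1" "\<And>p. 0 \<le> p \<Longrightarrow> p \<le> \<delta> \<Longrightarrow> p * (1 - pmf D 0 / U (int 1) - e) \<le> R p"
    using R_lower_near_0[of 1, OF _ e(1)] by (metis zero_less_one)
  have "0 < min p \<delta> * (1 - pmf D 0 / U (int 1) - e)" using \<delta> p e by (intro mult_pos_pos) auto
  also have "\<dots> \<le> R (min p \<delta>)" using \<delta> p by (intro \<delta>(3)) auto
  also have "\<dots> \<le> R p" using p \<delta> by (intro R_mono) auto
  finally show ?thesis .
qed

section \<open>Probabilities of m successive returns\<close>

definition ret :: "nat \<Rightarrow> real" where
  "ret m = (R ^^ m) 1"

lemma ret_0 [simp]: "ret 0 = 1" and ret_Suc: "ret (Suc m) = R (ret m)"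
  by (auto simp: ret_def)

lemma ret_bounds: "0 \<le> ret m \<and> ret m \<le> 1"
proof (induction m)
  case (Suc m)
  then show ?case using R_bounds[of "ret m"] by (auto simp: ret_Suc)
qed simp

lemma ret_decreasing: "ret (Suc m) \<le> ret m"
  using R_bounds(2)[of "ret m"] ret_bounds[of m] by (simp add: ret_Suc)

lemma ret_pos: "pmf D 0 < 1 \<Longrightarrow> 0 < ret m"
proof (induction m)
  case (Suc m)
  then show ?case using R_pos[of "ret m"] ret_bounds[of m] by (simp add: ret_Suc)
qed simp

text \<open>The upper bound R p \<le> q p holds for all p and drives \<open>ret\<close> to 0; there
  the lower bound takes over, and the ratio of consecutive terms tends to q.\<close>

lemma log_ret_drift:
  assumes u: "(\<lambda>n. U (int n)) \<longlonglongrightarrow> u" and lt: "pmf D 0 < 1" and q: "q = 1 - pmf D 0 / u"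
  shows "(\<lambda>m. - ln (ret m) / real m) \<longlonglongrightarrow> - ln q"
proof (rule stolz)
  have u1: "1 \<le> u" by (rule U_le_lim(2)[OF u])
  have q01: "0 < q" "q < 1"
  proof -
    have "pmf D 0 / u \<le> pmf D 0" using u1 up by (simp add: divide_le_eq mult_left_le)
    then show "0 < q" "q < 1" using lt up u1 by (auto simp: q)
  qed
  have pos: "0 < ret m" for m by (rule ret_pos[OF lt])
  have Rq: "R (ret m) \<le> ret m * q" for m
    using R_upper_drift[OF _ _ u, of "ret m"] ret_bounds[of m] by (simp add: q)
  have "ret m \<le> q ^ m" for m
  proof (induction m)
    case (Suc m)
    then have "ret m * q \<le> q ^ m * q" using q01 by (intro mult_right_mono) auto
    then show ?case using Rq[of m] by (simp add: ret_Suc mult.commute)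
  qed simp
  then have lim0: "ret \<longlonglongrightarrow> 0"
    using ret_bounds q01 by (intro tendsto_sandwich[OF _ _ tendsto_const LIMSEQ_power_zero[of q]]) (auto intro!: always_eventually)
  have ratio: "(\<lambda>m. R (ret m) / ret m) \<longlonglongrightarrow> q"
  proof (rule order_tendstoI)
    fix a assume "q < a"
    have "R (ret m) / ret m < a" for m
    proof -
      have "ret m * q < ret m * a" using pos[of m] \<open>q < a\<close> by (intro mult_strict_left_mono)
      with Rq[of m] have "R (ret m) < ret m * a" by (rule le_less_trans)
      then show ?thesis using pos[of m] by (simp add: divide_less_eq mult.commute)
    qed
    then show "\<forall>\<^sub>F m in sequentially. R (ret m) / ret m < a" by simp
  next
    fix a assume a: "a < q"
    define e where "e = (q - a) / 3"
    have e: "0 < e" "a + 3 * e = q" using a by (auto simp: e_def diff_divide_distrib)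
    have "(\<lambda>L. 1 - pmf D 0 / U (int L)) \<longlonglongrightarrow> q"
      unfolding q using u1 by (intro tendsto_intros u) auto
    then have "\<forall>\<^sub>F L in sequentially. q - e < 1 - pmf D 0 / U (int L)"
      using e order_tendstoD(1)[of _ q _ "q - e"] by simp
    then obtain N where "\<forall>L\<ge>N. q - e < 1 - pmf D 0 / U (int L)" unfolding eventually_sequentially by blast
    then obtain L where L: "0 < L" "q - e < 1 - pmf D 0 / U (int L)" by (meson le_SucI order_refl zero_less_Suc)
    obtain \<delta> where \<delta>: "0 < \<delta>" "\<delta> \<le> 1" "\<And>p. 0 \<le> p \<Longrightarrow> p \<le> \<delta> \<Longrightarrow> p * (1 - pmf D 0 / U (int L) - e) \<le> R p"
      using R_lower_near_0[OF L(1) e(1)] by metis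
    show "\<forall>\<^sub>F m in sequentially. a < R (ret m) / ret m"
      using order_tendstoD(2)[OF lim0 \<delta>(1)]
    proof eventually_elim
      case (elim m)
      have "ret m * a < ret m * (1 - pmf D 0 / U (int L) - e)"
        using pos[of m] L e by (intro mult_strict_left_mono) auto
      also have "\<dots> \<le> R (ret m)" using pos[of m] elim by (intro \<delta>(3)) auto
      finally show ?case using pos[of m] by (simp add: less_divide_eq mult.commute)
    qed
  qed
  have "(\<lambda>m. - ln (R (ret m) / ret m)) \<longlonglongrightarrow> - ln q"
    using q01 by (intro tendsto_intros ratio) auto
  moreover have "- ln (R (ret m) / ret m) = - ln (ret (Suc m)) - - ln (ret m)" for m
    using pos[of m] pos[of "Suc m"] by (simp add: ret_Suc ln_div)
  ultimately show "(\<lambda>m. - ln (ret (Suc m)) - - ln (ret m)) \<longlonglongrightarrow> - ln q" by simp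
qed

section \<open>The driftless case: relative loss per return\<close>

context
  fixes m :: real
  assumes m: "(\<lambda>n. real n / U (int n)) \<longlonglongrightarrow> m" "0 < m"
    and inf: "filterlim (\<lambda>n. U (int n)) at_top sequentially"
begin

text \<open>Take L slightly above y / t. Then exp (-t L) is at most exp (-\<eta> y) times p = exp
  (-y), and the relative loss pmf D 0 / U L is asymptotically pmf D 0 * m / L.\<close>

lemma return_decay_lower:
  assumes a: "a < pmf D 0 * m * t"
  shows "\<forall>\<^sub>F y in at_top. a < y * (1 - R (exp (- y)) * exp y)"
proof -
  let ?c = "pmf D 0 * m * t"
  have "((\<lambda>\<eta>. ?c / (1 + \<eta>)) \<longlongrightarrow> ?c / (1 + 0)) (at_right 0)" by (intro tendsto_intros) auto
  then have "\<forall>\<^sub>F \<eta> in at_right 0. a < ?c / (1 + \<eta>)" using a order_tendstoD(1) by fastforce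
  moreover have "\<forall>\<^sub>F \<eta> in at_right (0::real). 0 < \<eta>" by (simp add: eventually_at_right_less)
  ultimately have "\<forall>\<^sub>F \<eta> in at_right (0::real). 0 < \<eta> \<and> a < ?c / (1 + \<eta>)" by eventually_elim auto
  then obtain \<eta> :: real where \<eta>: "0 < \<eta>" "a < ?c / (1 + \<eta>)"
    by (auto dest: eventually_happens)
  define \<alpha> where "\<alpha> = (1 + \<eta>) / t"
  have \<alpha>: "0 < \<alpha>" using \<eta> t_pos by (simp add: \<alpha>_def)
  define L where "L y = nat \<lceil>\<alpha> * y\<rceil>" for y
  have L1: "\<alpha> * y \<le> real (L y)" "real (L y) \<le> \<alpha> * y + 1" if "0 \<le> y" for y
  proof -
    have "0 \<le> \<alpha> * y" using \<alpha> that by simp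
    then have "real (L y) = of_int \<lceil>\<alpha> * y\<rceil>" by (simp add: L_def)
    then show "\<alpha> * y \<le> real (L y)" "real (L y) \<le> \<alpha> * y + 1" by linarith+
  qed
  have L2: "filterlim L sequentially at_top" "((\<lambda>y. y / real (L y)) \<longlongrightarrow> 1 / \<alpha>) at_top"
    by (rule linear_rounding[OF \<alpha>], use L1 in \<open>fastforce simp: abs_le_iff\<close>)+
  have "((\<lambda>y. real (L y) / U (int (L y))) \<longlongrightarrow> m) at_top" by (rule filterlim_compose[OF m(1) L2(1)])
  moreover have "((\<lambda>y. y * exp (- \<eta> * y)) \<longlongrightarrow> 0) at_top" using \<eta> by real_asymp
  ultimately have "((\<lambda>y. pmf D 0 * ((y / real (L y)) * (real (L y) / U (int (L y)))) - y * exp (- \<eta> * y)) \<longlongrightarrow>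
      pmf D 0 * (1 / \<alpha> * m) - 0) at_top"
    by (intro tendsto_intros L2)
  moreover have "a < pmf D 0 * (1 / \<alpha> * m) - 0" using \<eta> by (simp add: \<alpha>_def mult_ac)
  ultimately have ev: "\<forall>\<^sub>F y in at_top. a < pmf D 0 * ((y / real (L y)) * (real (L y) / U (int (L y)))) - y * exp (- \<eta> * y)"
    by (rule order_tendstoD(1))
  have Lpos: "\<forall>\<^sub>F y in at_top. 0 < L y"
    using L2(1) by (metis eventually_gt_at_top filterlim_iff)
  show ?thesis
    using ev Lpos eventually_gt_at_top[of 0]
  proof eventually_elim
    case (elim y)
    let ?p = "exp (- y)"
    have "R ?p \<le> ?p * (1 - pmf D 0 / U (int (L y))) + exp (- t * real (L y))"
      using elim by (intro R_upper_critical inf) auto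
    then have "R ?p * exp y \<le> (?p * (1 - pmf D 0 / U (int (L y))) + exp (- t * real (L y))) * exp y"
      by (intro mult_right_mono) auto
    also have "\<dots> = 1 - pmf D 0 / U (int (L y)) + exp (y - t * real (L y))"
    proof -
      have "exp (- y) * exp y = 1" by (simp flip: exp_add)
      moreover have "exp (- t * real (L y)) * exp y = exp (y - t * real (L y))" by (simp flip: exp_add)
      moreover have "(?p * (1 - pmf D 0 / U (int (L y))) + exp (- t * real (L y))) * exp y =
          (exp (- y) * exp y) * (1 - pmf D 0 / U (int (L y))) + exp (- t * real (L y)) * exp y"
      proof -
        have "(p' * a + b) * e = (p' * e) * a + b * e" for p' a b e :: real by (simp add: algebra_simps)
        then show ?thesis .
      qed
      ultimately show ?thesis by (simp only: mult_1_left)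
    qed
    also have "exp (y - t * real (L y)) \<le> exp (- \<eta> * y)"
    proof -
      have "t * (\<alpha> * y) \<le> t * real (L y)" using L1[of y] elim t_pos by (intro mult_left_mono) auto
      moreover have "t * (\<alpha> * y) = (1 + \<eta>) * y" using t_pos by (simp add: \<alpha>_def)
      ultimately have "y - t * real (L y) \<le> - \<eta> * y" by (simp add: algebra_simps)
      then show ?thesis by simp
    qed
    finally have "pmf D 0 / U (int (L y)) - exp (- \<eta> * y) \<le> 1 - R ?p * exp y" by simp
    then have "y * (pmf D 0 / U (int (L y)) - exp (- \<eta> * y)) \<le> y * (1 - R ?p * exp y)"
      using elim by (intro mult_left_mono) auto
    then show ?case using elim by (simp add: right_diff_distrib mult.commute)
  qed
qed

text \<open>Take L slightly below y / t, so that the second-order error, of order p^2 exp (t L)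
  times a power of K, stays small compared with p.\<close>

lemma return_decay_upper:
  assumes a: "pmf D 0 * m * t < a"
  shows "\<forall>\<^sub>F y in at_top. y * (1 - R (exp (- y)) * exp y) < a"
proof -
  let ?c = "pmf D 0 * m * t"
  have "((\<lambda>\<eta>. ?c / (1 - \<eta>)) \<longlongrightarrow> ?c / (1 - 0)) (at_right 0)" by (intro tendsto_intros) auto
  then have "\<forall>\<^sub>F \<eta> in at_right 0. ?c / (1 - \<eta>) < a" using a order_tendstoD(2) by fastforce
  moreover have "\<forall>\<^sub>F \<eta> in at_right (0::real). 0 < \<eta>" by (simp add: eventually_at_right_less)
  moreover have "\<forall>\<^sub>F \<eta> in at_right (0::real). \<eta> < 1"
    using eventually_at_right[of 0 1] by (metis zero_less_one)
  ultimately have "\<forall>\<^sub>F \<eta> in at_right (0::real). 0 < \<eta> \<and> \<eta> < 1 \<and> ?c / (1 - \<eta>) < a" by eventually_elim auto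
  then obtain \<eta> :: real where \<eta>: "0 < \<eta>" "\<eta> < 1" "?c / (1 - \<eta>) < a"
    by (auto dest: eventually_happens)
  define \<alpha> where "\<alpha> = (1 - \<eta>) / t"
  have \<alpha>: "0 < \<alpha>" using \<eta> t_pos by (simp add: \<alpha>_def)
  define L where "L y = nat \<lfloor>\<alpha> * y\<rfloor>" for y
  have L1: "real (L y) \<le> \<alpha> * y" "\<alpha> * y \<le> real (L y) + 1" if "0 \<le> y" for y
  proof -
    have "0 \<le> \<alpha> * y" using \<alpha> that by simp
    then have "real (L y) = of_int \<lfloor>\<alpha> * y\<rfloor>" by (simp add: L_def)
    then show "real (L y) \<le> \<alpha> * y" "\<alpha> * y \<le> real (L y) + 1" by linarith+
  qed
  have L2: "filterlim L sequentially at_top" "((\<lambda>y. y / real (L y)) \<longlongrightarrow> 1 / \<alpha>) at_top"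
    by (rule linear_rounding[OF \<alpha>], use L1 in \<open>fastforce simp: abs_le_iff\<close>)+
  \<comment> \<open>K = L^2 makes pmf D 0 / U K, of order L^(-2), negligible against the loss of
    order 1 / L, while powers of K remain polynomial in y.\<close>
  define K where "K y = (L y)\<^sup>2" for y
  have K2: "filterlim K sequentially at_top"
  proof (rule filterlim_at_top_mono[OF L2(1)])
    show "\<forall>\<^sub>F y in at_top. L y \<le> K y" by (simp add: K_def power2_eq_square)
  qed
  define B where "B = C * 2 * exp 1 / pmf D 0 * exp 1"
  have B0: "0 \<le> B" using C_nonneg up by (simp add: B_def)
  have ULm: "((\<lambda>y. real (L y) / U (int (L y))) \<longlongrightarrow> m) at_top" by (rule filterlim_compose[OF m(1) L2(1)])
  have UKm: "((\<lambda>y. real (K y) / U (int (K y))) \<longlongrightarrow> m) at_top" by (rule filterlim_compose[OF m(1) K2])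
  have Linv: "((\<lambda>y. 1 / real (L y)) \<longlongrightarrow> 0) at_top"
    by (intro filterlim_compose[OF lim_1_over_n L2(1)])
  have "((\<lambda>y. pmf D 0 * ((y / real (L y)) * (real (L y) / U (int (L y))))
      + pmf D 0 * ((y / real (L y)) * (1 / real (L y)) * (real (K y) / U (int (K y))))
      + y * exp (- \<eta> * y) * B * (\<alpha> * y) ^ 4 + y * exp (- y) * C) \<longlongrightarrow>
      pmf D 0 * (1 / \<alpha> * m) + pmf D 0 * (1 / \<alpha> * 0 * m) + 0 + 0) at_top"
  proof (intro tendsto_add tendsto_mult tendsto_const L2 ULm UKm Linv)
    have "((\<lambda>y. B * \<alpha> ^ 4 * (y * exp (- \<eta> * y) * y ^ 4)) \<longlongrightarrow> B * \<alpha> ^ 4 * 0) at_top"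
      using \<eta>(1) by (intro tendsto_mult tendsto_const) real_asymp
    then show "((\<lambda>y. y * exp (- \<eta> * y) * B * (\<alpha> * y) ^ 4) \<longlongrightarrow> 0) at_top"
      by (simp add: power_mult_distrib mult_ac)
    show "((\<lambda>y. y * exp (- y) * C) \<longlongrightarrow> 0) at_top" by real_asymp
  qed
  moreover have "pmf D 0 * (1 / \<alpha> * m) + pmf D 0 * (1 / \<alpha> * 0 * m) + 0 + 0 < a"
    using \<eta> by (simp add: \<alpha>_def mult_ac)
  ultimately have ev: "\<forall>\<^sub>F y in at_top. pmf D 0 * ((y / real (L y)) * (real (L y) / U (int (L y))))
      + pmf D 0 * ((y / real (L y)) * (1 / real (L y)) * (real (K y) / U (int (K y))))
      + y * exp (- \<eta> * y) * B * (\<alpha> * y) ^ 4 + y * exp (- y) * C < a"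
    by (rule order_tendstoD(2))
  have Lpos: "\<forall>\<^sub>F y in at_top. 0 < L y"
    using L2(1) by (metis eventually_gt_at_top filterlim_iff)
  show ?thesis
    using ev Lpos eventually_gt_at_top[of 0]
  proof eventually_elim
    case (elim y)
    let ?p = "exp (- y)" and ?L = "L y" and ?K = "K y"
    have LK: "0 < ?L" "?L \<le> ?K" "0 < ?K" using elim by (auto simp: K_def power2_eq_square)
    note z = U_ratio_superharmonic[OF LK(1,3)]
    have "?p * (1 - pmf D 0 / U (int ?L)) - ?p * Q (\<lambda>x. U x / U (int ?K)) 0 - error ?p ?L ?K * exp 1 - ?p\<^sup>2 * C \<le> R ?p"
      using elim by (intro R_lower LK z) auto
    then have low: "(?p * (1 - pmf D 0 / U (int ?L)) - ?p * (pmf D 0 / U (int ?K)) - error ?p ?L ?K * exp 1 - ?p\<^sup>2 * C) * exp y \<le> R ?p * exp y"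
      unfolding z(5) by (intro mult_right_mono) auto
    have pe: "?p * exp y = 1" by (simp flip: exp_add)
    have eq: "(?p * (1 - pmf D 0 / U (int ?L)) - ?p * (pmf D 0 / U (int ?K)) - error ?p ?L ?K * exp 1 - ?p\<^sup>2 * C) * exp y
        = (?p * exp y) * (1 - pmf D 0 / U (int ?L) - pmf D 0 / U (int ?K)
          - ?p * exp (t * real ?L) * B * (real ?K)\<^sup>2 - ?p * C)"
      by (simp add: error_def B_def power2_eq_square algebra_simps)
    have low2: "1 - R ?p * exp y \<le> pmf D 0 / U (int ?L) + pmf D 0 / U (int ?K)
        + ?p * exp (t * real ?L) * B * (real ?K)\<^sup>2 + ?p * C"
      using low unfolding eq pe mult_1_left by linarith
    have b1: "?p * exp (t * real ?L) \<le> exp (- \<eta> * y)"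
    proof -
      have "t * real ?L \<le> t * (\<alpha> * y)" using L1[of y] elim t_pos by (intro mult_left_mono) auto
      moreover have "t * (\<alpha> * y) = (1 - \<eta>) * y" using t_pos by (simp add: \<alpha>_def)
      ultimately have "- y + t * real ?L \<le> - \<eta> * y" by (simp add: algebra_simps)
      then show ?thesis by (simp flip: exp_add)
    qed
    have b2: "(real ?K)\<^sup>2 \<le> (\<alpha> * y) ^ 4"
    proof -
      have "(real ?K)\<^sup>2 = real ?L ^ 4" by (simp add: K_def flip: power_mult)
      also have "\<dots> \<le> (\<alpha> * y) ^ 4" using L1[of y] elim by (intro power_mono) auto
      finally show ?thesis .
    qed
    have "?p * exp (t * real ?L) * B * (real ?K)\<^sup>2 \<le> exp (- \<eta> * y) * B * (\<alpha> * y) ^ 4"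
      using B0 by (intro mult_mono mult_right_mono b1 b2) auto
    with low2 have "1 - R ?p * exp y \<le> pmf D 0 / U (int ?L) + pmf D 0 / U (int ?K)
        + exp (- \<eta> * y) * B * (\<alpha> * y) ^ 4 + ?p * C" by linarith
    then have "y * (1 - R ?p * exp y) \<le> y * (pmf D 0 / U (int ?L) + pmf D 0 / U (int ?K)
        + exp (- \<eta> * y) * B * (\<alpha> * y) ^ 4 + ?p * C)"
      using elim by (intro mult_left_mono) auto
    also have "\<dots> = pmf D 0 * ((y / real ?L) * (real ?L / U (int ?L)))
      + pmf D 0 * ((y / real ?L) * (1 / real ?L) * (real ?K / U (int ?K)))
      + y * exp (- \<eta> * y) * B * (\<alpha> * y) ^ 4 + y * exp (- y) * C"
      using LK by (simp add: K_def distrib_left power2_eq_square mult.commute[of y "pmf D 0"])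
    finally show ?case using elim by linarith
  qed
qed

lemma return_decay: "((\<lambda>y. y * (1 - R (exp (- y)) * exp y)) \<longlongrightarrow> pmf D 0 * m * t) at_top"
  by (rule order_tendstoI) (auto intro: return_decay_lower return_decay_upper)

text \<open>The limit l satisfies l * pmf D 0 \<le> U L * exp (-t L) for every L > 0, and
  \<open>U\<close> grows only linearly.\<close>

lemma ret_tendsto_0: "ret \<longlonglongrightarrow> 0"
proof -
  have "decseq ret" by (rule decseq_SucI) (rule ret_decreasing)
  then obtain l where l: "ret \<longlonglongrightarrow> l" using decseq_convergent[of ret 0] ret_bounds by blast
  have l0: "0 \<le> l" using ret_bounds by (intro LIMSEQ_le_const[OF l]) auto
  have "l * pmf D 0 \<le> U (int L) * exp (- t * real L)" if L: "0 < L" for L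
  proof -
    have "l \<le> l * (1 - pmf D 0 / U (int L)) + exp (- t * real L)"
    proof (rule LIMSEQ_le[OF LIMSEQ_Suc[OF l]])
      show "(\<lambda>k. ret k * (1 - pmf D 0 / U (int L)) + exp (- t * real L)) \<longlonglongrightarrow> l * (1 - pmf D 0 / U (int L)) + exp (- t * real L)"
        by (intro tendsto_intros l)
      show "\<exists>N. \<forall>k\<ge>N. ret (Suc k) \<le> ret k * (1 - pmf D 0 / U (int L)) + exp (- t * real L)"
        using R_upper_critical[OF _ _ inf L] ret_bounds by (auto simp: ret_Suc)
    qed
    then have "l * (pmf D 0 / U (int L)) \<le> exp (- t * real L)" by (simp add: right_diff_distrib)
    then show ?thesis using U_pos[of "int L"] L by (simp add: divide_le_eq mult.commute)
  qed
  moreover have "(\<lambda>L. U (int L) * exp (- t * real L)) \<longlonglongrightarrow> 0"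
  proof -
    have "(\<lambda>L. inverse (real L / U (int L)) * (real L * exp (- t * real L))) \<longlonglongrightarrow> inverse m * 0"
      using t_pos m by (intro tendsto_intros) (auto, real_asymp)
    moreover have "\<forall>\<^sub>F L in sequentially. inverse (real L / U (int L)) * (real L * exp (- t * real L)) = U (int L) * exp (- t * real L)"
      using eventually_gt_at_top[of 0] by eventually_elim simp
    ultimately show ?thesis by (simp add: tendsto_cong)
  qed
  ultimately have "l * pmf D 0 \<le> 0" by (intro LIMSEQ_le_const) (auto intro!: exI[of _ 1])
  then have "l = 0" using up l0 by (simp add: mult_le_0_iff)
  then show ?thesis using l by simp
qed

text \<open>With y = -ln ret and relative loss x, the product y x tends to c, and y (k + 1) - y k =
  -ln (1 - x k) equals x k to first order. So the squares of y have increments tending to 2 c, and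
  Stolz-Cesaro applies.\<close>

lemma log_ret_critical:
  assumes lt: "pmf D 0 < 1"
  shows "(\<lambda>k. (- ln (ret k))\<^sup>2 / real k) \<longlonglongrightarrow> 2 * (pmf D 0 * m * t)"
proof (rule stolz)
  let ?c = "pmf D 0 * m * t"
  define y where "y k = - ln (ret k)" for k
  define x where "x k = 1 - R (ret k) / ret k" for k
  have pos: "0 < ret k" for k by (rule ret_pos[OF lt])
  have "filterlim ret (at_right 0) sequentially"
    unfolding filterlim_at using ret_tendsto_0 pos
    by (auto intro!: always_eventually simp: less_imp_neq[symmetric])
  then have "filterlim (\<lambda>k. ln (ret k)) at_bot sequentially" by (rule filterlim_compose[OF ln_at_0])
  then have y_inf: "filterlim y at_top sequentially"
    unfolding y_def by (simp add: filterlim_uminus_at_bot)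
  have ret_y: "ret k = exp (- y k)" for k using pos by (simp add: y_def)
  have xy: "(\<lambda>k. y k * x k) \<longlonglongrightarrow> ?c"
    using filterlim_compose[OF return_decay y_inf] by (simp add: x_def ret_y exp_minus divide_inverse)
  have yinv: "(\<lambda>k. inverse (y k)) \<longlonglongrightarrow> 0"
    by (intro tendsto_inverse_0_at_top y_inf)
  have "(\<lambda>k. inverse (y k) * (y k * x k)) \<longlonglongrightarrow> 0 * ?c" by (intro tendsto_intros xy yinv)
  moreover have ev: "\<forall>\<^sub>F k in sequentially. 0 < y k"
    using y_inf by (simp add: filterlim_at_top_dense)
  have "\<forall>\<^sub>F k in sequentially. inverse (y k) * (y k * x k) = x k"
    using ev by eventually_elim simp
  ultimately have x0: "x \<longlonglongrightarrow> 0" by (simp add: tendsto_cong)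
  have step: "y (Suc k) - y k = - ln (1 - x k)" for k
    using pos[of k] pos[of "Suc k"] by (simp add: y_def x_def ret_Suc ln_div)
  have x_bounds: "0 \<le> x k" "x k < 1" for k
    using pos[of k] pos[of "Suc k"] ret_decreasing[of k] by (auto simp: x_def ret_Suc)
  have lower: "x k \<le> y (Suc k) - y k" for k
    using ln_add_one_self_le_self2[of "- x k"] x_bounds[of k] by (simp add: step)
  have upper: "y (Suc k) - y k \<le> x k / (1 - x k)" for k
  proof -
    have "ln (inverse (1 - x k)) \<le> inverse (1 - x k) - 1"
      using x_bounds[of k] by (intro ln_le_minus_one) auto
    moreover have "inverse (1 - x k) - 1 = x k / (1 - x k)"
      using x_bounds[of k] by (simp add: field_simps)
    moreover have "ln (inverse (1 - x k)) = - ln (1 - x k)"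
      by (rule ln_inverse)
    ultimately show ?thesis by (simp only: step)
  qed
  have dy: "(\<lambda>k. y k * (y (Suc k) - y k)) \<longlonglongrightarrow> ?c"
  proof (rule tendsto_sandwich[OF _ _ xy])
    have "(\<lambda>k. (y k * x k) / (1 - x k)) \<longlonglongrightarrow> ?c / (1 - 0)" by (intro tendsto_intros xy x0) auto
    then show "(\<lambda>k. (y k * x k) / (1 - x k)) \<longlonglongrightarrow> ?c" by simp
    show "\<forall>\<^sub>F k in sequentially. y k * x k \<le> y k * (y (Suc k) - y k)"
      using ev by eventually_elim (intro mult_left_mono lower, simp)
    show "\<forall>\<^sub>F k in sequentially. y k * (y (Suc k) - y k) \<le> (y k * x k) / (1 - x k)"
      using ev
    proof eventually_elim
      case (elim k)
      then have "y k * (y (Suc k) - y k) \<le> y k * (x k / (1 - x k))" by (intro mult_left_mono upper) auto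
      then show ?case by simp
    qed
  qed
  have d0: "(\<lambda>k. y (Suc k) - y k) \<longlonglongrightarrow> 0"
  proof (rule tendsto_sandwich[OF _ _ x0])
    have "(\<lambda>k. x k / (1 - x k)) \<longlonglongrightarrow> 0 / (1 - 0)" by (intro tendsto_intros x0) auto
    then show "(\<lambda>k. x k / (1 - x k)) \<longlonglongrightarrow> 0" by simp
  qed (use lower upper in auto)
  have "(\<lambda>k. 2 * (y k * (y (Suc k) - y k)) + (y (Suc k) - y k)\<^sup>2) \<longlonglongrightarrow> 2 * ?c + 0\<^sup>2"
    by (intro tendsto_intros dy d0)
  moreover have "(- ln (ret (Suc k)))\<^sup>2 - (- ln (ret k))\<^sup>2 = 2 * (y k * (y (Suc k) - y k)) + (y (Suc k) - y k)\<^sup>2" for k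
    unfolding y_def[symmetric] by (simp add: power2_eq_square algebra_simps)
  ultimately show "(\<lambda>k. (- ln (ret (Suc k)))\<^sup>2 - (- ln (ret k))\<^sup>2) \<longlonglongrightarrow> 2 * ?c"
    by simp
qed

end

end

section \<open>One-step decomposition of the tree\<close>

text \<open>One scheme for two kinds of events, few visits and extinction: a state is carried down
  the tree, \<open>acc\<close> is tested in the first n generations and \<open>base\<close> in the
  last. The value depends only on the labels below v, so it splits over independent
  subtrees.\<close>

primrec descends ::
  "('y \<Rightarrow> enat \<Rightarrow> bool) \<Rightarrow> ('y \<Rightarrow> int \<Rightarrow> 'y) \<Rightarrow> ('y \<Rightarrow> bool) \<Rightarrow> (nat list \<Rightarrow> enat \<times> (nat \<Rightarrow> real)) \<Rightarrow>
    nat \<Rightarrow> 'y \<Rightarrow> nat list \<Rightarrow> bool" where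
  "descends acc step base fam 0 y v = base y"
| "descends acc step base fam (Suc n) y v =
    (acc y (fst (fam v)) \<and>
     (\<forall>i. enat i < fst (fam v) \<longrightarrow> descends acc step base fam n (step y \<lfloor>snd (fam v) i\<rfloor>) (v @ [i])))"

definition subtree :: "nat list \<Rightarrow> nat list set" where
  "subtree v = range (\<lambda>w. v @ w)"

lemma subtree_root: "v \<in> subtree v"
  unfolding subtree_def by (rule range_eqI[of _ _ "[]"]) simp

lemma subtree_child: "subtree (v @ [i]) \<subseteq> subtree v"
  by (auto simp: subtree_def)

lemma root_notin_subtree_child: "v \<notin> subtree (v @ [i])"
  by (auto simp: subtree_def)

lemma subtree_disjoint: "i \<noteq> j \<Longrightarrow> subtree (v @ [i]) \<inter> subtree (v @ [j]) = {}"
  by (auto simp: subtree_def)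

lemma descends_cong:
  assumes "\<And>u. u \<in> subtree v \<Longrightarrow> fam u = fam' u"
  shows "descends acc step base fam n y v = descends acc step base fam' n y v"
  using assms
proof (induction n arbitrary: y v)
  case (Suc n)
  have "fam v = fam' v" using Suc.prems subtree_root by blast
  moreover have "descends acc step base fam n z (v @ [i]) = descends acc step base fam' n z (v @ [i])" for z i
    using Suc.prems subtree_child by (intro Suc.IH) blast
  ultimately show ?case by simp
qed simp

abbreviation family_space :: "(enat \<times> (nat \<Rightarrow> real)) measure" where
  "family_space \<equiv> count_space UNIV \<Otimes>\<^sub>M (\<Pi>\<^sub>M i\<in>UNIV. borel)"

lemma measurable_family_floor [measurable]:
  "(\<lambda>f. \<lfloor>snd f i\<rfloor>) \<in> family_space \<rightarrow>\<^sub>M count_space UNIV"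
proof -
  have "(\<lambda>f. snd f i) \<in> family_space \<rightarrow>\<^sub>M borel"
    by (rule measurable_compose[OF measurable_snd measurable_component_singleton]) simp
  then show ?thesis by measurable
qed

lemma measurable_descends:
  assumes "subtree v \<subseteq> I"
  shows "Measurable.pred (\<Pi>\<^sub>M u\<in>I. family_space) (\<lambda>fam. descends acc step base fam n y v)"
  using assms
proof (induction n arbitrary: y v)
  case (Suc n)
  have [measurable]: "(\<lambda>fam. fam v) \<in> (\<Pi>\<^sub>M u\<in>I. family_space) \<rightarrow>\<^sub>M family_space"
    using Suc.prems subtree_root[of v] by (intro measurable_component_singleton) auto
  have *: "Measurable.pred (\<Pi>\<^sub>M u\<in>I. family_space)
      (\<lambda>fam. descends acc step base fam n (step y \<lfloor>snd (fam v) i\<rfloor>) (v @ [i]))" for i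
  proof (rule measurable_compose_countable[where f = "\<lambda>k fam. descends acc step base fam n (step y k) (v @ [i])"])
    show "(\<lambda>fam. \<lfloor>snd (fam v) i\<rfloor>) \<in> (\<Pi>\<^sub>M u\<in>I. family_space) \<rightarrow>\<^sub>M count_space UNIV"
      by (rule measurable_compose[OF _ measurable_family_floor]) measurable
    show "Measurable.pred (\<Pi>\<^sub>M u\<in>I. family_space) (\<lambda>fam. descends acc step base fam n (step y k) (v @ [i]))" for k
      using Suc.prems subtree_child by (intro Suc.IH) blast
  qed
  have [measurable]: "(\<lambda>fam. fst (fam v)) \<in> (\<Pi>\<^sub>M u\<in>I. family_space) \<rightarrow>\<^sub>M count_space UNIV"
    by (rule measurable_compose[OF _ measurable_fst]) measurable
  show ?case using * by simp
qed simp

context branching_random_walk begin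

definition family :: "nat list \<Rightarrow> 'a \<Rightarrow> enat \<times> (nat \<Rightarrow> real)" where
  "family u \<omega> = (N u \<omega>, \<lambda>i. X u i \<omega>)"

lemma family_sel [simp]: "fst (family u \<omega>) = N u \<omega>" "snd (family u \<omega>) i = X u i \<omega>"
  by (simp_all add: family_def)

lemma indep_family: "indep_vars (\<lambda>_. family_space) family UNIV"
  using indep_reproduction by (simp add: family_def[abs_def])

lemma family_measurable [measurable]: "family u \<in> M \<rightarrow>\<^sub>M family_space"
  using indep_family by (auto simp: indep_vars_def)

lemma distr_family: "distr M family_space (family u) = distr M family_space (family [])"
  using reproduction_law[of u] by (simp add: family_def[abs_def])

lemma N_measurable [measurable]: "N u \<in> M \<rightarrow>\<^sub>M count_space UNIV"
  using measurable_compose[OF family_measurable[of u] measurable_fst] by (simp add: family_def)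

lemma X_measurable [measurable]: "X u i \<in> borel_measurable M"
  using measurable_compose[OF measurable_compose[OF family_measurable[of u] measurable_snd]
      measurable_component_singleton[of i UNIV "\<lambda>_. borel"]] by (simp add: family_def)

lemma restrict_family_measurable:
  "(\<lambda>\<omega>. restrict (\<lambda>u. family u \<omega>) I) \<in> M \<rightarrow>\<^sub>M (\<Pi>\<^sub>M u\<in>I. family_space)"
  by (rule measurable_restrict) measurable

lemma descends_measurable [measurable]:
  "Measurable.pred M (\<lambda>\<omega>. descends acc step base (\<lambda>u. family u \<omega>) n y v)"
proof -
  have "Measurable.pred M (\<lambda>\<omega>. descends acc step base (restrict (\<lambda>u. family u \<omega>) UNIV) n y v)"
    by (rule measurable_compose[OF restrict_family_measurable measurable_descends]) simp
  moreover have "descends acc step base (restrict (\<lambda>u. family u \<omega>) UNIV) n y v =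
      descends acc step base (\<lambda>u. family u \<omega>) n y v" for \<omega>
    by (rule descends_cong) simp
  ultimately show ?thesis by simp
qed

primrec val :: "('y \<Rightarrow> enat \<Rightarrow> bool) \<Rightarrow> ('y \<Rightarrow> int \<Rightarrow> 'y) \<Rightarrow> ('y \<Rightarrow> bool) \<Rightarrow> nat \<Rightarrow> 'y \<Rightarrow> real" where
  "val acc step base 0 y = of_bool (base y)"
| "val acc step base (Suc n) y = expectation (\<lambda>\<omega>. of_bool (acc y (N [] \<omega>)) *
      iprod (\<lambda>i. if enat i < N [] \<omega> then val acc step base n (step y \<lfloor>X [] i \<omega>\<rfloor>) else 1))"

text \<open>Disjoint subtrees carry independent families. Here A and y are deterministic; they
  become the data of the parent only after Fubini.\<close>

lemma prob_all_children:
  assumes p: "\<And>y i. prob {\<omega> \<in> space M. descends acc step base (\<lambda>u. family u \<omega>) n y (v @ [i])} = g y"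
  shows "prob {\<omega> \<in> space M. \<forall>i. A i \<longrightarrow> descends acc step base (\<lambda>u. family u \<omega>) n (y i) (v @ [i])} =
    iprod (\<lambda>i. if A i then g (y i) else 1)"
proof -
  let ?D = "\<lambda>i \<omega>. descends acc step base (\<lambda>u. family u \<omega>) n (y i) (v @ [i])"
  let ?E = "\<lambda>i \<omega>. A i \<longrightarrow> descends acc step base (restrict (\<lambda>u. family u \<omega>) (subtree (v @ [i]))) n (y i) (v @ [i])"
  have DE: "?E i \<omega> = (A i \<longrightarrow> ?D i \<omega>)" for i \<omega>
  proof -
    have "descends acc step base (restrict (\<lambda>u. family u \<omega>) (subtree (v @ [i]))) n (y i) (v @ [i]) = ?D i \<omega>"
      by (rule descends_cong) simp
    then show ?thesis by simp
  qed
  have "indep_vars (\<lambda>i. \<Pi>\<^sub>M u\<in>subtree (v @ [i]). family_space)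
      (\<lambda>i \<omega>. restrict (\<lambda>u. family u \<omega>) (subtree (v @ [i]))) (UNIV :: nat set)"
    by (rule indep_vars_restrict[OF indep_family]) (auto simp: disjoint_family_on_def subtree_disjoint)
  then have ind: "indep_vars (\<lambda>_. count_space UNIV) ?E UNIV"
    by (rule indep_vars_compose2) (auto intro!: pred_intros_logic measurable_descends)
  have g: "prob {\<omega> \<in> space M. ?E i \<omega>} = (if A i then g (y i) else 1)" for i
    unfolding DE using p[of "y i" i] by (auto simp: prob_space)
  have g01: "0 \<le> (if A i then g (y i) else 1)" "(if A i then g (y i) else 1) \<le> 1" for i
    using g[of i, symmetric] by (simp_all del: if_split)
  \<comment> \<open>Initial segments up to \<open>Suc m\<close>, since the product formula for
    independent variables concerns nonempty index sets.\<close>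
  have fin: "prob {\<omega> \<in> space M. \<forall>i<Suc m. ?E i \<omega>} = (\<Prod>i<Suc m. if A i then g (y i) else 1)" for m
  proof -
    have "{\<omega> \<in> space M. \<forall>i<Suc m. ?E i \<omega>} = (\<Inter>i\<in>{..<Suc m}. ?E i -` {True} \<inter> space M)" by auto
    then have "prob {\<omega> \<in> space M. \<forall>i<Suc m. ?E i \<omega>} = (\<Prod>i<Suc m. prob (?E i -` {True} \<inter> space M))"
      using indep_varsD[OF ind, of "{..<Suc m}" "\<lambda>_. {True}"] by (simp add: lessThan_Suc)
    also have "\<dots> = (\<Prod>i<Suc m. prob {\<omega> \<in> space M. ?E i \<omega>})"
      by (intro prod.cong refl arg_cong[where f = prob]) auto
    finally show ?thesis by (simp only: g)
  qed
  have l1: "(\<lambda>m. prob {\<omega> \<in> space M. \<forall>i<Suc m. ?E i \<omega>}) \<longlonglongrightarrow> prob (\<Inter>m. {\<omega> \<in> space M. \<forall>i<Suc m. ?E i \<omega>})"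
  proof (rule finite_Lim_measure_decseq)
    show "range (\<lambda>m. {\<omega> \<in> space M. \<forall>i<Suc m. ?E i \<omega>}) \<subseteq> events" unfolding DE by auto
    show "decseq (\<lambda>m. {\<omega> \<in> space M. \<forall>i<Suc m. ?E i \<omega>})" by (intro decseq_SucI) auto
  qed
  have l2: "(\<lambda>m. prob {\<omega> \<in> space M. \<forall>i<Suc m. ?E i \<omega>}) \<longlonglongrightarrow> iprod (\<lambda>i. if A i then g (y i) else 1)"
    unfolding fin using LIMSEQ_Suc[OF iprod_tendsto[OF g01]] .
  have "(\<Inter>m. {\<omega> \<in> space M. \<forall>i<Suc m. ?E i \<omega>}) = {\<omega> \<in> space M. \<forall>i. A i \<longrightarrow> ?D i \<omega>}"
    unfolding DE by auto
  with LIMSEQ_unique[OF l1 l2] show ?thesis by (simp only:)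
qed

lemma val_bounds: "0 \<le> val acc step base n y \<and> val acc step base n y \<le> 1"
proof (induction n arbitrary: y)
  case (Suc n)
  let ?f = "\<lambda>\<omega>. of_bool (acc y (N [] \<omega>)) *
      iprod (\<lambda>i. if enat i < N [] \<omega> then val acc step base n (step y \<lfloor>X [] i \<omega>\<rfloor>) else 1)"
  have b: "0 \<le> ?f \<omega>" "?f \<omega> \<le> 1" for \<omega>
  proof -
    have "0 \<le> iprod (\<lambda>i. if enat i < N [] \<omega> then val acc step base n (step y \<lfloor>X [] i \<omega>\<rfloor>) else 1)"
      "iprod (\<lambda>i. if enat i < N [] \<omega> then val acc step base n (step y \<lfloor>X [] i \<omega>\<rfloor>) else 1) \<le> 1"
      using Suc by (auto intro!: iprod_bounds)
    then show "0 \<le> ?f \<omega>" "?f \<omega> \<le> 1" by auto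
  qed
  have "0 \<le> expectation ?f" by (intro integral_nonneg_AE) (use b in auto)
  moreover have "expectation ?f \<le> 1"
  \<comment> \<open>This spares a measurability argument: a non-integrable function has Bochner
    integral 0, which also satisfies the bound.\<close>
  proof (cases "integrable M ?f")
    case True
    then have "expectation ?f \<le> expectation (\<lambda>_. 1)" using b by (intro integral_mono) auto
    then show ?thesis by (simp add: prob_space)
  next
    case False
    then show ?thesis by (simp add: not_integrable_integral_eq)
  qed
  ultimately show ?case by simp
qed simp

text \<open>The family of v is independent of the families strictly below v, so Fubini lets
  \<open>prob_all_children\<close> act with the family of v frozen. Its law is then replaced by that
  of the root.\<close>

lemma prob_descends:
  "prob {\<omega> \<in> space M. descends acc step base (\<lambda>u. family u \<omega>) n y v} = val acc step base n y"
proof (induction n arbitrary: y v)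
  case 0
  show ?case by (cases "base y") (auto simp: prob_space)
next
  case (Suc n)
  define I where "I = (\<Union>i. subtree (v @ [i]))"
  let ?A = "\<lambda>\<omega>. restrict (\<lambda>u. family u \<omega>) {v}" and ?B = "\<lambda>\<omega>. restrict (\<lambda>u. family u \<omega>) I"
  let ?S = "\<Pi>\<^sub>M u\<in>{v}. family_space" and ?T = "\<Pi>\<^sub>M u\<in>I. family_space"
  define P where "P a b \<longleftrightarrow> acc y (fst (a v)) \<and>
      (\<forall>i. enat i < fst (a v) \<longrightarrow> descends acc step base b n (step y \<lfloor>snd (a v) i\<rfloor>) (v @ [i]))"
    for a b :: "nat list \<Rightarrow> enat \<times> (nat \<Rightarrow> real)"
  have vI: "v \<notin> I" by (auto simp: I_def root_notin_subtree_child)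
  have ind: "indep_var ?S ?A ?T ?B"
    by (rule indep_var_restrict[OF indep_family]) (use vI in auto)
  have A: "?A \<in> M \<rightarrow>\<^sub>M ?S" and B: "?B \<in> M \<rightarrow>\<^sub>M ?T" by (rule restrict_family_measurable)+
  have P_measurable: "Measurable.pred (?S \<Otimes>\<^sub>M ?T) (\<lambda>(a, b). P a b)"
  proof -
    have av [measurable]: "(\<lambda>ab. (fst ab) v) \<in> (?S \<Otimes>\<^sub>M ?T) \<rightarrow>\<^sub>M family_space"
      by (rule measurable_compose[OF measurable_fst measurable_component_singleton]) simp
    have [measurable]: "(\<lambda>ab. fst ((fst ab) v)) \<in> (?S \<Otimes>\<^sub>M ?T) \<rightarrow>\<^sub>M count_space UNIV"
      by (rule measurable_compose[OF av measurable_fst])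
    have *: "Measurable.pred (?S \<Otimes>\<^sub>M ?T)
        (\<lambda>ab. descends acc step base (snd ab) n (step y \<lfloor>snd ((fst ab) v) i\<rfloor>) (v @ [i]))" for i
    proof (rule measurable_compose_countable[where f = "\<lambda>k ab. descends acc step base (snd ab) n (step y k) (v @ [i])"])
      show "(\<lambda>ab. \<lfloor>snd ((fst ab) v) i\<rfloor>) \<in> (?S \<Otimes>\<^sub>M ?T) \<rightarrow>\<^sub>M count_space UNIV"
        by (rule measurable_compose[OF av measurable_family_floor])
      show "Measurable.pred (?S \<Otimes>\<^sub>M ?T) (\<lambda>ab. descends acc step base (snd ab) n (step y k) (v @ [i]))" for k
        by (rule measurable_compose[OF measurable_snd measurable_descends]) (auto simp: I_def)
    qed
    show ?thesis unfolding case_prod_beta' P_def using * by measurable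
  qed
  then have P_sets: "{ab \<in> space (?S \<Otimes>\<^sub>M ?T). P (fst ab) (snd ab)} \<in> sets (?S \<Otimes>\<^sub>M ?T)"
    by (simp add: pred_def case_prod_beta')
  have PD: "P (?A \<omega>) (?B \<omega>') \<longleftrightarrow> acc y (N v \<omega>) \<and>
      (\<forall>i. enat i < N v \<omega> \<longrightarrow> descends acc step base (\<lambda>u. family u \<omega>') n (step y \<lfloor>X v i \<omega>\<rfloor>) (v @ [i]))" for \<omega> \<omega>'
  proof -
    have "descends acc step base (?B \<omega>') n z (v @ [i]) = descends acc step base (\<lambda>u. family u \<omega>') n z (v @ [i])" for z i
      by (rule descends_cong) (auto simp: I_def)
    then show ?thesis by (simp add: P_def family_def)
  qed
  interpret dA: prob_space "distr M ?S ?A" by (rule prob_space_distr[OF A])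
  interpret dB: prob_space "distr M ?T ?B" by (rule prob_space_distr[OF B])
  let ?g = "\<lambda>f. of_bool (acc y (fst f)) * iprod (\<lambda>i. if enat i < fst f then val acc step base n (step y \<lfloor>snd f i\<rfloor>) else 1)"
  have g_measurable: "?g \<in> borel_measurable family_space"
  proof (intro borel_measurable_times measurable_iprod)
    show "(\<lambda>f. of_bool (acc y (fst f))) \<in> borel_measurable family_space" by measurable
    fix i
    have [measurable]: "(\<lambda>f. val acc step base n (step y \<lfloor>snd f i\<rfloor>)) \<in> borel_measurable family_space"
      by (rule measurable_compose[OF measurable_family_floor]) simp
    show "(\<lambda>f. if enat i < fst f then val acc step base n (step y \<lfloor>snd f i\<rfloor>) else 1) \<in> borel_measurable family_space"
      by measurable
  qed (auto simp: val_bounds)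
  have g_bounds: "0 \<le> ?g f" "?g f \<le> 1" for f
  proof -
    have "0 \<le> iprod (\<lambda>i. if enat i < fst f then val acc step base n (step y \<lfloor>snd f i\<rfloor>) else 1)"
      "iprod (\<lambda>i. if enat i < fst f then val acc step base n (step y \<lfloor>snd f i\<rfloor>) else 1) \<le> 1"
      by (auto intro!: iprod_bounds simp: val_bounds)
    then show "0 \<le> ?g f" "?g f \<le> 1" by auto
  qed
  have "emeasure M {\<omega> \<in> space M. descends acc step base (\<lambda>u. family u \<omega>) (Suc n) y v} =
      emeasure M ((\<lambda>\<omega>. (?A \<omega>, ?B \<omega>)) -` {ab \<in> space (?S \<Otimes>\<^sub>M ?T). P (fst ab) (snd ab)} \<inter> space M)"
  proof (rule arg_cong[where f = "emeasure M"])
    show "{\<omega> \<in> space M. descends acc step base (\<lambda>u. family u \<omega>) (Suc n) y v} =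
      (\<lambda>\<omega>. (?A \<omega>, ?B \<omega>)) -` {ab \<in> space (?S \<Otimes>\<^sub>M ?T). P (fst ab) (snd ab)} \<inter> space M"
      using measurable_space[OF A] measurable_space[OF B]
      by (auto simp: PD space_pair_measure)
  qed
  also have "\<dots> = emeasure (distr M (?S \<Otimes>\<^sub>M ?T) (\<lambda>\<omega>. (?A \<omega>, ?B \<omega>))) {ab \<in> space (?S \<Otimes>\<^sub>M ?T). P (fst ab) (snd ab)}"
    using A B P_sets by (intro emeasure_distr[symmetric] measurable_Pair)
  also have "distr M (?S \<Otimes>\<^sub>M ?T) (\<lambda>\<omega>. (?A \<omega>, ?B \<omega>)) = distr M ?S ?A \<Otimes>\<^sub>M distr M ?T ?B"
    using ind by (simp add: indep_var_distribution_eq)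
  also have "emeasure (distr M ?S ?A \<Otimes>\<^sub>M distr M ?T ?B) {ab \<in> space (?S \<Otimes>\<^sub>M ?T). P (fst ab) (snd ab)} =
      (\<integral>\<^sup>+a. emeasure (distr M ?T ?B) (Pair a -` {ab \<in> space (?S \<Otimes>\<^sub>M ?T). P (fst ab) (snd ab)}) \<partial>distr M ?S ?A)"
    using P_sets by (intro dB.emeasure_pair_measure_alt) (simp cong: sets_pair_measure_cong)
  also have "\<dots> = (\<integral>\<^sup>+\<omega>. emeasure (distr M ?T ?B) (Pair (?A \<omega>) -` {ab \<in> space (?S \<Otimes>\<^sub>M ?T). P (fst ab) (snd ab)}) \<partial>M)"
    using P_sets by (intro nn_integral_distr A dB.measurable_emeasure_Pair) (simp cong: sets_pair_measure_cong)
  also have "\<dots> = (\<integral>\<^sup>+\<omega>. ennreal (?g (family v \<omega>)) \<partial>M)"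
  proof (rule nn_integral_cong)
    fix \<omega> assume \<omega>: "\<omega> \<in> space M"
    have "Pair (?A \<omega>) -` {ab \<in> space (?S \<Otimes>\<^sub>M ?T). P (fst ab) (snd ab)} \<in> sets ?T"
      using P_sets by (rule sets_Pair1)
    then have "emeasure (distr M ?T ?B) (Pair (?A \<omega>) -` {ab \<in> space (?S \<Otimes>\<^sub>M ?T). P (fst ab) (snd ab)}) =
        emeasure M (?B -` (Pair (?A \<omega>) -` {ab \<in> space (?S \<Otimes>\<^sub>M ?T). P (fst ab) (snd ab)}) \<inter> space M)"
      by (intro emeasure_distr B)
    also have "?B -` (Pair (?A \<omega>) -` {ab \<in> space (?S \<Otimes>\<^sub>M ?T). P (fst ab) (snd ab)}) \<inter> space M =
        {\<omega>' \<in> space M. acc y (N v \<omega>) \<and>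
          (\<forall>i. enat i < N v \<omega> \<longrightarrow> descends acc step base (\<lambda>u. family u \<omega>') n (step y \<lfloor>X v i \<omega>\<rfloor>) (v @ [i]))}"
      using measurable_space[OF A \<omega>] measurable_space[OF B] by (auto simp: PD space_pair_measure)
    also have "emeasure M \<dots> = ennreal (?g (family v \<omega>))"
    proof (cases "acc y (N v \<omega>)")
      case True
      then show ?thesis
        using prob_all_children[OF Suc, where A = "\<lambda>i. enat i < N v \<omega>" and y = "\<lambda>i. step y \<lfloor>X v i \<omega>\<rfloor>"]
        by (simp add: emeasure_eq_measure cong: if_cong)
    qed (simp add: family_def)
    finally show "emeasure (distr M ?T ?B) (Pair (?A \<omega>) -` {ab \<in> space (?S \<Otimes>\<^sub>M ?T). P (fst ab) (snd ab)}) =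
        ennreal (?g (family v \<omega>))" .
  qed
  also have "\<dots> = (\<integral>\<^sup>+f. ennreal (?g f) \<partial>distr M family_space (family v))"
    using g_measurable by (subst nn_integral_distr) (auto intro!: family_measurable)
  also have "\<dots> = (\<integral>\<^sup>+f. ennreal (?g f) \<partial>distr M family_space (family []))"
    by (simp only: distr_family[of v])
  also have "\<dots> = (\<integral>\<^sup>+\<omega>. ennreal (?g (family [] \<omega>)) \<partial>M)"
    using g_measurable by (subst nn_integral_distr) (auto intro!: family_measurable)
  also have "\<dots> = ennreal (expectation (\<lambda>\<omega>. ?g (family [] \<omega>)))"
  proof (rule nn_integral_eq_integral)
    have "(\<lambda>\<omega>. ?g (family [] \<omega>)) \<in> borel_measurable M"
      by (rule measurable_compose[OF family_measurable g_measurable])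
    then show "integrable M (\<lambda>\<omega>. ?g (family [] \<omega>))"
    proof (rule integrable_const_bound[where B = 1, rotated])
      have "norm (?g (family [] \<omega>)) \<le> 1" for \<omega>
        by (simp only: real_norm_def abs_of_nonneg g_bounds)
      then show "AE \<omega> in M. norm (?g (family [] \<omega>)) \<le> 1" by (rule AE_I2)
    qed
    show "AE \<omega> in M. 0 \<le> ?g (family [] \<omega>)" by (rule AE_I2) (rule g_bounds)
  qed
  also have "expectation (\<lambda>\<omega>. ?g (family [] \<omega>)) = val acc step base (Suc n) y"
    by (simp cong: if_cong)
  finally show ?case
    by (simp add: emeasure_eq_measure val_bounds del: val.simps descends.simps)
qed

end

section \<open>Visits along rays\<close>

context offspring begin

text \<open>The probability, starting at x, that no line makes m or more visits to 0 within n
  generations. The second argument is the remaining budget, and the first factor vanishes when it is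
  exhausted.\<close>

primrec cnt :: "nat \<Rightarrow> nat \<Rightarrow> int \<Rightarrow> real" where
  "cnt 0 m x = of_bool (of_bool (x = 0) < m)"
| "cnt (Suc n) m x = of_bool (of_bool (x = 0) < m) * T (cnt n (m - of_bool (x = 0))) x"

lemma cnt_unit_valued: "unit_valued (cnt n m)"
  by (induction n arbitrary: m) (auto simp: unit_valued_def T_bounds)

lemma cnt_decreasing: "cnt (Suc n) m x \<le> cnt n m x"
proof (induction n arbitrary: m x)
  case 0
  show ?case using T_bounds(2)[OF cnt_unit_valued[of 0 "m - of_bool (x = 0)"], of x] by simp
next
  case (Suc n)
  have "T (cnt (Suc n) k) x \<le> T (cnt n k) x" for k
    by (intro T_mono cnt_unit_valued Suc)
  then show ?case
    by (simp del: cnt.simps add: cnt.simps(2)[of n] cnt.simps(2)[of "Suc n"] mult_left_mono)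
qed

text \<open>The limit is a fixed point of \<open>T\<close> off 0 with value 1 - ret m at 0: there
  one visit is spent, and the induction hypothesis for m - 1 enters under one application of
  \<open>T\<close>. Maximality of \<open>Psi\<close> gives one inequality, iteration from above the
  other.\<close>

lemma cnt_tendsto: "(\<lambda>n. cnt n (Suc m) x) \<longlonglongrightarrow> Psi (1 - ret m) x"
proof (induction m arbitrary: x rule: less_induct)
  case (less m)
  define s where "s = 1 - ret m"
  have s: "0 \<le> s" "s \<le> 1" using ret_bounds[of m] by (auto simp: s_def)
  define g where "g x = lim (\<lambda>n. cnt n (Suc m) x)" for x
  have lim: "(\<lambda>n. cnt n (Suc m) x) \<longlonglongrightarrow> g x" for x
  proof -
    have "decseq (\<lambda>n. cnt n (Suc m) x)" by (rule decseq_SucI) (rule cnt_decreasing)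
    moreover have "0 \<le> cnt n (Suc m) x" for n by (rule unit_valuedD(1)[OF cnt_unit_valued])
    ultimately have "convergent (\<lambda>n. cnt n (Suc m) x)"
      using decseq_convergent[of "\<lambda>n. cnt n (Suc m) x" 0] by (metis convergent_def)
    then show ?thesis unfolding g_def by (simp add: convergent_LIMSEQ_iff)
  qed
  have ug: "unit_valued g"
    unfolding unit_valued_def using cnt_unit_valued[of _ "Suc m"]
    by (auto intro!: LIMSEQ_le_const[OF lim] LIMSEQ_le_const2[OF lim] simp: unit_valuedD)
  have fixed: "T g x = g x" if "x \<noteq> 0" for x
  proof -
    have "(\<lambda>n. T (cnt n (Suc m)) x) \<longlonglongrightarrow> T g x"
      by (rule T_tendsto) (auto simp: cnt_unit_valued lim cnt_decreasing simp del: cnt.simps)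
    moreover have "(\<lambda>n. T (cnt n (Suc m)) x) \<longlonglongrightarrow> g x"
      using LIMSEQ_Suc[OF lim[of x]] that by simp
    ultimately show ?thesis by (rule LIMSEQ_unique)
  qed
  have g0: "g 0 = s"
  proof (cases m)
    case 0
    have "cnt n (Suc m) 0 = 0" for n by (cases n) (auto simp: 0)
    then have "g 0 = 0" using LIMSEQ_unique[OF lim[of 0], of 0] by simp
    then show ?thesis by (simp add: s_def 0)
  next
    case (Suc k)
    have "(\<lambda>n. T (cnt n (Suc k)) 0) \<longlonglongrightarrow> T (Psi (1 - ret k)) 0"
      by (rule T_tendsto) (auto simp: cnt_unit_valued cnt_decreasing Suc intro!: less simp del: cnt.simps)
    moreover have "(\<lambda>n. T (cnt n (Suc k)) 0) \<longlonglongrightarrow> g 0"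
      using LIMSEQ_Suc[OF lim[of 0]] by (simp add: Suc)
    ultimately have "g 0 = T (Psi (1 - ret k)) 0" by (rule LIMSEQ_unique[rotated])
    then show ?thesis by (simp add: s_def Suc ret_Suc R_def)
  qed
  have "g x \<le> Psi s x" for x by (rule Psi_greatest[OF s ug]) (auto simp: g0 fixed)
  moreover have "Psi s x \<le> g x" for x
  proof -
    have "Psi s x \<le> cnt n (Suc m) x" for n x
    proof (induction n arbitrary: x)
      case 0
      show ?case
      proof (cases "x = 0")
        case True
        have "g 0 \<le> cnt 0 (Suc m) 0"
          using decseq_ge[OF decseq_SucI lim, of 0] cnt_decreasing by blast
        then show ?thesis using True by (simp add: Psi_0[OF s] g0 del: cnt.simps)
      qed (use unit_valuedD(2)[OF Psi_unit_valued[OF s]] in simp)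
    next
      case (Suc n)
      show ?case
      proof (cases "x = 0")
        case True
        have "g 0 \<le> cnt (Suc n) (Suc m) 0"
          using decseq_ge[OF decseq_SucI lim, of 0] cnt_decreasing by blast
        then show ?thesis using True by (simp add: Psi_0[OF s] g0 del: cnt.simps)
      next
        case False
        have "Psi s x = T (Psi s) x" using False by (simp add: Psi_fixed_point[OF s])
        also have "\<dots> \<le> T (cnt n (Suc m)) x" by (intro T_mono Psi_unit_valued s cnt_unit_valued Suc)
        finally show ?thesis using False by simp
      qed
    qed
    then show ?thesis by (intro LIMSEQ_le_const[OF lim]) auto
  qed
  ultimately have "g x = Psi s x" by (simp add: antisym)
  then show ?case using lim[of x] by (simp add: s_def)
qed

end

section \<open>Counting visits along labels relative to a vertex\<close>

primrec in_subtree :: "(nat list \<Rightarrow> enat \<times> (nat \<Rightarrow> real)) \<Rightarrow> nat list \<Rightarrow> nat list \<Rightarrow> bool" where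
  "in_subtree fam v [] = True"
| "in_subtree fam v (i # w) = (enat i < fst (fam v) \<and> in_subtree fam (v @ [i]) w)"

primrec zeros :: "(nat list \<Rightarrow> enat \<times> (nat \<Rightarrow> real)) \<Rightarrow> int \<Rightarrow> nat list \<Rightarrow> nat list \<Rightarrow> nat" where
  "zeros fam x v [] = of_bool (x = 0)"
| "zeros fam x v (i # w) = of_bool (x = 0) + zeros fam (x + \<lfloor>snd (fam v) i\<rfloor>) (v @ [i]) w"

text \<open>The test passes if the current vertex leaves at least one unit of the budget, so the
  truncated subtraction in \<open>zeros_step\<close> never underflows on accepted states.\<close>

definition zeros_acc :: "int \<times> nat \<Rightarrow> enat \<Rightarrow> bool" where
  "zeros_acc y e = (of_bool (fst y = 0) < snd y)"

definition zeros_step :: "int \<times> nat \<Rightarrow> int \<Rightarrow> int \<times> nat" where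
  "zeros_step y k = (fst y + k, snd y - of_bool (fst y = 0))"

definition zeros_base :: "int \<times> nat \<Rightarrow> bool" where
  "zeros_base y = (of_bool (fst y = 0) < snd y)"

lemma descends_zeros:
  "descends zeros_acc zeros_step zeros_base fam n (x, m) v \<longleftrightarrow>
    (\<forall>w. length w \<le> n \<longrightarrow> in_subtree fam v w \<longrightarrow> zeros fam x v w < m)"
proof (induction n arbitrary: x m v)
  case 0
  show ?case by (simp add: zeros_base_def)
next
  case (Suc n)
  have "(\<forall>w. length w \<le> Suc n \<longrightarrow> in_subtree fam v w \<longrightarrow> zeros fam x v w < m) \<longleftrightarrow>
      zeros fam x v [] < m \<and> (\<forall>i w. length w \<le> n \<longrightarrow> in_subtree fam v (i # w) \<longrightarrow> zeros fam x v (i # w) < m)"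
    (is "?L \<longleftrightarrow> ?R")
  proof
    assume ?L
    then show ?R by (metis in_subtree.simps(1) le0 length_Cons list.size(3) Suc_le_mono)
  next
    assume R: ?R
    show ?L
    proof (intro allI impI)
      fix w assume "length w \<le> Suc n" "in_subtree fam v w"
      then show "zeros fam x v w < m" using R by (cases w) auto
    qed
  qed
  also have "\<dots> \<longleftrightarrow> descends zeros_acc zeros_step zeros_base fam (Suc n) (x, m) v"
    by (auto simp: zeros_acc_def zeros_step_def Suc less_diff_conv add.commute)
  finally show ?case by simp
qed

text \<open>With \<open>base\<close> constantly false every line must end before generation n;
  finite offspring then leaves finitely many vertices.\<close>

lemma finite_of_descends:
  "descends (\<lambda>_ e. e < \<infinity>) (\<lambda>y _. y) (\<lambda>_. False) fam n y v \<Longrightarrow> finite {w. in_subtree fam v w}"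
proof (induction n arbitrary: y v)
  case (Suc n)
  then obtain c where c: "fst (fam v) = enat c" by (auto simp: less_infinityE)
  have "{w. in_subtree fam v w} \<subseteq> insert [] (\<Union>i<c. (#) i ` {w. in_subtree fam (v @ [i]) w})"
  proof
    fix w assume "w \<in> {w. in_subtree fam v w}"
    then show "w \<in> insert [] (\<Union>i<c. (#) i ` {w. in_subtree fam (v @ [i]) w})"
      using c by (cases w) auto
  qed
  moreover have "finite {w. in_subtree fam (v @ [i]) w}" if "i < c" for i
    using Suc c that by auto
  ultimately show ?case by (auto intro: finite_subset)
qed simp

lemma in_subtree_iff: "in_subtree fam v w \<longleftrightarrow> (\<forall>k<length w. enat (w ! k) < fst (fam (v @ take k w)))"
proof (induction w arbitrary: v)
  case (Cons i w)
  have "(\<forall>k<length (i # w). enat ((i # w) ! k) < fst (fam (v @ take k (i # w)))) \<longleftrightarrow>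
      enat i < fst (fam v) \<and> (\<forall>k<length w. enat (w ! k) < fst (fam ((v @ [i]) @ take k w)))"
    by (subst length_Cons, subst All_less_Suc2) auto
  then show ?case using Cons by simp
qed simp

lemma zeros_eq_sum:
  "zeros fam x v w = (\<Sum>k\<le>length w. of_bool (x + (\<Sum>j<k. \<lfloor>snd (fam (v @ take j w)) (w ! j)\<rfloor>) = 0))"
proof (induction w arbitrary: x v)
  case (Cons i w)
  have "(\<Sum>j<Suc k. \<lfloor>snd (fam (v @ take j (i # w))) ((i # w) ! j)\<rfloor>) =
      \<lfloor>snd (fam v) i\<rfloor> + (\<Sum>j<k. \<lfloor>snd (fam ((v @ [i]) @ take j w)) (w ! j)\<rfloor>)" for k
    by (subst sum.lessThan_Suc_shift) simp
  then show ?case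
    by (simp only: zeros.simps Cons length_Cons sum.atMost_Suc_shift) (simp add: add.assoc)
qed simp

section \<open>From vertices to rays\<close>

definition level_count :: "(nat list \<Rightarrow> real) \<Rightarrow> nat \<Rightarrow> nat list \<Rightarrow> nat" where
  "level_count V l u = (\<Sum>k\<le>length u. of_bool (V (take k u) = real l))"

lemma level_count_snoc: "level_count V l (u @ [i]) = level_count V l u + of_bool (V (u @ [i]) = real l)"
proof -
  have "(\<Sum>k\<le>length u. of_bool (V (take k (u @ [i])) = real l)) = level_count V l u"
    unfolding level_count_def by (intro sum.cong) auto
  then show ?thesis by (simp add: level_count_def)
qed

lemma tree_Nil: "[] \<in> tree N \<omega>" by (simp add: tree_def)

lemma tree_prefix: "u \<in> tree N \<omega> \<Longrightarrow> take k u \<in> tree N \<omega>"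
  by (auto simp: tree_def min_def)

definition ray_term :: "(nat list \<Rightarrow> real) \<Rightarrow> (nat \<Rightarrow> nat list option) \<Rightarrow> nat \<Rightarrow> nat \<Rightarrow> ereal" where
  "ray_term V \<xi> l n = (case \<xi> n of None \<Rightarrow> 0 | Some u \<Rightarrow> if V u = real l then 1 else 0)"

lemma visits_eq: "visits V \<xi> l = (\<Sum>n. ray_term V \<xi> l n)"
  by (simp add: visits_def ray_term_def)

lemma ray_term_nonneg: "0 \<le> ray_term V \<xi> l n"
  by (simp add: ray_term_def split: option.split)

text \<open>Every partial count along a ray is the count at a vertex. Beyond the end of a finite ray
  the last vertex keeps this role, hence the conditional form of the last clause.\<close>

lemma ray_partial_sum:
  assumes \<xi>: "\<xi> \<in> rays (tree N \<omega>)"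
  shows "\<exists>u\<in>tree N \<omega>. (\<Sum>k\<le>n. ray_term V \<xi> l k) = ereal (real (level_count V l u)) \<and> (\<forall>u'. \<xi> n = Some u' \<longrightarrow> u' = u)"
proof (induction n)
  case 0
  have "\<xi> 0 = Some []" using \<xi> by (simp add: rays_def)
  then show ?case
    by (intro bexI[of _ "[]"]) (auto simp: ray_term_def level_count_def tree_Nil)
next
  case (Suc n)
  then obtain u where u: "u \<in> tree N \<omega>" "(\<Sum>k\<le>n. ray_term V \<xi> l k) = ereal (real (level_count V l u))"
    "\<And>u'. \<xi> n = Some u' \<Longrightarrow> u' = u" by auto
  have step: "case \<xi> n of None \<Rightarrow> \<xi> (Suc n) = None
      | Some u \<Rightarrow> if is_leaf (tree N \<omega>) u then \<xi> (Suc n) = None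
                  else (\<exists>i. u @ [i] \<in> tree N \<omega> \<and> \<xi> (Suc n) = Some (u @ [i]))"
    using \<xi> by (simp add: rays_def)
  show ?case
  proof (cases "\<xi> (Suc n)")
    case None
    then have "ray_term V \<xi> l (Suc n) = 0" by (simp add: ray_term_def)
    then show ?thesis using u(1,2) None by (intro bexI[of _ u]) simp_all
  next
    case (Some u')
    then obtain u0 where u0: "\<xi> n = Some u0" using step by (cases "\<xi> n") simp_all
    then have "\<xi> n = Some u" using u(3) by blast
    then have "if is_leaf (tree N \<omega>) u then \<xi> (Suc n) = None
        else (\<exists>i. u @ [i] \<in> tree N \<omega> \<and> \<xi> (Suc n) = Some (u @ [i]))" using step by simp
    then obtain i where i: "u @ [i] \<in> tree N \<omega>" "\<xi> (Suc n) = Some (u @ [i])"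
      using Some by (cases "is_leaf (tree N \<omega>) u") auto
    then have "ray_term V \<xi> l (Suc n) = ereal (of_bool (V (u @ [i]) = real l))"
      by (simp add: ray_term_def one_ereal_def zero_ereal_def)
    then have "(\<Sum>k\<le>Suc n. ray_term V \<xi> l k) = ereal (real (level_count V l (u @ [i])))"
      using u(2) by (simp add: level_count_snoc)
    then show ?thesis using i by (intro bexI[of _ "u @ [i]"]) simp_all
  qed
qed

lemma SUP_visits_le:
  assumes "\<And>u. u \<in> tree N \<omega> \<Longrightarrow> level_count V l u \<le> m"
  shows "(SUP \<xi>\<in>rays (tree N \<omega>). visits V \<xi> l) \<le> ereal (real m)"
proof (rule SUP_least)
  fix \<xi> assume \<xi>: "\<xi> \<in> rays (tree N \<omega>)"
  have "(\<Sum>k<n. ray_term V \<xi> l k) \<le> ereal (real m)" for n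
  proof -
    obtain u where "u \<in> tree N \<omega>" "(\<Sum>k\<le>n. ray_term V \<xi> l k) = ereal (real (level_count V l u))"
      using ray_partial_sum[OF \<xi>] by blast
    then have "(\<Sum>k\<le>n. ray_term V \<xi> l k) \<le> ereal (real m)" using assms by simp
    moreover have "(\<Sum>k<n. ray_term V \<xi> l k) \<le> (\<Sum>k\<le>n. ray_term V \<xi> l k)"
      by (intro sum_mono2) (auto simp: ray_term_nonneg)
    ultimately show ?thesis by order
  qed
  then show "visits V \<xi> l \<le> ereal (real m)"
    unfolding visits_eq by (intro suminf_le_const summable_ereal_pos ray_term_nonneg)
qed

text \<open>Below w an arbitrary child is chosen again and again, until a leaf ends the ray, if
  ever.\<close>

lemma exists_ray_through:
  assumes w: "w \<in> tree N \<omega>"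
  shows "\<exists>\<xi>\<in>rays (tree N \<omega>). \<forall>k\<le>length w. \<xi> k = Some (take k w)"
proof -
  let ?T = "tree N \<omega>"
  define nxt where "nxt r = (case r of None \<Rightarrow> None
    | Some u \<Rightarrow> if is_leaf ?T u then None else Some (u @ [SOME i. u @ [i] \<in> ?T]))" for r
  define \<xi> where "\<xi> n = (if n \<le> length w then Some (take n w) else (nxt ^^ (n - length w)) (Some w))" for n
  have inT: "u \<in> ?T" if "(nxt ^^ k) (Some w) = Some u" for k u
    using that
  proof (induction k arbitrary: u)
    case (Suc k)
    have "nxt ((nxt ^^ k) (Some w)) = Some u" using Suc.prems by simp
    moreover have "nxt None = None" by (simp add: nxt_def)
    ultimately obtain u0 where u0: "(nxt ^^ k) (Some w) = Some u0" "nxt (Some u0) = Some u"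
      by (cases "(nxt ^^ k) (Some w)") auto
    then have u0: "(nxt ^^ k) (Some w) = Some u0" "\<not> is_leaf ?T u0" "u = u0 @ [SOME i. u0 @ [i] \<in> ?T]"
      by (auto simp: nxt_def split: if_splits)
    then have "\<exists>i. u0 @ [i] \<in> ?T" using Suc.IH by (auto simp: is_leaf_def)
    then show ?case unfolding u0(3) by (rule someI_ex)
  qed (use w in simp)
  have "\<xi> \<in> rays ?T"
    unfolding rays_def
  proof (intro CollectI conjI allI)
    show "\<xi> 0 = Some []" by (simp add: \<xi>_def)
    fix n
    show "case \<xi> n of None \<Rightarrow> \<xi> (Suc n) = None
      | Some u \<Rightarrow> if is_leaf ?T u then \<xi> (Suc n) = None
                  else (\<exists>i. u @ [i] \<in> ?T \<and> \<xi> (Suc n) = Some (u @ [i]))"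
    proof (cases "n < length w")
      case True
      have t: "take (Suc n) w = take n w @ [w ! n]" using True by (rule take_Suc_conv_app_nth)
      moreover have "take (Suc n) w \<in> ?T" by (rule tree_prefix[OF w])
      ultimately show ?thesis using True by (auto simp: \<xi>_def is_leaf_def)
    next
      case False
      have n: "\<xi> n = (nxt ^^ (n - length w)) (Some w)" using False by (auto simp: \<xi>_def)
      have Sn: "\<xi> (Suc n) = nxt (\<xi> n)" unfolding n using False by (simp add: \<xi>_def Suc_diff_le)
      show ?thesis
      proof (cases "\<xi> n")
        case None
        then show ?thesis by (simp add: Sn nxt_def)
      next
        case (Some u)
        then have "u \<in> ?T" using inT n by auto
        then show ?thesis
          using Some someI_ex[of "\<lambda>i. u @ [i] \<in> ?T"] by (auto simp: Sn nxt_def is_leaf_def)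
      qed
    qed
  qed
  then show ?thesis by (intro bexI[of _ \<xi>]) (simp_all add: \<xi>_def)
qed

lemma level_count_le_SUP_visits:
  assumes w: "w \<in> tree N \<omega>"
  shows "ereal (real (level_count V l w)) \<le> (SUP \<xi>\<in>rays (tree N \<omega>). visits V \<xi> l)"
proof -
  obtain \<xi> where \<xi>: "\<xi> \<in> rays (tree N \<omega>)" "\<And>k. k \<le> length w \<Longrightarrow> \<xi> k = Some (take k w)"
    using exists_ray_through[OF w] by blast
  have "ereal (real (level_count V l w)) = (\<Sum>k\<le>length w. ray_term V \<xi> l k)"
    unfolding level_count_def of_nat_sum sum_ereal[symmetric]
    by (intro sum.cong refl) (simp add: ray_term_def \<xi> one_ereal_def zero_ereal_def)
  also have "\<dots> \<le> visits V \<xi> l"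
    unfolding visits_eq by (intro sum_le_suminf summable_ereal_pos) (auto simp: ray_term_nonneg)
  also have "\<dots> \<le> (SUP \<xi>\<in>rays (tree N \<omega>). visits V \<xi> l)" using \<xi>(1) by (rule SUP_upper)
  finally show ?thesis .
qed

context branching_random_walk begin

lemma in_subtree_family: "in_subtree (\<lambda>u. family u \<omega>) [] w \<longleftrightarrow> w \<in> tree N \<omega>"
  by (simp add: in_subtree_iff tree_def)

text \<open>A pathwise form of the support assumption, under which the floors inside
  \<open>descends\<close> are the displacements themselves.\<close>

definition integral_steps :: "'a \<Rightarrow> bool" where
  "integral_steps \<omega> \<longleftrightarrow> (\<forall>u i. enat i < N u \<omega> \<longrightarrow> X u i \<omega> = of_int \<lfloor>X u i \<omega>\<rfloor> \<and> \<lfloor>X u i \<omega>\<rfloor> \<le> 1)"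

lemma zeros_family:
  assumes "integral_steps \<omega>" "w \<in> tree N \<omega>"
  shows "zeros (\<lambda>u. family u \<omega>) (- int l) [] w = level_count (position X \<omega>) l w"
  unfolding zeros_eq_sum level_count_def
proof (intro sum.cong refl arg_cong[where f = of_bool])
  fix k assume k: "k \<in> {..length w}"
  have "position X \<omega> (take k w) = (\<Sum>j<k. X (take j w) (w ! j) \<omega>)"
    unfolding position_def using k by (intro sum.cong) auto
  also have "\<dots> = (\<Sum>j<k. of_int \<lfloor>X (take j w) (w ! j) \<omega>\<rfloor>)"
    using assms k by (intro sum.cong) (auto simp: integral_steps_def tree_def)
  finally have "position X \<omega> (take k w) = of_int (\<Sum>j<k. \<lfloor>X (take j w) (w ! j) \<omega>\<rfloor>)" by simp
  moreover have "(of_int (\<Sum>j<k. \<lfloor>X (take j w) (w ! j) \<omega>\<rfloor>) = real l) \<longleftrightarrow> (\<Sum>j<k. \<lfloor>X (take j w) (w ! j) \<omega>\<rfloor>) = int l"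
    by (metis of_int_eq_iff of_int_of_nat_eq)
  ultimately show "(- int l + (\<Sum>j<k. \<lfloor>snd (family ([] @ take j w) \<omega>) (w ! j)\<rfloor>) = 0) \<longleftrightarrow>
      position X \<omega> (take k w) = real l"
    by auto
qed

text \<open>Positions start at 0 and rise by at most 1, so avoiding level n keeps all of them below
  n.\<close>

lemma no_level_skipped:
  assumes \<omega>: "integral_steps \<omega>" and none: "\<And>u. u \<in> tree N \<omega> \<Longrightarrow> level_count (position X \<omega>) n u = 0"
    and w: "w \<in> tree N \<omega>"
  shows "level_count (position X \<omega>) (Suc n) w = 0"
proof -
  have int: "\<exists>z::int. position X \<omega> u = of_int z \<and> z < int n" if "u \<in> tree N \<omega>" for u
    using that
  proof (induction u rule: rev_induct)
    case Nil
    have "position X \<omega> [] \<noteq> real n" using none[OF tree_Nil] by (simp add: level_count_def)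
    then show ?case by (intro exI[of _ 0]) (auto simp: position_def)
  next
    case (snoc i u)
    have uT: "u \<in> tree N \<omega>" using tree_prefix[OF snoc.prems, of "length u"] by simp
    obtain z where z: "position X \<omega> u = of_int z" "z < int n" using snoc.IH[OF uT] by auto
    have "enat i < N u \<omega>" using snoc.prems by (auto simp: tree_def dest: spec[of _ "length u"])
    then have X: "X u i \<omega> = of_int \<lfloor>X u i \<omega>\<rfloor>" "\<lfloor>X u i \<omega>\<rfloor> \<le> 1" using \<omega> by (auto simp: integral_steps_def)
    have "position X \<omega> (u @ [i]) = (\<Sum>k<length u. X (take k (u @ [i])) ((u @ [i]) ! k) \<omega>) + X u i \<omega>"
      by (simp add: position_def)
    also have "(\<Sum>k<length u. X (take k (u @ [i])) ((u @ [i]) ! k) \<omega>) = position X \<omega> u"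
      unfolding position_def by (intro sum.cong) (auto simp: nth_append)
    finally have pos: "position X \<omega> (u @ [i]) = of_int (z + \<lfloor>X u i \<omega>\<rfloor>)" using z X by simp
    have "position X \<omega> (u @ [i]) \<noteq> real n"
      using none[OF snoc.prems] by (simp add: level_count_snoc)
    then have "z + \<lfloor>X u i \<omega>\<rfloor> \<noteq> int n" using pos by auto
    then show ?case using pos z X by (intro exI[of _ "z + \<lfloor>X u i \<omega>\<rfloor>"]) auto
  qed
  have "position X \<omega> (take k w) \<noteq> real (Suc n)" for k
  proof
    assume eq: "position X \<omega> (take k w) = real (Suc n)"
    obtain z where "position X \<omega> (take k w) = of_int z" "z < int n" using int[OF tree_prefix[OF w]] by blast
    then have "real_of_int z = real_of_int (int (Suc n))" using eq by simp
    then have "z = int (Suc n)" by (simp only: of_int_eq_iff)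
    then show False using \<open>z < int n\<close> by simp
  qed
  then show ?thesis by (simp add: level_count_def)
qed

lemma finite_tree_bounded:
  assumes "finite (tree N \<omega>)"
  shows "\<exists>n. \<forall>u\<in>tree N \<omega>. level_count (position X \<omega>) n u = 0"
proof -
  obtain B where B: "\<And>u. u \<in> tree N \<omega> \<Longrightarrow> position X \<omega> u \<le> B"
    using finite_imageI[OF assms, of "position X \<omega>"] by (metis Max_ge imageI)
  obtain n where n: "B < real n" using reals_Archimedean2 by blast
  have "position X \<omega> (take k u) \<noteq> real n" if "u \<in> tree N \<omega>" for k u
    using B[OF tree_prefix[OF that, of k]] n by auto
  then show ?thesis by (intro exI[of _ n]) (simp add: level_count_def)
qed

lemma tree_pred [measurable]: "Measurable.pred M (\<lambda>\<omega>. u \<in> tree N \<omega>)"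
  unfolding tree_def mem_Collect_eq by measurable

text \<open>Labels form a countable type, so finiteness of the tree is a countable union over the
  finite lists that contain it.\<close>

lemma survival_measurable: "survival M N \<in> events"
proof -
  have "infinite (tree N \<omega>) \<longleftrightarrow> \<not> (\<exists>us. \<forall>u. u \<in> tree N \<omega> \<longrightarrow> u \<in> set us)" for \<omega>
    by (metis List.finite_set finite_list finite_subset subsetI)
  then have "survival M N = {\<omega> \<in> space M. \<not> (\<exists>us. \<forall>u. u \<in> tree N \<omega> \<longrightarrow> u \<in> set us)}"
    by (simp add: survival_def)
  then show ?thesis by simp
qed

end

section \<open>Lattice-valued intensities\<close>

text \<open>Passes from a real step law to the law of k = 1 - step; flooring and clipping by
  \<open>nat\<close> change nothing on the lattice.\<close>

definition down_pmf :: "real measure \<Rightarrow> nat pmf" where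
  "down_pmf \<nu> = Abs_pmf (distr \<nu> (count_space UNIV) (\<lambda>x. nat (1 - \<lfloor>x\<rfloor>)))"

lemma measurable_down: "(\<lambda>x::real. nat (1 - \<lfloor>x\<rfloor>)) \<in> borel \<rightarrow>\<^sub>M count_space UNIV"
  by measurable

locale lattice_law = prob_space \<nu> for \<nu> :: "real measure" +
  assumes sets_law: "sets \<nu> = sets borel"
    and lattice: "AE x in \<nu>. x \<in> real_of_int ` {..0} \<union> {1}"
begin

abbreviation "D \<equiv> down_pmf \<nu>"

lemma measurable_down': "(\<lambda>x::real. nat (1 - \<lfloor>x\<rfloor>)) \<in> \<nu> \<rightarrow>\<^sub>M count_space UNIV"
  using measurable_down measurable_cong_sets[OF sets_law refl] by blast

lemma measure_D: "measure_pmf D = distr \<nu> (count_space UNIV) (\<lambda>x. nat (1 - \<lfloor>x\<rfloor>))"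
proof -
  let ?M = "distr \<nu> (count_space UNIV) (\<lambda>x. nat (1 - \<lfloor>x\<rfloor>))"
  interpret d: prob_space ?M by (rule prob_space_distr[OF measurable_down'])
  have "AE k in ?M. measure ?M {k} \<noteq> 0"
  proof (rule AE_I')
    have "(\<Union>k\<in>{k. measure ?M {k} = 0}. {k}) \<in> null_sets ?M"
      by (intro null_sets_UN') (auto simp: null_sets_def d.emeasure_eq_measure)
    then show "{k. measure ?M {k} = 0} \<in> null_sets ?M" by simp
  qed simp
  then show ?thesis
    unfolding down_pmf_def by (intro Abs_pmf_inverse) (auto intro: d.prob_space_axioms)
qed

lemma down_inverse: "AE x in \<nu>. 1 - real (nat (1 - \<lfloor>x\<rfloor>)) = x \<and> x = of_int \<lfloor>x\<rfloor> \<and> x \<le> 1"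
  using lattice by eventually_elim auto

lemma nn_integral_D:
  assumes f: "f \<in> borel_measurable borel"
  shows "(\<integral>\<^sup>+k. f (1 - real k) \<partial>measure_pmf D) = (\<integral>\<^sup>+x. f x \<partial>\<nu>)"
proof -
  have "(\<integral>\<^sup>+k. f (1 - real k) \<partial>measure_pmf D) = (\<integral>\<^sup>+x. f (1 - real (nat (1 - \<lfloor>x\<rfloor>))) \<partial>\<nu>)"
    unfolding measure_D by (rule nn_integral_distr[OF measurable_down']) simp
  also have "\<dots> = (\<integral>\<^sup>+x. f x \<partial>\<nu>)"
    by (rule nn_integral_cong_AE) (use down_inverse in eventually_elim, simp)
  finally show ?thesis .
qed

abbreviation "mean_pos \<equiv> (\<integral>\<^sup>+x. ennreal x \<partial>\<nu>)"
abbreviation "mean_neg \<equiv> (\<integral>\<^sup>+x. ennreal (- x) \<partial>\<nu>)"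

text \<open>The integrated identity k + (1 - k)^+ = 1 + (1 - k)^-. The additive form avoids
  subtracting possibly infinite integrals.\<close>

lemma mean_D: "(\<integral>\<^sup>+k. ennreal (real k) \<partial>measure_pmf D) + mean_pos = 1 + mean_neg"
proof -
  have "(\<integral>\<^sup>+k. ennreal (real k) \<partial>measure_pmf D) + mean_pos =
      (\<integral>\<^sup>+k. ennreal (real k) \<partial>measure_pmf D) + (\<integral>\<^sup>+k. ennreal (1 - real k) \<partial>measure_pmf D)"
    by (subst nn_integral_D) auto
  also have "\<dots> = (\<integral>\<^sup>+k. ennreal (real k) + ennreal (1 - real k) \<partial>measure_pmf D)"
    by (rule nn_integral_add[symmetric]) auto
  also have "\<dots> = (\<integral>\<^sup>+k. 1 + ennreal (- (1 - real k)) \<partial>measure_pmf D)"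
  proof (rule nn_integral_cong)
    fix k :: nat
    show "ennreal (real k) + ennreal (1 - real k) = 1 + ennreal (- (1 - real k))"
    proof (cases "k = 0")
      case False
      then have "ennreal (1 - real k) = 0" by (intro ennreal_neg) auto
      moreover have "ennreal 1 + ennreal (real k - 1) = ennreal (real k)"
        using False by (subst ennreal_plus[symmetric]) auto
      ultimately show ?thesis by simp
    qed (simp add: ennreal_neg)
  qed
  also have "\<dots> = 1 + (\<integral>\<^sup>+k. ennreal (- (1 - real k)) \<partial>measure_pmf D)"
    by (subst nn_integral_add) auto
  also have "(\<integral>\<^sup>+k. ennreal (- (1 - real k)) \<partial>measure_pmf D) = mean_neg"
    by (rule nn_integral_D[where f = "\<lambda>x. ennreal (- x)"]) simp
  finally show ?thesis .
qed

lemma mean_pos_eq: "mean_pos = ennreal (pmf D 0)"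
proof -
  have "mean_pos = (\<integral>\<^sup>+k. ennreal (1 - real k) \<partial>measure_pmf D)"
    by (rule nn_integral_D[symmetric]) simp
  also have "\<dots> = (\<integral>\<^sup>+k. indicator {0} k \<partial>measure_pmf D)"
    by (intro nn_integral_cong) (auto split: split_indicator simp: ennreal_neg Suc_le_eq)
  also have "\<dots> = ennreal (pmf D 0)" by (simp add: emeasure_pmf_single)
  finally show ?thesis .
qed

text \<open>Since \<open>mean_pos\<close> equals \<open>pmf D 0\<close>, both parts are finite and
  \<open>mean_D\<close> says that the mean of \<open>D\<close> is 1 + mean_neg - mean_pos.\<close>

lemma walk_of_mean:
  assumes neg: "0 < mean_neg" and le: "mean_neg \<le> mean_pos"
  shows "skip_free_walk D" and "pmf D 0 < 1"
    and "measure_pmf.expectation D real < 1 \<longleftrightarrow> mean_neg < mean_pos"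
proof -
  have fin: "mean_neg < \<infinity>" using le mean_pos_eq by (auto simp: less_top[symmetric] top_unique)
  then obtain n where n: "mean_neg = ennreal n" "0 \<le> n" by (cases mean_neg) auto
  have n0: "0 < n" using neg n by simp
  have np: "n \<le> pmf D 0" using le n by (simp add: mean_pos_eq)
  have "(\<integral>\<^sup>+k. ennreal (real k) \<partial>measure_pmf D) + ennreal (pmf D 0) = 1 + ennreal n"
    using mean_D by (simp add: mean_pos_eq n)
  moreover have "1 + ennreal n = ennreal (1 + n)" using n by (simp add: ennreal_plus)
  ultimately have eq: "(\<integral>\<^sup>+k. ennreal (real k) \<partial>measure_pmf D) + ennreal (pmf D 0) = ennreal (1 + n)" by simp
  then have "(\<integral>\<^sup>+k. ennreal (real k) \<partial>measure_pmf D) \<noteq> \<infinity>" by auto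
  then obtain e where e: "(\<integral>\<^sup>+k. ennreal (real k) \<partial>measure_pmf D) = ennreal e" "0 \<le> e"
    by (cases "\<integral>\<^sup>+k. ennreal (real k) \<partial>measure_pmf D") auto
  have "ennreal (e + pmf D 0) = ennreal (1 + n)" using eq e by (simp add: ennreal_plus)
  then have en: "e + pmf D 0 = 1 + n" using e n by (subst (asm) ennreal_inj) auto
  have int: "integrable (measure_pmf D) real"
    by (rule integrableI_bounded) (use e in auto)
  have Ee: "measure_pmf.expectation D real = e"
    using e by (intro integral_eq_nn_integral[THEN trans]) auto
  show "skip_free_walk D"
    by unfold_locales (use np n0 int Ee en in auto)
  show "pmf D 0 < 1"
  proof (rule ccontr)
    assume "\<not> pmf D 0 < 1"
    then have "pmf D 0 = 1" using pmf_le_1[of D 0] by simp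
    then have "AE k in measure_pmf D. k \<in> {0}" by (intro measure_pmf.AE_prob_1) (simp add: pmf.rep_eq)
    then have "(\<integral>\<^sup>+k. ennreal (- (1 - real k)) \<partial>measure_pmf D) = (\<integral>\<^sup>+k. 0 \<partial>measure_pmf D)"
    proof (rule nn_integral_cong_AE[OF eventually_mono])
      fix k :: nat assume "k \<in> {0}"
      then show "ennreal (- (1 - real k)) = 0" by (simp add: ennreal_neg)
    qed
    then show False using neg nn_integral_D[of "\<lambda>x. ennreal (- x)"] by simp
  qed
  show "measure_pmf.expectation D real < 1 \<longleftrightarrow> mean_neg < mean_pos"
    unfolding Ee mean_pos_eq n(1) ennreal_less_iff[OF n(2)] using en by linarith
qed

lemma square_integrable_D:
  assumes "(\<integral>\<^sup>+x. ennreal (x\<^sup>2) \<partial>\<nu>) < \<infinity>"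
  shows "integrable (measure_pmf D) (\<lambda>k. (real k)\<^sup>2)"
proof (rule integrableI_bounded)
  \<comment> \<open>The difference of the two sides is (k - 2)^2.\<close>
  have sq: "(real k)\<^sup>2 \<le> 2 + 2 * (1 - real k)\<^sup>2" for k
    using zero_le_power2[of "real k - 2"] by (simp add: power2_eq_square algebra_simps)
  have "(\<integral>\<^sup>+k. ennreal (norm ((real k)\<^sup>2)) \<partial>measure_pmf D) \<le> (\<integral>\<^sup>+k. 2 + 2 * ennreal ((1 - real k)\<^sup>2) \<partial>measure_pmf D)"
  proof (rule nn_integral_mono)
    fix k
    have "ennreal (norm ((real k)\<^sup>2)) \<le> ennreal (2 + 2 * (1 - real k)\<^sup>2)" using sq by (intro ennreal_leI) simp
    also have "\<dots> = 2 + 2 * ennreal ((1 - real k)\<^sup>2)" by (simp add: ennreal_plus ennreal_mult)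
    finally show "ennreal (norm ((real k)\<^sup>2)) \<le> 2 + 2 * ennreal ((1 - real k)\<^sup>2)" .
  qed
  also have "\<dots> = 2 + 2 * (\<integral>\<^sup>+k. ennreal ((1 - real k)\<^sup>2) \<partial>measure_pmf D)"
    by (subst nn_integral_add) (auto simp: nn_integral_cmult)
  also have "(\<integral>\<^sup>+k. ennreal ((1 - real k)\<^sup>2) \<partial>measure_pmf D) = (\<integral>\<^sup>+x. ennreal (x\<^sup>2) \<partial>\<nu>)"
    by (rule nn_integral_D[where f = "\<lambda>x. ennreal (x\<^sup>2)"]) simp
  also have "2 + 2 * (\<integral>\<^sup>+x. ennreal (x\<^sup>2) \<partial>\<nu>) < \<infinity>" using assms by (simp add: ennreal_mult_less_top)
  finally show "(\<integral>\<^sup>+k. ennreal (norm ((real k)\<^sup>2)) \<partial>measure_pmf D) < \<infinity>" .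
qed simp

end

lemma sets_tilted_law [simp]: "sets (tilted_law \<mu> t) = sets \<mu>"
  by (simp add: tilted_law_def)

lemma nn_integral_tilted_law:
  assumes "sets \<mu> = sets borel" "f \<in> borel_measurable borel"
  shows "(\<integral>\<^sup>+x. f x \<partial>tilted_law \<mu> t) = (\<integral>\<^sup>+x. ennreal (exp (- t * x)) * f x \<partial>\<mu>)"
proof -
  have [measurable_cong]: "sets \<mu> = sets borel" by fact
  show ?thesis unfolding tilted_law_def using assms(2) by (intro nn_integral_density) measurable
qed

lemma tilted_mean_pos_eq:
  assumes "sets \<mu> = sets borel"
  shows "tilted_mean_pos \<mu> t = (\<integral>\<^sup>+x. ennreal x \<partial>tilted_law \<mu> t)"
  unfolding tilted_mean_pos_def
  by (subst nn_integral_tilted_law[OF assms]) (auto intro!: nn_integral_cong split: split_indicator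
      simp: ennreal_mult' ennreal_neg mult.commute)

lemma tilted_mean_neg_eq:
  assumes "sets \<mu> = sets borel"
  shows "tilted_mean_neg \<mu> t = (\<integral>\<^sup>+x. ennreal (- x) \<partial>tilted_law \<mu> t)"
  unfolding tilted_mean_neg_def
  by (subst nn_integral_tilted_law[OF assms]) (auto intro!: nn_integral_cong split: split_indicator
      simp: ennreal_mult' ennreal_neg mult.commute)

lemma log_laplace_eq_0:
  assumes "log_laplace \<mu> t = 0"
  shows "(\<integral>\<^sup>+x. ennreal (exp (- t * x)) \<partial>\<mu>) = 1"
proof -
  let ?I = "\<integral>\<^sup>+x. ennreal (exp (- t * x)) \<partial>\<mu>"
  have I: "?I \<noteq> \<infinity>" "?I \<noteq> 0" using assms by (auto simp: log_laplace_def Let_def split: if_splits)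
  then have "ln (enn2real ?I) = 0" using assms by (simp add: log_laplace_def Let_def zero_ereal_def)
  moreover have "0 < enn2real ?I" using I by (simp add: enn2real_positive_iff zero_less_iff_neq_zero less_top)
  ultimately have "enn2real ?I = 1" by (simp add: ln_eq_zero_iff)
  then show ?thesis using I by (metis ennreal_1 ennreal_enn2real_if infinity_ennreal_def)
qed

context branching_random_walk begin

lemma sets_intensity [simp, measurable_cong]: "sets (intensity M N X) = sets borel"
  unfolding intensity_def
  using sets.sigma_algebra_axioms[of "borel :: real measure"]
  by (simp add: sigma_algebra.sigma_sets_eq)

text \<open>Campbell's formula for the first generation, by induction over nonnegative Borel
  functions from the values of the intensity on sets.\<close>

lemma nn_integral_intensity:
  assumes "f \<in> borel_measurable borel"
  shows "(\<integral>\<^sup>+x. f x \<partial>intensity M N X) = (\<integral>\<^sup>+\<omega>. (\<Sum>i. if enat i < N [] \<omega> then f (X [] i \<omega>) else 0) \<partial>M)"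
  using assms
proof (induction rule: borel_measurable_induct)
  case (cong f g)
  then have fg: "f = g" by (auto simp: fun_eq_iff)
  show ?case unfolding fg using cong by blast
next
  case (set A)
  then have "(\<integral>\<^sup>+x. indicator A x \<partial>intensity M N X) = (\<integral>\<^sup>+\<omega>. emeasure (reproduction_process N X \<omega>) A \<partial>M)"
    by (simp add: emeasure_intensity)
  also have "\<dots> = (\<integral>\<^sup>+\<omega>. (\<Sum>i. if enat i < N [] \<omega> then indicator A (X [] i \<omega>) else 0) \<partial>M)"
    by (intro nn_integral_cong) (subst emeasure_reproduction_process[OF set], intro suminf_cong, simp)
  finally show ?case .
next
  case (mult u c)
  have [measurable]: "u \<in> borel_measurable borel" by fact
  have "(\<integral>\<^sup>+x. c * u x \<partial>intensity M N X) = c * (\<integral>\<^sup>+x. u x \<partial>intensity M N X)"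
    by (rule nn_integral_cmult) measurable
  also have "\<dots> = (\<integral>\<^sup>+\<omega>. c * (\<Sum>i. if enat i < N [] \<omega> then u (X [] i \<omega>) else 0) \<partial>M)"
    unfolding mult.IH by (rule nn_integral_cmult[symmetric]) measurable
  also have "\<dots> = (\<integral>\<^sup>+\<omega>. (\<Sum>i. if enat i < N [] \<omega> then c * u (X [] i \<omega>) else 0) \<partial>M)"
    by (intro nn_integral_cong) (subst ennreal_suminf_cmult[symmetric], intro suminf_cong, simp)
  finally show ?case .
next
  case (add u v)
  have [measurable]: "u \<in> borel_measurable borel" "v \<in> borel_measurable borel" by fact+
  have "(\<integral>\<^sup>+x. v x + u x \<partial>intensity M N X) = (\<integral>\<^sup>+x. v x \<partial>intensity M N X) + (\<integral>\<^sup>+x. u x \<partial>intensity M N X)"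
    by (rule nn_integral_add) measurable
  also have "\<dots> = (\<integral>\<^sup>+\<omega>. (\<Sum>i. if enat i < N [] \<omega> then v (X [] i \<omega>) else 0) + (\<Sum>i. if enat i < N [] \<omega> then u (X [] i \<omega>) else 0) \<partial>M)"
    unfolding add.IH by (rule nn_integral_add[symmetric]) measurable
  also have "\<dots> = (\<integral>\<^sup>+\<omega>. (\<Sum>i. if enat i < N [] \<omega> then v (X [] i \<omega>) + u (X [] i \<omega>) else 0) \<partial>M)"
    by (intro nn_integral_cong) (subst suminf_add, auto intro!: suminf_cong)
  finally show ?case .
next
  case (seq U)
  have [measurable]: "U i \<in> borel_measurable borel" for i by (rule seq)
  have inc: "incseq U" by fact
  have "(\<integral>\<^sup>+x. (SUP i. U i) x \<partial>intensity M N X) = (SUP i. \<integral>\<^sup>+x. U i x \<partial>intensity M N X)"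
    unfolding SUP_apply by (rule nn_integral_monotone_convergence_SUP[OF inc]) measurable
  also have "\<dots> = (SUP j. \<integral>\<^sup>+\<omega>. (\<Sum>i. if enat i < N [] \<omega> then U j (X [] i \<omega>) else 0) \<partial>M)"
    by (simp only: seq.IH)
  also have "\<dots> = (\<integral>\<^sup>+\<omega>. (SUP j. \<Sum>i. if enat i < N [] \<omega> then U j (X [] i \<omega>) else 0) \<partial>M)"
  proof (rule nn_integral_monotone_convergence_SUP[symmetric])
    show "incseq (\<lambda>j \<omega>. \<Sum>i. if enat i < N [] \<omega> then U j (X [] i \<omega>) else 0)"
      using inc by (intro incseq_SucI le_funI suminf_le) (auto simp: incseq_Suc_iff le_fun_def)
  qed measurable
  also have "\<dots> = (\<integral>\<^sup>+\<omega>. (\<Sum>i. if enat i < N [] \<omega> then (SUP j. U j) (X [] i \<omega>) else 0) \<partial>M)"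
  proof (intro nn_integral_cong)
    fix \<omega>
    have "(SUP j. \<Sum>i. if enat i < N [] \<omega> then U j (X [] i \<omega>) else 0) =
        (\<Sum>i. SUP j. if enat i < N [] \<omega> then U j (X [] i \<omega>) else 0)"
      using inc by (intro ennreal_suminf_SUP_eq[symmetric]) (auto simp: incseq_def le_fun_def)
    also have "\<dots> = (\<Sum>i. if enat i < N [] \<omega> then (SUP j. U j) (X [] i \<omega>) else 0)"
      by (intro suminf_cong) (auto simp: image_comp)
    finally show "(SUP j. \<Sum>i. if enat i < N [] \<omega> then U j (X [] i \<omega>) else 0) =
        (\<Sum>i. if enat i < N [] \<omega> then (SUP j. U j) (X [] i \<omega>) else 0)" .
  qed
  finally show ?case .
qed

lemma lattice_set: "UNIV - (real_of_int ` {..0} \<union> {1}) \<in> sets borel"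
proof -
  have "real_of_int ` {..0} \<union> {1} \<in> sets borel"
    by (rule sets.countable) auto
  then show ?thesis by auto
qed

lemma lattice_law_tilted:
  assumes laplace: "(\<integral>\<^sup>+x. ennreal (exp (- t * x)) \<partial>intensity M N X) = 1"
    and support: "emeasure (intensity M N X) (UNIV - (real_of_int ` {..0} \<union> {1})) = 0"
  shows "lattice_law (tilted_law (intensity M N X) t)"
proof (intro lattice_law.intro prob_spaceI lattice_law_axioms.intro)
  let ?\<mu> = "intensity M N X" and ?\<nu> = "tilted_law (intensity M N X) t"
  have "(\<integral>\<^sup>+x. 1 \<partial>?\<nu>) = (\<integral>\<^sup>+x. ennreal (exp (- t * x)) * 1 \<partial>?\<mu>)"
    by (rule nn_integral_tilted_law) simp_all
  then show "emeasure ?\<nu> (space ?\<nu>) = 1"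
    using laplace by simp
  show "sets ?\<nu> = sets borel" by simp
  have "AE x in ?\<mu>. x \<in> real_of_int ` {..0} \<union> {1}"
  proof (rule AE_I')
    show "UNIV - (real_of_int ` {..0} \<union> {1}) \<in> null_sets ?\<mu>"
      using support lattice_set by (simp add: null_sets_def)
  qed auto
  then show "AE x in ?\<nu>. x \<in> real_of_int ` {..0} \<union> {1}"
    unfolding tilted_law_def by (subst AE_density) auto
qed

end

text \<open>The common setting of both cases: the last two assumptions say that the associated walk
  takes downward steps and has nonnegative drift.\<close>

locale lattice_brw = branching_random_walk +
  fixes t :: real
  assumes tpos: "0 < t"
    and laplace: "(\<integral>\<^sup>+x. ennreal (exp (- t * x)) \<partial>intensity M N X) = 1"
    and support: "emeasure (intensity M N X) (UNIV - (real_of_int ` {..0} \<union> {1})) = 0"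
    and second_moment:
      "(\<integral>\<^sup>+\<omega>. (\<Sum>\<^sub>\<infinity>(u, v) \<in> {(u, v). u \<in> generation N \<omega> 1 \<and> v \<in> generation N \<omega> 1 \<and> u \<noteq> v}.
          ennreal (exp (- t * position X \<omega> u) * exp (- t * position X \<omega> v))) \<partial>M) < \<infinity>"
    and mean_neg: "0 < tilted_mean_neg (intensity M N X) t"
    and mean_le: "tilted_mean_neg (intensity M N X) t \<le> tilted_mean_pos (intensity M N X) t"
begin

abbreviation "\<mu> \<equiv> intensity M N X"
abbreviation "\<nu> \<equiv> tilted_law \<mu> t"

sublocale law: lattice_law \<nu>
  by (rule lattice_law_tilted[OF laplace support])

definition C :: real where
  "C = enn2real (\<integral>\<^sup>+\<omega>. (\<Sum>\<^sub>\<infinity>(u, v) \<in> {(u, v). u \<in> generation N \<omega> 1 \<and> v \<in> generation N \<omega> 1 \<and> u \<noteq> v}.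
          ennreal (exp (- t * position X \<omega> u) * exp (- t * position X \<omega> v))) \<partial>M)"

lemma AE_root_lattice: "AE \<omega> in M. \<forall>i. enat i < N [] \<omega> \<longrightarrow> X [] i \<omega> \<in> real_of_int ` {..0} \<union> {1}"
proof -
  let ?B = "UNIV - (real_of_int ` {..0} \<union> {1})"
  have [measurable]: "?B \<in> sets borel" by (rule lattice_set)
  have "(\<integral>\<^sup>+\<omega>. (\<Sum>i. if enat i < N [] \<omega> then indicator ?B (X [] i \<omega>) else 0) \<partial>M) = (\<integral>\<^sup>+x. indicator ?B x \<partial>\<mu>)"
    by (rule nn_integral_intensity[symmetric]) measurable
  also have "\<dots> = 0" using support lattice_set by simp
  finally have "AE \<omega> in M. (\<Sum>i. if enat i < N [] \<omega> then indicator ?B (X [] i \<omega>) else 0 :: ennreal) = 0"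
    by (subst (asm) nn_integral_0_iff_AE) measurable
  then show ?thesis
  proof eventually_elim
    case (elim \<omega>)
    have zero: "(if enat i < N [] \<omega> then indicator ?B (X [] i \<omega>) else 0 :: ennreal) = 0" for i
      using elim by (subst (asm) suminf_eq_zero_iff) auto
    show ?case
    proof (intro allI impI, rule ccontr)
      fix i assume "enat i < N [] \<omega>" "X [] i \<omega> \<notin> real_of_int ` {..0} \<union> {1}"
      then show False
        using zero[of i] by simp
    qed
  qed
qed

text \<open>The lattice property passes from the root to every label, as all families share one law
  and labels are countable.\<close>

lemma AE_integral_steps: "AE \<omega> in M. integral_steps \<omega>"
proof -
  define good where "good f \<longleftrightarrow> (\<forall>i. enat i < fst f \<longrightarrow> snd f i \<in> real_of_int ` {..0} \<union> {1})"
    for f :: "enat \<times> (nat \<Rightarrow> real)"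
  have comp: "(\<lambda>f. snd f i) \<in> borel_measurable family_space" for i
    by (rule measurable_compose[OF measurable_snd measurable_component_singleton]) simp
  have [measurable]: "real_of_int ` {..0} \<union> {1} \<in> sets borel" by (rule sets.countable) auto
  have [measurable]: "Measurable.pred family_space (\<lambda>f. snd f i \<in> real_of_int ` {..0} \<union> {1})" for i
    by (rule pred_sets2[OF _ comp]) measurable
  have good: "Measurable.pred family_space good" unfolding good_def[abs_def] by measurable
  then have G: "{f \<in> space family_space. good f} \<in> sets family_space" by (simp add: pred_def)
  have "AE \<omega> in M. good (family u \<omega>)" for u
  proof -
    have "AE f in distr M family_space (family []). good f"
      using AE_root_lattice by (subst AE_distr_iff[OF family_measurable G]) (simp add: good_def)
    then have "AE f in distr M family_space (family u). good f" by (simp only: distr_family[of u])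
    then show ?thesis by (subst (asm) AE_distr_iff[OF family_measurable G])
  qed
  then have "AE \<omega> in M. \<forall>u. good (family u \<omega>)" by (simp add: AE_all_countable)
  then show ?thesis
  proof eventually_elim
    case (elim \<omega>)
    then show ?case by (fastforce simp: good_def integral_steps_def)
  qed
qed

lemma pairs_le_second_moment:
  "(\<Sum>i. \<Sum>j<i. if enat i < N [] \<omega> \<and> enat j < N [] \<omega> then ennreal (exp (- t * X [] i \<omega>) * exp (- t * X [] j \<omega>)) else 0) \<le>
   (\<Sum>\<^sub>\<infinity>(u, v) \<in> {(u, v). u \<in> generation N \<omega> 1 \<and> v \<in> generation N \<omega> 1 \<and> u \<noteq> v}.
          ennreal (exp (- t * position X \<omega> u) * exp (- t * position X \<omega> v)))"
proof (rule suminf_le_const)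
  fix n
  let ?w = "\<lambda>(u, v). ennreal (exp (- t * position X \<omega> u) * exp (- t * position X \<omega> v))"
  let ?P = "{(u, v). u \<in> generation N \<omega> 1 \<and> v \<in> generation N \<omega> 1 \<and> u \<noteq> v}"
  let ?I = "{(i, j). i < n \<and> j < i \<and> enat i < N [] \<omega> \<and> enat j < N [] \<omega>}"
  have fin: "finite ?I" by (rule finite_subset[of _ "{..<n} \<times> {..<n}"]) auto
  have inj: "inj_on (\<lambda>(i, j). ([i], [j])) ?I" by (auto simp: inj_on_def)
  have sub: "(\<lambda>(i, j). ([i], [j])) ` ?I \<subseteq> ?P" unfolding generation_1 by auto
  have "(\<Sum>i<n. \<Sum>j<i. if enat i < N [] \<omega> \<and> enat j < N [] \<omega> then ennreal (exp (- t * X [] i \<omega>) * exp (- t * X [] j \<omega>)) else 0) =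
      (\<Sum>(i, j)\<in>Sigma {..<n} (\<lambda>i. {..<i}). if enat i < N [] \<omega> \<and> enat j < N [] \<omega> then ennreal (exp (- t * X [] i \<omega>) * exp (- t * X [] j \<omega>)) else 0)"
    by (rule sum.Sigma) auto
  also have "\<dots> = (\<Sum>(i, j)\<in>?I. ennreal (exp (- t * X [] i \<omega>) * exp (- t * X [] j \<omega>)))"
    by (rule sum.mono_neutral_cong_right) (auto split: if_splits)
  also have "\<dots> = (\<Sum>(i, j)\<in>?I. ?w ([i], [j]))"
    by (intro sum.cong) (auto simp: position_def)
  also have "\<dots> = sum ?w ((\<lambda>(i, j). ([i], [j])) ` ?I)"
    by (subst sum.reindex[OF inj]) (auto intro!: sum.cong)
  also have "\<dots> \<le> infsum ?w ?P"
    using fin sub by (subst nonneg_infsum_complete, simp) (intro SUP_upper, simp)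
  finally show "(\<Sum>i<n. \<Sum>j<i. if enat i < N [] \<omega> \<and> enat j < N [] \<omega> then ennreal (exp (- t * X [] i \<omega>) * exp (- t * X [] j \<omega>)) else 0) \<le> infsum ?w ?P" .
qed simp

lemma walk_D: "skip_free_walk law.D"
  and up_lt_1: "pmf law.D 0 < 1"
  and drift_iff: "measure_pmf.expectation law.D real < 1 \<longleftrightarrow> tilted_mean_neg \<mu> t < tilted_mean_pos \<mu> t"
  using law.walk_of_mean mean_neg mean_le
  by (simp_all add: tilted_mean_pos_eq tilted_mean_neg_eq)

sublocale offspring M law.D "\<lambda>i \<omega>. enat i < N [] \<omega>" "\<lambda>i \<omega>. \<lfloor>X [] i \<omega>\<rfloor>" t C
proof (intro offspring.intro offspring_axioms.intro)
  show "prob_space M" by (rule prob_space_axioms)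
  show "skip_free_walk law.D" by (rule walk_D)
  show "Measurable.pred M (\<lambda>\<omega>. enat i < N [] \<omega>)" for i by measurable
  show "(\<lambda>\<omega>. \<lfloor>X [] i \<omega>\<rfloor>) \<in> M \<rightarrow>\<^sub>M count_space UNIV" for i by measurable
  show "0 < t" by (rule tpos)
  show "0 \<le> C" by (simp add: C_def)
  show "(\<integral>\<^sup>+\<omega>. (\<Sum>i. if enat i < N [] \<omega> then f \<lfloor>X [] i \<omega>\<rfloor> else 0) \<partial>M) =
      (\<integral>\<^sup>+k. f (1 - int k) * ennreal (exp (t * (1 - real k))) \<partial>measure_pmf law.D)" for f :: "int \<Rightarrow> ennreal"
  proof -
    have [measurable]: "(\<lambda>x::real. f \<lfloor>x\<rfloor>) \<in> borel_measurable borel"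
      by (rule measurable_compose[where N = "count_space UNIV"]) measurable
    have "(\<integral>\<^sup>+\<omega>. (\<Sum>i. if enat i < N [] \<omega> then f \<lfloor>X [] i \<omega>\<rfloor> else 0) \<partial>M) = (\<integral>\<^sup>+x. f \<lfloor>x\<rfloor> \<partial>\<mu>)"
      by (rule nn_integral_intensity[symmetric]) measurable
    \<comment> \<open>Inserting exp (-t x) exp (t x) = 1 passes from the intensity to the tilted
      law.\<close>
    also have "\<dots> = (\<integral>\<^sup>+x. ennreal (exp (- t * x)) * (f \<lfloor>x\<rfloor> * ennreal (exp (t * x))) \<partial>\<mu>)"
    proof (rule nn_integral_cong)
      fix x
      have "ennreal (exp (- t * x)) * ennreal (exp (t * x)) = 1"
        by (simp add: ennreal_mult[symmetric] flip: exp_add)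
      then show "f \<lfloor>x\<rfloor> = ennreal (exp (- t * x)) * (f \<lfloor>x\<rfloor> * ennreal (exp (t * x)))"
        by (metis mult.left_commute mult.right_neutral)
    qed
    also have "\<dots> = (\<integral>\<^sup>+x. f \<lfloor>x\<rfloor> * ennreal (exp (t * x)) \<partial>\<nu>)"
      by (rule nn_integral_tilted_law[symmetric]) (simp, measurable)
    also have "\<dots> = (\<integral>\<^sup>+k. f \<lfloor>1 - real k\<rfloor> * ennreal (exp (t * (1 - real k))) \<partial>measure_pmf law.D)"
      by (rule law.nn_integral_D[symmetric]) measurable
    also have "\<dots> = (\<integral>\<^sup>+k. f (1 - int k) * ennreal (exp (t * (1 - real k))) \<partial>measure_pmf law.D)"
    proof (rule nn_integral_cong)
      fix k
      have "1 - real k = of_int (1 - int k)" by simp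
      then have "\<lfloor>1 - real k\<rfloor> = 1 - int k" by (simp only: floor_of_int)
      then show "f \<lfloor>1 - real k\<rfloor> * ennreal (exp (t * (1 - real k))) = f (1 - int k) * ennreal (exp (t * (1 - real k)))" by simp
    qed
    finally show ?thesis .
  qed
  show "(\<integral>\<^sup>+\<omega>. (\<Sum>i. \<Sum>j<i. if enat i < N [] \<omega> \<and> enat j < N [] \<omega>
      then ennreal (exp (- t * of_int \<lfloor>X [] i \<omega>\<rfloor>) * exp (- t * of_int \<lfloor>X [] j \<omega>\<rfloor>)) else 0) \<partial>M) \<le> ennreal C"
  proof -
    have "(\<integral>\<^sup>+\<omega>. (\<Sum>i. \<Sum>j<i. if enat i < N [] \<omega> \<and> enat j < N [] \<omega>
        then ennreal (exp (- t * of_int \<lfloor>X [] i \<omega>\<rfloor>) * exp (- t * of_int \<lfloor>X [] j \<omega>\<rfloor>)) else 0) \<partial>M) =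
      (\<integral>\<^sup>+\<omega>. (\<Sum>i. \<Sum>j<i. if enat i < N [] \<omega> \<and> enat j < N [] \<omega>
        then ennreal (exp (- t * X [] i \<omega>) * exp (- t * X [] j \<omega>)) else 0) \<partial>M)"
    proof (rule nn_integral_cong_AE)
      show "AE \<omega> in M. (\<Sum>i. \<Sum>j<i. if enat i < N [] \<omega> \<and> enat j < N [] \<omega>
        then ennreal (exp (- t * of_int \<lfloor>X [] i \<omega>\<rfloor>) * exp (- t * of_int \<lfloor>X [] j \<omega>\<rfloor>)) else 0) =
        (\<Sum>i. \<Sum>j<i. if enat i < N [] \<omega> \<and> enat j < N [] \<omega>
        then ennreal (exp (- t * X [] i \<omega>) * exp (- t * X [] j \<omega>)) else 0)"
        using AE_root_lattice
      proof eventually_elim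
        case (elim \<omega>)
        then have X: "of_int \<lfloor>X [] i \<omega>\<rfloor> = X [] i \<omega>" if "enat i < N [] \<omega>" for i
          using that by fastforce
        show ?case by (intro suminf_cong sum.cong refl) (auto simp: X)
      qed
    qed
    also have "\<dots> \<le> (\<integral>\<^sup>+\<omega>. (\<Sum>\<^sub>\<infinity>(u, v) \<in> {(u, v). u \<in> generation N \<omega> 1 \<and> v \<in> generation N \<omega> 1 \<and> u \<noteq> v}.
          ennreal (exp (- t * position X \<omega> u) * exp (- t * position X \<omega> v))) \<partial>M)"
      by (intro nn_integral_mono pairs_le_second_moment)
    also have "\<dots> = ennreal C" using second_moment by (simp add: C_def ennreal_enn2real_if less_top)
    finally show ?thesis .
  qed
qed

end

section \<open>The associated random walk\<close>

text \<open>The pathwise counterpart of \<open>reach\<close>. The last argument is the index of the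
  first increment used, so that the recursion runs on later, independent increments.\<close>

primrec reaches :: "int set \<Rightarrow> int set \<Rightarrow> (nat \<Rightarrow> nat) \<Rightarrow> nat \<Rightarrow> int \<Rightarrow> nat \<Rightarrow> bool" where
  "reaches B C K 0 x j = (x \<in> B)"
| "reaches B C K (Suc n) x j = (x \<in> B \<or> x \<notin> C \<and> reaches B C K n (x + 1 - int (K j)) (Suc j))"

definition walk_pos :: "(nat \<Rightarrow> nat) \<Rightarrow> int \<Rightarrow> nat \<Rightarrow> nat \<Rightarrow> int" where
  "walk_pos K x j i = x + (\<Sum>l<i. 1 - int (K (j + l)))"

lemma walk_pos_Suc: "walk_pos K x j (Suc i) = walk_pos K (x + 1 - int (K j)) (Suc j) i"
  unfolding walk_pos_def by (subst sum.lessThan_Suc_shift) simp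

lemma walk_pos_0 [simp]: "walk_pos K x j 0 = x"
  by (simp add: walk_pos_def)

lemma reaches_iff:
  "reaches B C K n x j \<longleftrightarrow> (\<exists>i\<le>n. walk_pos K x j i \<in> B \<and> (\<forall>l<i. walk_pos K x j l \<notin> C))"
proof (induction n arbitrary: x j)
  case (Suc n)
  let ?P = "\<lambda>i. walk_pos K x j i \<in> B \<and> (\<forall>l<i. walk_pos K x j l \<notin> C)"
  have "(\<exists>i\<le>Suc n. ?P i) \<longleftrightarrow> ?P 0 \<or> (\<exists>i\<le>n. ?P (Suc i))"
    using Ex_less_Suc2[of "Suc n" ?P] by (simp only: less_Suc_eq_le)
  also have "\<dots> \<longleftrightarrow> x \<in> B \<or> (\<exists>i\<le>n. walk_pos K (x + 1 - int (K j)) (Suc j) i \<in> B \<and>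
      x \<notin> C \<and> (\<forall>l<i. walk_pos K (x + 1 - int (K j)) (Suc j) l \<notin> C))"
    by (simp add: walk_pos_Suc All_less_Suc2)
  also have "\<dots> \<longleftrightarrow> reaches B C K (Suc n) x j"
    by (auto simp: Suc)
  finally show ?case by simp
qed simp

lemma reaches_cong: "(\<And>l. j \<le> l \<Longrightarrow> K l = K' l) \<Longrightarrow> reaches B C K n x j = reaches B C K' n x j"
  unfolding reaches_iff walk_pos_def by simp

lemma measurable_reaches:
  assumes "{j..} \<subseteq> I"
  shows "Measurable.pred (\<Pi>\<^sub>M l\<in>I. count_space UNIV) (\<lambda>K. reaches B C K n x j)"
proof -
  have [measurable]: "(\<lambda>K. K (j + l)) \<in> (\<Pi>\<^sub>M l\<in>I. count_space UNIV) \<rightarrow>\<^sub>M count_space UNIV" for l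
    using assms by (intro measurable_component_singleton) auto
  have pos: "(\<lambda>K. walk_pos K x j i) \<in> (\<Pi>\<^sub>M l\<in>I. count_space UNIV) \<rightarrow>\<^sub>M count_space UNIV" for i
  proof (induction i)
    case (Suc i)
    have "(\<lambda>K. walk_pos K x j i + (1 - int (K (j + i)))) \<in> (\<Pi>\<^sub>M l\<in>I. count_space UNIV) \<rightarrow>\<^sub>M count_space UNIV"
    proof (rule measurable_compose_countable[where g = "\<lambda>K. K (j + i)" and f = "\<lambda>k K. walk_pos K x j i + (1 - int k)"])
      show "(\<lambda>K. walk_pos K x j i + (1 - int k)) \<in> (\<Pi>\<^sub>M l\<in>I. count_space UNIV) \<rightarrow>\<^sub>M count_space UNIV" for k
        by (rule measurable_compose[OF Suc]) simp
    qed measurable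
    then show ?case by (simp add: walk_pos_def algebra_simps)
  qed simp
  have "Measurable.pred (\<Pi>\<^sub>M l\<in>I. count_space UNIV) (\<lambda>K. walk_pos K x j i \<in> A)" for i A
    by (rule measurable_compose[OF pos]) simp
  then show ?thesis
    unfolding reaches_iff by (intro pred_intros_countable pred_intros_logic) simp_all
qed

lemma le_return_time: "enat i \<le> return_time S \<omega> \<longleftrightarrow> (\<forall>k. 1 \<le> k \<and> k < i \<longrightarrow> S k \<omega> \<noteq> 0)"
proof -
  have "enat i \<le> return_time S \<omega> \<longleftrightarrow> (\<forall>k\<in>{k. 1 \<le> k \<and> S k \<omega> = 0}. i \<le> k)"
    unfolding return_time_def by (simp add: le_INF_iff)
  then show ?thesis by (auto simp: not_le[symmetric])
qed

lemma return_time_finite: "return_time S \<omega> < \<infinity> \<longleftrightarrow> (\<exists>k\<ge>1. S k \<omega> = 0)"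
proof
  assume lt: "return_time S \<omega> < \<infinity>"
  show "\<exists>k\<ge>1. S k \<omega> = 0"
  proof (rule ccontr)
    assume "\<not> ?thesis"
    then have "{k. 1 \<le> k \<and> S k \<omega> = 0} = {}" by auto
    then have "return_time S \<omega> = \<infinity>" unfolding return_time_def by (simp only:) (simp add: top_enat_def)
    then show False using lt by simp
  qed
next
  assume "\<exists>k\<ge>1. S k \<omega> = 0"
  then obtain k where "1 \<le> k" "S k \<omega> = 0" by auto
  then have "return_time S \<omega> \<le> enat k" unfolding return_time_def by (intro INF_lower) simp
  also have "enat k < \<infinity>" by simp
  finally show "return_time S \<omega> < \<infinity>" .
qed

lemma excursion_min_eq:
  "excursion_min S \<omega> = (INF i. if \<forall>k. 1 \<le> k \<and> k < i \<longrightarrow> S k \<omega> \<noteq> 0 then ereal (S i \<omega>) else \<infinity>)"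
proof (rule antisym)
  show "excursion_min S \<omega> \<le> (INF i. if \<forall>k. 1 \<le> k \<and> k < i \<longrightarrow> S k \<omega> \<noteq> 0 then ereal (S i \<omega>) else \<infinity>)"
    by (rule INF_greatest) (auto simp: excursion_min_def le_return_time intro!: INF_lower)
  show "(INF i. if \<forall>k. 1 \<le> k \<and> k < i \<longrightarrow> S k \<omega> \<noteq> 0 then ereal (S i \<omega>) else \<infinity>) \<le> excursion_min S \<omega>"
    (is "(INF i. ?f i) \<le> _")
    unfolding excursion_min_def
  proof (rule INF_greatest)
    fix i assume "i \<in> {i. enat i \<le> return_time S \<omega>}"
    then have "?f i = ereal (S i \<omega>)" unfolding le_return_time mem_Collect_eq by (rule if_P)
    moreover have "(INF i. ?f i) \<le> ?f i" by (rule INF_lower) simp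
    ultimately show "(INF i. ?f i) \<le> ereal (S i \<omega>)" by order
  qed
qed

locale lattice_walk = random_walk P \<nu> S + law: lattice_law \<nu> + skip_free_walk "down_pmf \<nu>"
  for P :: "'b measure" and \<nu> :: "real measure" and S :: "nat \<Rightarrow> 'b \<Rightarrow> real"
begin

definition K :: "nat \<Rightarrow> 'b \<Rightarrow> nat" where
  "K j \<omega> = nat (1 - \<lfloor>S (Suc j) \<omega> - S j \<omega>\<rfloor>)"

lemma step_measurable [measurable]: "(\<lambda>\<omega>. S (Suc j) \<omega> - S j \<omega>) \<in> borel_measurable P"
  using indep_steps by (auto simp: indep_vars_def)

lemma K_measurable [measurable]: "K j \<in> P \<rightarrow>\<^sub>M count_space UNIV"
  unfolding K_def[abs_def] by measurable

lemma S_measurable [measurable]: "S k \<in> borel_measurable P"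
proof -
  have eq: "S k \<omega> = (\<Sum>j<k. S (Suc j) \<omega> - S j \<omega>)" if "\<omega> \<in> space P" for \<omega>
    using start[OF that] sum_lessThan_telescope[of "\<lambda>k. S k \<omega>" k] by simp
  have "(\<lambda>\<omega>. \<Sum>j<k. S (Suc j) \<omega> - S j \<omega>) \<in> borel_measurable P" by measurable
  then show ?thesis using eq by (subst measurable_cong) auto
qed

lemma indep_K: "indep_vars (\<lambda>_. count_space UNIV) K UNIV"
  unfolding K_def[abs_def]
  by (rule indep_vars_compose2[OF indep_steps, where Y = "\<lambda>_ x. nat (1 - \<lfloor>x\<rfloor>)"]) measurable

lemma distr_K: "distr P (count_space UNIV) (K j) = measure_pmf (down_pmf \<nu>)"
proof -
  have "distr P (count_space UNIV) (K j) =
      distr (distr P borel (\<lambda>\<omega>. S (Suc j) \<omega> - S j \<omega>)) (count_space UNIV) (\<lambda>x. nat (1 - \<lfloor>x\<rfloor>))"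
    unfolding K_def[abs_def] by (subst distr_distr) (auto simp: comp_def)
  then show ?thesis by (simp add: step_law law.measure_D)
qed

lemma prob_K: "prob {\<omega> \<in> space P. K j \<omega> = k} = pmf (down_pmf \<nu>) k"
proof -
  have "pmf (down_pmf \<nu>) k = measure (distr P (count_space UNIV) (K j)) {k}"
    by (simp add: distr_K pmf.rep_eq)
  also have "\<dots> = prob (K j -` {k} \<inter> space P)" by (rule measure_distr) auto
  also have "K j -` {k} \<inter> space P = {\<omega> \<in> space P. K j \<omega> = k}" by auto
  finally show ?thesis by simp
qed

lemma reaches_event [measurable]: "Measurable.pred P (\<lambda>\<omega>. reaches B C (\<lambda>j. K j \<omega>) n x j)"
proof -
  have "Measurable.pred P (\<lambda>\<omega>. reaches B C (restrict (\<lambda>j. K j \<omega>) UNIV) n x j)"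
    by (rule measurable_compose[OF measurable_restrict measurable_reaches]) auto
  moreover have "reaches B C (restrict (\<lambda>j. K j \<omega>) UNIV) n x j = reaches B C (\<lambda>j. K j \<omega>) n x j" for \<omega>
    by (rule reaches_cong) simp
  ultimately show ?thesis by simp
qed

text \<open>The increment with index j is independent of the later ones; sum over its
  values.\<close>

lemma prob_first_step:
  assumes IH: "\<And>y. prob {\<omega> \<in> space P. reaches B C (\<lambda>j. K j \<omega>) n y (Suc j)} = reach B C n y"
  shows "prob {\<omega> \<in> space P. reaches B C (\<lambda>j. K j \<omega>) n (x + 1 - int (K j \<omega>)) (Suc j)} = Q (reach B C n) x"
proof -
  define E where "E k = {\<omega> \<in> space P. K j \<omega> = k \<and> reaches B C (\<lambda>j. K j \<omega>) n (x + 1 - int k) (Suc j)}" for k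
  have E [measurable]: "E k \<in> events" for k unfolding E_def by measurable
  have probE: "prob (E k) = pmf (down_pmf \<nu>) k * reach B C n (x + 1 - int k)" for k
  proof -
    let ?A = "\<lambda>\<omega>. restrict (\<lambda>l. K l \<omega>) {j}" and ?B = "\<lambda>\<omega>. restrict (\<lambda>l. K l \<omega>) {Suc j..}"
    let ?S = "\<Pi>\<^sub>M l\<in>{j}. count_space (UNIV :: nat set)" and ?T = "\<Pi>\<^sub>M l\<in>{Suc j..}. count_space (UNIV :: nat set)"
    have ind: "indep_var ?S ?A ?T ?B" by (rule indep_var_restrict[OF indep_K]) auto
    have A: "{f \<in> space ?S. f j = k} \<in> sets ?S"
    proof -
      have [measurable]: "(\<lambda>f. f j) \<in> ?S \<rightarrow>\<^sub>M count_space UNIV" by (rule measurable_component_singleton) simp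
      show ?thesis by measurable
    qed
    have B: "{f \<in> space ?T. reaches B C f n (x + 1 - int k) (Suc j)} \<in> sets ?T"
      using measurable_reaches[of "Suc j" "{Suc j..}" B C n "x + 1 - int k"] by (simp add: pred_def)
    have r: "reaches B C (?B \<omega>) n y (Suc j) = reaches B C (\<lambda>l. K l \<omega>) n y (Suc j)" for \<omega> y
      by (rule reaches_cong) simp
    have "prob ((\<lambda>\<omega>. (?A \<omega>, ?B \<omega>)) -` ({f \<in> space ?S. f j = k} \<times> {f \<in> space ?T. reaches B C f n (x + 1 - int k) (Suc j)}) \<inter> space P)
        = prob (?A -` {f \<in> space ?S. f j = k} \<inter> space P) *
          prob (?B -` {f \<in> space ?T. reaches B C f n (x + 1 - int k) (Suc j)} \<inter> space P)"
      by (rule indep_varD[OF ind A B])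
    moreover have "(\<lambda>\<omega>. (?A \<omega>, ?B \<omega>)) -` ({f \<in> space ?S. f j = k} \<times> {f \<in> space ?T. reaches B C f n (x + 1 - int k) (Suc j)}) \<inter> space P = E k"
      by (auto simp: E_def space_PiM r)
    moreover have "?A -` {f \<in> space ?S. f j = k} \<inter> space P = {\<omega> \<in> space P. K j \<omega> = k}"
      by (auto simp: space_PiM)
    moreover have "?B -` {f \<in> space ?T. reaches B C f n (x + 1 - int k) (Suc j)} \<inter> space P =
        {\<omega> \<in> space P. reaches B C (\<lambda>j. K j \<omega>) n (x + 1 - int k) (Suc j)}"
      by (auto simp: space_PiM r)
    ultimately show ?thesis by (simp only: prob_K IH)
  qed
  have un: "{\<omega> \<in> space P. reaches B C (\<lambda>j. K j \<omega>) n (x + 1 - int (K j \<omega>)) (Suc j)} = (\<Union>k. E k)"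
    by (auto simp: E_def)
  have "emeasure P (\<Union>k. E k) = (\<Sum>k. emeasure P (E k))"
    by (rule suminf_emeasure[symmetric]) (auto simp: disjoint_family_on_def E_def)
  also have "\<dots> = (\<Sum>k. ennreal (pmf (down_pmf \<nu>) k) * ennreal (reach B C n (x + 1 - int k)))"
    using reach_bounds by (simp add: emeasure_eq_measure probE ennreal_mult)
  also have "\<dots> = (\<integral>\<^sup>+k. ennreal (reach B C n (x + 1 - int k)) \<partial>measure_pmf (down_pmf \<nu>))"
    by (simp add: nn_integral_measure_pmf nn_integral_count_space_nat)
  also have "\<dots> = ennreal (Q (reach B C n) x)"
    unfolding Q_def using reach_bounds
    by (intro nn_integral_eq_integral Q_integrable left_bounded_reach) auto
  finally show ?thesis
    unfolding un using reach_bounds by (simp add: emeasure_eq_measure Q_nonneg)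
qed

lemma prob_reaches:
  "prob {\<omega> \<in> space P. reaches B C (\<lambda>j. K j \<omega>) n x j} = reach B C n x"
proof (induction n arbitrary: x j)
  case 0
  show ?case by (cases "x \<in> B") (auto simp: prob_space)
next
  case (Suc n)
  have "prob {\<omega> \<in> space P. reaches B C (\<lambda>j. K j \<omega>) n (x + 1 - int (K j \<omega>)) (Suc j)} = Q (reach B C n) x"
    by (rule prob_first_step) (rule Suc)
  then show ?case by (cases "x \<in> B"; cases "x \<in> C") (auto simp: prob_space)
qed

text \<open>The first step is split off because the starting point 0 belongs to the target or to the
  killing set, while returns count from time 1 on. Hence \<open>Q\<close> of the hitting probability
  at 0, and not the hitting probability itself.\<close>

lemma prob_eventually_reaches:
  "prob {\<omega> \<in> space P. \<exists>n. reaches B C (\<lambda>j. K j \<omega>) n (0 + 1 - int (K 0 \<omega>)) (Suc 0)} = Q (reach_lim B C) 0"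
proof -
  let ?E = "\<lambda>n. {\<omega> \<in> space P. reaches B C (\<lambda>j. K j \<omega>) n (0 + 1 - int (K 0 \<omega>)) (Suc 0)}"
  have m: "Measurable.pred P (\<lambda>\<omega>. reaches B C (\<lambda>j. K j \<omega>) n (0 + 1 - int (K 0 \<omega>)) (Suc 0))" for n
    by (rule measurable_compose_countable[where g = "\<lambda>\<omega>. K 0 \<omega>" and f = "\<lambda>k \<omega>. reaches B C (\<lambda>j. K j \<omega>) n (0 + 1 - int k) (Suc 0)"])
      measurable
  have lim: "(\<lambda>n. prob (?E n)) \<longlonglongrightarrow> prob (\<Union>n. ?E n)"
  proof (rule finite_Lim_measure_incseq)
    show "range ?E \<subseteq> events" using m by auto
    show "incseq ?E" by (rule incseq_SucI) (auto simp: reaches_iff intro: le_SucI)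
  qed
  have "(\<lambda>n. prob (?E n)) = (\<lambda>n. Q (reach B C n) 0)"
    by (rule ext) (rule prob_first_step, rule prob_reaches)
  then have "prob (\<Union>n. ?E n) = Q (reach_lim B C) 0"
    using LIMSEQ_unique[OF lim] Q_reach_tendsto[of B C 0] by (simp only:)
  moreover have "(\<Union>n. ?E n) = {\<omega> \<in> space P. \<exists>n. reaches B C (\<lambda>j. K j \<omega>) n (0 + 1 - int (K 0 \<omega>)) (Suc 0)}" by auto
  ultimately show ?thesis by simp
qed

lemma AE_walk_pos: "AE \<omega> in P. \<forall>k. S k \<omega> = of_int (walk_pos (\<lambda>j. K j \<omega>) 0 0 k)"
proof -
  have "AE \<omega> in P. \<forall>j. S (Suc j) \<omega> - S j \<omega> = 1 - real (K j \<omega>)"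
    unfolding AE_all_countable
  proof
    fix j
    have "AE x in distr P borel (\<lambda>\<omega>. S (Suc j) \<omega> - S j \<omega>). 1 - real (nat (1 - \<lfloor>x\<rfloor>)) = x"
      unfolding step_law using law.down_inverse by eventually_elim simp
    from AE_distrD[OF step_measurable this]
    show "AE \<omega> in P. S (Suc j) \<omega> - S j \<omega> = 1 - real (K j \<omega>)"
      by eventually_elim (simp only: K_def)
  qed
  moreover have "AE \<omega> in P. S 0 \<omega> = 0" using start by (intro AE_I2)
  ultimately show ?thesis
  proof eventually_elim
    case (elim \<omega>)
    have "S k \<omega> = of_int (walk_pos (\<lambda>j. K j \<omega>) 0 0 k)" for k
    proof (induction k)
      case (Suc k)
      have "S (Suc k) \<omega> = S k \<omega> + (1 - real (K k \<omega>))" using elim by (simp add: algebra_simps)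
      then show ?case using Suc by (simp add: walk_pos_def)
    qed (use elim in simp)
    then show ?case by blast
  qed
qed

lemma return_time_prob: "prob {\<omega> \<in> space P. return_time S \<omega> < \<infinity>} = Q (reach_lim {0} {}) 0"
proof -
  have "prob {\<omega> \<in> space P. return_time S \<omega> < \<infinity>} =
      prob {\<omega> \<in> space P. \<exists>n. reaches {0} {} (\<lambda>j. K j \<omega>) n (0 + 1 - int (K 0 \<omega>)) (Suc 0)}"
  proof (rule finite_measure_eq_AE)
    show "AE \<omega> in P. (\<omega> \<in> {\<omega> \<in> space P. return_time S \<omega> < \<infinity>}) =
        (\<omega> \<in> {\<omega> \<in> space P. \<exists>n. reaches {0} {} (\<lambda>j. K j \<omega>) n (0 + 1 - int (K 0 \<omega>)) (Suc 0)})"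
      using AE_walk_pos
    proof eventually_elim
      case (elim \<omega>)
      have "(\<exists>k\<ge>1. S k \<omega> = 0) \<longleftrightarrow> (\<exists>i. walk_pos (\<lambda>j. K j \<omega>) 0 0 (Suc i) = 0)"
        using elim by (metis One_nat_def Suc_le_D le_add1 of_int_eq_0_iff plus_1_eq_Suc)
      also have "\<dots> \<longleftrightarrow> (\<exists>n. reaches {0} {} (\<lambda>j. K j \<omega>) n (0 + 1 - int (K 0 \<omega>)) (Suc 0))"
        unfolding reaches_iff walk_pos_Suc by auto
      finally show ?case unfolding mem_Collect_eq return_time_finite by simp
    qed
    show "{\<omega> \<in> space P. return_time S \<omega> < \<infinity>} \<in> events" unfolding return_time_finite by measurable
    have m: "Measurable.pred P (\<lambda>\<omega>. reaches {0} {} (\<lambda>j. K j \<omega>) n (0 + 1 - int (K 0 \<omega>)) (Suc 0))" for n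
      by (rule measurable_compose_countable[where g = "\<lambda>\<omega>. K 0 \<omega>" and f = "\<lambda>k \<omega>. reaches {0} {} (\<lambda>j. K j \<omega>) n (0 + 1 - int k) (Suc 0)"])
        measurable
    then show "{\<omega> \<in> space P. \<exists>n. reaches {0} {} (\<lambda>j. K j \<omega>) n (0 + 1 - int (K 0 \<omega>)) (Suc 0)} \<in> events"
      by measurable
  qed
  then show ?thesis by (simp only: prob_eventually_reaches)
qed

lemma excursion_min_measurable [measurable]: "excursion_min S \<in> borel_measurable P"
proof -
  have "(\<lambda>\<omega>. INF i. if \<forall>k. 1 \<le> k \<and> k < i \<longrightarrow> S k \<omega> \<noteq> 0 then ereal (S i \<omega>) else \<infinity>) \<in> borel_measurable P"
    by (intro borel_measurable_INF) (simp, measurable)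
  then show ?thesis by (simp add: excursion_min_eq[abs_def])
qed

lemma excursion_min_le_iff:
  assumes n: "0 < n" and w: "\<And>k. S k \<omega> = of_int (w k)" and w0: "w 0 = 0"
  shows "excursion_min S \<omega> \<le> ereal (- real n) \<longleftrightarrow> (\<exists>i. w (Suc i) \<le> - int n \<and> (\<forall>l<i. w (Suc l) \<noteq> 0))"
proof
  assume le: "excursion_min S \<omega> \<le> ereal (- real n)"
  have "\<exists>i. enat i \<le> return_time S \<omega> \<and> w i \<le> - int n"
  proof (rule ccontr)
    assume "\<not> ?thesis"
    \<comment> \<open>By integrality, staying above - n means staying at or above 1 - n, so the
      infimum cannot equal - n without being attained.\<close>
    then have a: "- int n + 1 \<le> w i" if "enat i \<le> return_time S \<omega>" for i using that by force
    have "ereal (- real n + 1) \<le> ereal (S i \<omega>)" if "enat i \<le> return_time S \<omega>" for i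
    proof -
      have "real_of_int (- int n + 1) \<le> real_of_int (w i)" using a[OF that] by (simp only: of_int_le_iff)
      then show ?thesis by (simp add: w)
    qed
    then have "ereal (- real n + 1) \<le> excursion_min S \<omega>"
      unfolding excursion_min_def by (intro INF_greatest) auto
    then have "ereal (- real n + 1) \<le> ereal (- real n)" using le by order
    then show False by simp
  qed
  then obtain i where i: "enat i \<le> return_time S \<omega>" "w i \<le> - int n" by auto
  \<comment> \<open>Time 0 is excluded because the walk is then at 0, above - n.\<close>
  then obtain i' where i': "i = Suc i'" using w0 n by (cases i) auto
  have "\<forall>l<i'. w (Suc l) \<noteq> 0"
    using i(1) unfolding le_return_time i' by (auto simp: w)
  then show "\<exists>i. w (Suc i) \<le> - int n \<and> (\<forall>l<i. w (Suc l) \<noteq> 0)" using i(2) i' by blast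
next
  assume "\<exists>i. w (Suc i) \<le> - int n \<and> (\<forall>l<i. w (Suc l) \<noteq> 0)"
  then obtain i where i: "w (Suc i) \<le> - int n" "\<And>l. l < i \<Longrightarrow> w (Suc l) \<noteq> 0" by auto
  have "S k \<omega> \<noteq> 0" if "1 \<le> k" "k < Suc i" for k
    using i(2)[of "k - 1"] that by (cases k) (auto simp: w)
  then have "enat (Suc i) \<le> return_time S \<omega>" unfolding le_return_time by blast
  then have "excursion_min S \<omega> \<le> ereal (S (Suc i) \<omega>)"
    unfolding excursion_min_def by (intro INF_lower) simp
  also have "\<dots> \<le> ereal (- real n)"
  proof -
    have "real_of_int (w (Suc i)) \<le> real_of_int (- int n)" using i(1) by (simp only: of_int_le_iff)
    then show ?thesis by (simp add: w)
  qed
  finally show "excursion_min S \<omega> \<le> ereal (- real n)" .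
qed

lemma excursion_min_prob:
  assumes n: "0 < n"
  shows "prob {\<omega> \<in> space P. excursion_min S \<omega> \<le> ereal (- real n)} = Q (reach_lim {..- int n} {0}) 0"
proof -
  have "prob {\<omega> \<in> space P. excursion_min S \<omega> \<le> ereal (- real n)} =
      prob {\<omega> \<in> space P. \<exists>m. reaches {..- int n} {0} (\<lambda>j. K j \<omega>) m (0 + 1 - int (K 0 \<omega>)) (Suc 0)}"
  proof (rule finite_measure_eq_AE)
    show "AE \<omega> in P. (\<omega> \<in> {\<omega> \<in> space P. excursion_min S \<omega> \<le> ereal (- real n)}) =
        (\<omega> \<in> {\<omega> \<in> space P. \<exists>m. reaches {..- int n} {0} (\<lambda>j. K j \<omega>) m (0 + 1 - int (K 0 \<omega>)) (Suc 0)})"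
      using AE_walk_pos
    proof eventually_elim
      case (elim \<omega>)
      have "excursion_min S \<omega> \<le> ereal (- real n) \<longleftrightarrow>
          (\<exists>i. walk_pos (\<lambda>j. K j \<omega>) 0 0 (Suc i) \<le> - int n \<and> (\<forall>l<i. walk_pos (\<lambda>j. K j \<omega>) 0 0 (Suc l) \<noteq> 0))"
        using elim by (intro excursion_min_le_iff n) auto
      also have "\<dots> \<longleftrightarrow> (\<exists>m. reaches {..- int n} {0} (\<lambda>j. K j \<omega>) m (0 + 1 - int (K 0 \<omega>)) (Suc 0))"
        unfolding reaches_iff walk_pos_Suc by auto
      finally show ?case by simp
    qed
    show "{\<omega> \<in> space P. excursion_min S \<omega> \<le> ereal (- real n)} \<in> events" by measurable
    have m: "Measurable.pred P (\<lambda>\<omega>. reaches {..- int n} {0} (\<lambda>j. K j \<omega>) m (0 + 1 - int (K 0 \<omega>)) (Suc 0))" for m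
      by (rule measurable_compose_countable[where g = "\<lambda>\<omega>. K 0 \<omega>" and f = "\<lambda>k \<omega>. reaches {..- int n} {0} (\<lambda>j. K j \<omega>) m (0 + 1 - int k) (Suc 0)"])
        measurable
    then show "{\<omega> \<in> space P. \<exists>m. reaches {..- int n} {0} (\<lambda>j. K j \<omega>) m (0 + 1 - int (K 0 \<omega>)) (Suc 0)} \<in> events"
      by measurable
  qed
  then show ?thesis by (simp only: prob_eventually_reaches)
qed

end

section \<open>Almost sure limits\<close>

text \<open>The convention that s to the power \<infinity> is 0 agrees with the infinite product for
  s < 1; at s = 1 it keeps infinite offspring from counting as extinction.\<close>

definition gen_term :: "real \<Rightarrow> enat \<Rightarrow> real" where
  "gen_term s n = (case n of enat k \<Rightarrow> s ^ k | \<infinity> \<Rightarrow> 0)"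

lemma gen_term_bounds: "0 \<le> s \<Longrightarrow> s \<le> 1 \<Longrightarrow> 0 \<le> gen_term s n \<and> gen_term s n \<le> 1"
  by (auto simp: gen_term_def power_le_one split: enat.split)

lemma iprod_finite: "iprod (\<lambda>i. if i < c then s else 1) = s ^ c"
  if "0 \<le> s" "s \<le> 1" for s :: real
proof -
  have "(\<Prod>i<c + n. if i < c then s else 1) = s ^ c" for n
    by (induction n) (simp_all add: prod.If_cases)
  then have "(\<lambda>n. \<Prod>i<n + c. if i < c then s else 1) \<longlonglongrightarrow> s ^ c"
    by (simp add: add.commute)
  then have "(\<lambda>n. \<Prod>i<n. if i < c then s else 1) \<longlonglongrightarrow> s ^ c"
    by (rule LIMSEQ_offset)
  moreover have "(\<lambda>n. \<Prod>i<n. if i < c then s else 1) \<longlonglongrightarrow> iprod (\<lambda>i. if i < c then s else 1)"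
    by (rule iprod_tendsto) (use that in auto)
  ultimately show ?thesis by (metis LIMSEQ_unique)
qed

lemma iprod_infinite: "iprod (\<lambda>i. s) = 0" if "0 \<le> s" "s < 1" for s :: real
proof -
  have "(\<lambda>n. \<Prod>i<n. s) \<longlonglongrightarrow> iprod (\<lambda>i. s)" by (rule iprod_tendsto) (use that in auto)
  moreover have "(\<lambda>n. \<Prod>i<n. s) \<longlonglongrightarrow> 0" using LIMSEQ_power_zero[of s] that by simp
  ultimately show ?thesis by (metis LIMSEQ_unique)
qed

lemma iprod_gen_term:
  assumes "0 \<le> s" "s < 1"
  shows "iprod (\<lambda>i. if enat i < n then s else 1) = gen_term s n"
  using assms by (cases n) (auto simp: gen_term_def iprod_finite iprod_infinite)

text \<open>The point e is the convex combination l d + (1 - l). The chord inequality is strict as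
  soon as n > 1, n = \<infinity> included, which is where supercriticality will enter.\<close>

lemma gen_term_strictly_convex:
  assumes d: "0 \<le> d" "d < e" "e < 1" and l: "l = (1 - e) / (1 - d)"
  shows "gen_term e n \<le> l * gen_term d n + (1 - l)"
    and "1 < n \<Longrightarrow> gen_term e n < l * gen_term d n + (1 - l)"
proof -
  have l01: "0 < l" "l < 1" using d by (auto simp: l)
  have "l * (1 - d) = 1 - e" using d by (simp add: l)
  then have ed: "e = l * d + (1 - l)" by (simp add: algebra_simps)
  have de: "d - e = - (1 - l) * (1 - d)" "1 - e = l * (1 - d)" using ed by (auto simp: algebra_simps)
  have gap: "l * d ^ Suc c + (1 - l) - e * (l * d ^ c + (1 - l)) = l * (1 - l) * ((1 - d) * (1 - d ^ c))" for c
  proof -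
    have "l * d ^ Suc c + (1 - l) - e * (l * d ^ c + (1 - l)) = l * d ^ c * (d - e) + (1 - l) * (1 - e)"
      by (simp add: algebra_simps)
    also have "\<dots> = l * (1 - l) * ((1 - d) * (1 - d ^ c))" unfolding de by (simp add: algebra_simps)
    finally show ?thesis .
  qed
  have le: "e ^ c \<le> l * d ^ c + (1 - l)" for c
  proof (induction c)
    case (Suc c)
    have "e ^ Suc c \<le> e * (l * d ^ c + (1 - l))" using Suc d by (simp add: mult_left_mono)
    also have "\<dots> \<le> l * d ^ Suc c + (1 - l)"
    proof -
      have "0 \<le> l * (1 - l) * ((1 - d) * (1 - d ^ c))"
        using l01 d by (intro mult_nonneg_nonneg) (auto simp: power_le_one)
      then show ?thesis using gap[of c] by linarith
    qed
    finally show ?case .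
  qed simp
  have lt: "e ^ Suc c < l * d ^ Suc c + (1 - l)" if "0 < c" for c
  proof -
    have "e ^ Suc c \<le> e * (l * d ^ c + (1 - l))" using le d by (simp add: mult_left_mono)
    also have "\<dots> < l * d ^ Suc c + (1 - l)"
    proof -
      have "d ^ c < 1" using d that by (simp add: power_less_one_iff)
      then have "0 < l * (1 - l) * ((1 - d) * (1 - d ^ c))"
        using l01 d by (intro mult_pos_pos) auto
      then show ?thesis using gap[of c] by linarith
    qed
    finally show ?thesis .
  qed
  show "gen_term e n \<le> l * gen_term d n + (1 - l)"
    using le l01 by (cases n) (auto simp: gen_term_def)
  show "gen_term e n < l * gen_term d n + (1 - l)" if n1: "1 < n"
  proof (cases n)
    case (enat k)
    then obtain c where "k = Suc c" "0 < c" using n1 by (cases k) (auto simp: one_enat_def)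
    then show ?thesis using lt[of c] enat by (simp add: gen_term_def)
  next
    case infinity
    then show ?thesis using l01 by (simp add: gen_term_def)
  qed
qed

text \<open>The predicate P allows the test values c to be restricted to two sequences tending to L,
  so that countably many almost sure statements suffice.\<close>

lemma ereal_tendsto_of_bounds:
  fixes f :: "nat \<Rightarrow> ereal" and L :: real
  assumes up: "\<And>c. L < c \<Longrightarrow> P c \<Longrightarrow> \<forall>\<^sub>F n in sequentially. f n \<le> ereal c"
    and low: "\<And>c. 0 < c \<Longrightarrow> c < L \<Longrightarrow> P c \<Longrightarrow> \<forall>\<^sub>F n in sequentially. ereal c \<le> f n"
    and L: "0 < L" and P: "\<And>j::nat. P (L + 1 / real (Suc j))" "\<And>j::nat. P (L - L / real (j + 2))"
  shows "f \<longlonglongrightarrow> ereal L"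
proof (rule order_tendstoI)
  fix a assume a: "ereal L < a"
  have "(\<lambda>j. L + 1 / real (Suc j)) \<longlonglongrightarrow> L" by real_asymp
  then have "(\<lambda>j. ereal (L + 1 / real (Suc j))) \<longlonglongrightarrow> ereal L" by simp
  from order_tendstoD(2)[OF this a] obtain j where j: "ereal (L + 1 / real (Suc j)) < a"
    unfolding eventually_sequentially by blast
  have "\<forall>\<^sub>F n in sequentially. f n \<le> ereal (L + 1 / real (Suc j))" by (rule up) (simp_all add: P del: of_nat_Suc)
  then show "\<forall>\<^sub>F n in sequentially. f n < a" by eventually_elim (use j in order)
next
  fix a assume a: "a < ereal L"
  have "(\<lambda>j. L - L / real (j + 2)) \<longlonglongrightarrow> L" by real_asymp
  then have "(\<lambda>j. ereal (L - L / real (j + 2))) \<longlonglongrightarrow> ereal L" by simp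
  from order_tendstoD(1)[OF this a] obtain j where j: "a < ereal (L - L / real (j + 2))"
    unfolding eventually_sequentially by blast
  have "L / real (j + 2) < L" using L by (simp add: divide_less_eq)
  then have "\<forall>\<^sub>F n in sequentially. ereal (L - L / real (j + 2)) \<le> f n"
    using L by (intro low P) auto
  then show "\<forall>\<^sub>F n in sequentially. a < f n" by eventually_elim (use j in order)
qed

lemma zeros_simps:
  "zeros_acc (x, m) e \<longleftrightarrow> of_bool (x = 0) < m"
  "zeros_step (x, m) k = (x + k, m - of_bool (x = 0))"
  by (simp_all add: zeros_acc_def zeros_step_def)

section \<open>Visit probabilities, and unvisited levels versus extinction\<close>

context lattice_brw begin

lemma val_zeros: "val zeros_acc zeros_step zeros_base n (x, m) = cnt n m x"
proof (induction n arbitrary: x m)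
  case (Suc n)
  show ?case
    by (simp add: zeros_simps Suc T_def cong: if_cong)
qed (simp add: zeros_base_def)

text \<open>The event that no line of descent visits level \<open>n\<close> at least \<open>m\<close> times.\<close>

definition few_visits :: "nat \<Rightarrow> nat \<Rightarrow> 'a set" where
  "few_visits n m = {\<omega> \<in> space M. \<forall>k. descends zeros_acc zeros_step zeros_base (\<lambda>u. family u \<omega>) k (- int n, m) []}"

lemma few_visits_measurable [measurable]: "few_visits n m \<in> events"
  unfolding few_visits_def by measurable

lemma few_visits_iff:
  assumes "integral_steps \<omega>" "\<omega> \<in> space M"
  shows "\<omega> \<in> few_visits n m \<longleftrightarrow> (\<forall>w\<in>tree N \<omega>. level_count (position X \<omega>) n w < m)"
proof -
  have "\<omega> \<in> few_visits n m \<longleftrightarrow> (\<forall>w. w \<in> tree N \<omega> \<longrightarrow> zeros (\<lambda>u. family u \<omega>) (- int n) [] w < m)"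
    using assms(2) by (auto simp: few_visits_def descends_zeros in_subtree_family)
  then show ?thesis using zeros_family[OF assms(1)] by auto
qed

text \<open>Making m + 1 visits means m returns after the first one. A first visitor of level n
  starts such a line with probability ret m, and the first visitors form generation n of the level
  process.\<close>

lemma prob_few_visits: "prob (few_visits n (Suc m)) = 1 - (phi ^^ n) (ret m)"
proof -
  let ?E = "\<lambda>k. {\<omega> \<in> space M. descends zeros_acc zeros_step zeros_base (\<lambda>u. family u \<omega>) k (- int n, Suc m) []}"
  have lim: "(\<lambda>k. prob (?E k)) \<longlonglongrightarrow> prob (\<Inter>k. ?E k)"
  proof (rule finite_Lim_measure_decseq)
    show "range ?E \<subseteq> events" by auto
    show "decseq ?E" by (rule decseq_SucI) (auto simp: descends_zeros simp del: descends.simps)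
  qed
  have lim': "(\<lambda>k. prob (?E k)) \<longlonglongrightarrow> Psi (1 - ret m) (- int n)"
    unfolding prob_descends val_zeros by (rule cnt_tendsto)
  have "(\<Inter>k. ?E k) = few_visits n (Suc m)" by (auto simp: few_visits_def)
  with LIMSEQ_unique[OF lim lim'] have "prob (few_visits n (Suc m)) = Psi (1 - ret m) (- int n)"
    by (simp only:)
  then show ?thesis
    using ret_bounds[of m] by (simp add: Psi_neg phi_pow)
qed

lemma few_visits_mono: "m \<le> m' \<Longrightarrow> few_visits n m \<subseteq> few_visits n m'"
  by (auto simp: few_visits_def descends_zeros intro: less_le_trans)

abbreviation "\<eta> n \<equiv> (phi ^^ n) 1"

text \<open>The limit e will be the probability that some level is never visited. It is below 1
  because phi p \<ge> p near 0 keeps the iterates away from 0.\<close>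

lemma unvisited_lim:
  obtains e where "(\<lambda>n. 1 - \<eta> n) \<longlonglongrightarrow> e" "0 \<le> e" "e < 1" "\<And>n. 1 - \<eta> n \<le> e"
proof -
  obtain \<delta> where \<delta>: "0 < \<delta>" "\<delta> \<le> 1" "\<And>p. 0 \<le> p \<Longrightarrow> p \<le> \<delta> \<Longrightarrow> 1 * p \<le> phi p"
    using phi_growth[of 1] tpos by auto
  have ge: "\<delta> \<le> \<eta> n" for n
  proof (induction n)
    case (Suc n)
    have "\<delta> \<le> phi \<delta>" using \<delta> by fastforce
    also have "\<dots> \<le> phi (\<eta> n)" using Suc \<delta> phi.pow_range[of 1 n] by (intro phi_mono) auto
    finally show ?case by simp
  qed (use \<delta> in simp)
  have "\<eta> (Suc n) \<le> \<eta> n" for n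
    using phi.pow_mono[of "phi 1" 1 n] phi_bounds[of 1] by (simp add: funpow_swap1)
  then have inc: "incseq (\<lambda>n. 1 - \<eta> n)" by (intro incseq_SucI) simp
  have "1 - \<eta> n \<le> 1 - \<delta>" for n using ge[of n] by simp
  then obtain e where e: "(\<lambda>n. 1 - \<eta> n) \<longlonglongrightarrow> e" "\<And>n. 1 - \<eta> n \<le> e"
    using incseq_convergent[OF inc, of "1 - \<delta>"] by metis
  have "e \<le> 1 - \<delta>" using ge by (intro LIMSEQ_le_const2[OF e(1)]) (auto simp: algebra_simps)
  moreover have "0 \<le> e" using e(2)[of 0] by simp
  ultimately show ?thesis using that e \<delta> by auto
qed

text \<open>From a start below 0 every child is still at or below 0 and misses level 0 with
  probability at most e. Thus e is a subsolution of the offspring equation.\<close>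

lemma unvisited_le:
  assumes e: "0 \<le> e" "e < 1" "(\<lambda>n. 1 - \<eta> n) \<longlonglongrightarrow> e" "\<And>n. 1 - \<eta> n \<le> e"
  shows "e \<le> expectation (\<lambda>\<omega>. gen_term e (N [] \<omega>))"
proof (rule LIMSEQ_le_const2[OF LIMSEQ_Suc[OF e(3)]])
  have "1 - \<eta> (Suc n) \<le> expectation (\<lambda>\<omega>. gen_term e (N [] \<omega>))" for n
  proof -
    have psi: "Psi 0 (- int k) = 1 - \<eta> k" for k by (simp add: Psi_neg phi_pow)
    have uP: "unit_valued (Psi 0)" by (intro Psi_unit_valued) auto
    define g where "g y = (if y \<le> 0 then e else 1)" for y :: int
    have ug: "unit_valued g" using e by (auto simp: unit_valued_def g_def)
    have "Psi 0 y \<le> g y" for y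
    proof (cases "y \<le> 0")
      case True
      then show ?thesis using psi[of "nat (- y)"] e(4)[of "nat (- y)"] by (simp add: g_def)
    qed (use uP in \<open>simp add: g_def unit_valuedD\<close>)
    then have "T (Psi 0) (- int (Suc n)) \<le> T g (- int (Suc n))" by (intro T_mono uP ug)
    also have "\<dots> = T (\<lambda>_. e) (- int (Suc n))"
      using e by (intro T_cong ug) (auto simp: g_def unit_valued_def)
    also have "\<dots> = expectation (\<lambda>\<omega>. gen_term e (N [] \<omega>))"
      unfolding T_def using e by (simp add: iprod_gen_term)
    finally show ?thesis
      using psi[of "Suc n"] by (simp add: Psi_fixed_point)
  qed
  then show "\<exists>n0. \<forall>n\<ge>n0. 1 - \<eta> (Suc n) \<le> expectation (\<lambda>\<omega>. gen_term e (N [] \<omega>))" by blast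
qed

definition dies :: "nat \<Rightarrow> 'a set" where
  "dies k = {\<omega> \<in> space M. descends (\<lambda>_ e. e < \<infinity>) (\<lambda>y _. y) (\<lambda>_. False) (\<lambda>u. family u \<omega>) k () []}"

lemma dies_finite: "\<omega> \<in> dies k \<Longrightarrow> finite (tree N \<omega>)"
  using finite_of_descends[of "\<lambda>u. family u \<omega>" k "()" "[]"]
  by (simp add: dies_def in_subtree_family)

lemma dies_measurable [measurable]: "dies k \<in> events"
  unfolding dies_def by measurable

lemma gen_term_measurable [measurable]: "(\<lambda>\<omega>. gen_term s (N [] \<omega>)) \<in> borel_measurable M"
  by (rule measurable_compose[OF N_measurable]) simp

lemma prob_dies_Suc:
  "prob (dies (Suc k)) = expectation (\<lambda>\<omega>. gen_term (prob (dies k)) (N [] \<omega>))"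
proof -
  have v: "prob (dies k) = val (\<lambda>_ e. e < \<infinity>) (\<lambda>y _. y) (\<lambda>_. False) k ()" for k
    unfolding dies_def by (rule prob_descends)
  have "of_bool (n < \<infinity>) * iprod (\<lambda>i. if enat i < n then s else 1) = gen_term s n" if "0 \<le> s" "s \<le> 1" for s n
    using that by (cases n) (auto simp: gen_term_def iprod_finite)
  then show ?thesis by (simp add: v val_bounds)
qed

lemma dies_incseq: "incseq dies"
proof -
  have "descends (\<lambda>_ e. e < \<infinity>) (\<lambda>y _. y) (\<lambda>_. False) fam k y v \<Longrightarrow>
      descends (\<lambda>_ e. e < \<infinity>) (\<lambda>y _. y) (\<lambda>_. False) fam (Suc k) y v" for fam k and y :: unit and v
  proof (induction k arbitrary: y v)
    case (Suc k)
    have "fst (fam v) < \<infinity>" "\<forall>i. enat i < fst (fam v) \<longrightarrow>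
        descends (\<lambda>_ e. e < \<infinity>) (\<lambda>y _. y) (\<lambda>_. False) fam k y (v @ [i])"
      using Suc.prems unfolding descends.simps(2)[of _ _ _ _ k] by blast+
    then show ?case by (subst descends.simps(2)) (use Suc.IH in blast)
  qed simp
  then show ?thesis unfolding dies_def by (intro incseq_SucI) blast
qed

lemma prob_dies_lim:
  defines "d \<equiv> prob (\<Union>k. dies k)"
  shows "d = expectation (\<lambda>\<omega>. gen_term d (N [] \<omega>))"
proof -
  have lim: "(\<lambda>k. prob (dies k)) \<longlonglongrightarrow> d"
    unfolding d_def by (rule finite_Lim_measure_incseq) (auto simp: dies_incseq)
  have "(\<lambda>k. expectation (\<lambda>\<omega>. gen_term (prob (dies k)) (N [] \<omega>))) \<longlonglongrightarrow> expectation (\<lambda>\<omega>. gen_term d (N [] \<omega>))"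
  proof (rule integral_dominated_convergence[where w = "\<lambda>_. 1"])
    show "AE \<omega> in M. (\<lambda>k. gen_term (prob (dies k)) (N [] \<omega>)) \<longlonglongrightarrow> gen_term d (N [] \<omega>)"
    proof (rule AE_I2)
      fix \<omega>
      show "(\<lambda>k. gen_term (prob (dies k)) (N [] \<omega>)) \<longlonglongrightarrow> gen_term d (N [] \<omega>)"
        by (cases "N [] \<omega>") (auto simp: gen_term_def intro!: tendsto_power lim)
    qed
    show "AE \<omega> in M. norm (gen_term (prob (dies k)) (N [] \<omega>)) \<le> 1" for k
      using gen_term_bounds[of "prob (dies k)"] by (intro AE_I2) (simp add: abs_of_nonneg)
  qed auto
  moreover have "(\<lambda>k. expectation (\<lambda>\<omega>. gen_term (prob (dies k)) (N [] \<omega>))) \<longlonglongrightarrow> d"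
    using LIMSEQ_Suc[OF lim] by (simp add: prob_dies_Suc)
  ultimately show ?thesis by (rule LIMSEQ_unique[rotated])
qed

text \<open>Let f be the offspring generating function, d the probability of the union of
  \<open>dies\<close>, and e that of an unvisited level. Then d \<le> e < 1, d = f d and e \<le> f
  e. If d < e, the chord from d to 1 gives f e \<le> e, so equality holds and strict convexity
  forces at most one child, against supercriticality. Hence d = e and the two events agree almost
  surely.\<close>

lemma AE_unvisited_dies:
  assumes super: "1 < emeasure (intensity M N X) UNIV"
  shows "AE \<omega> in M. infinite (tree N \<omega>) \<longrightarrow> (\<forall>n. \<omega> \<notin> few_visits n 1)"
proof -
  define d where "d = prob (\<Union>k. dies k)"
  obtain e where e: "(\<lambda>n. 1 - \<eta> n) \<longlonglongrightarrow> e" "0 \<le> e" "e < 1" "\<And>n. 1 - \<eta> n \<le> e"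
    by (rule unvisited_lim) auto
  have pU: "prob (few_visits n 1) = 1 - \<eta> n" for n
    using prob_few_visits[of n 0] by simp
  \<comment> \<open>The union makes the events increase surely; almost surely it equals its last
    member because levels are not skipped.\<close>
  define W where "W n = (\<Union>k\<le>n. few_visits k 1)" for n
  have W [measurable]: "W n \<in> events" for n unfolding W_def by auto
  have W_eq: "AE \<omega> in M. \<omega> \<in> W n \<longleftrightarrow> \<omega> \<in> few_visits n 1" for n
    using AE_integral_steps AE_space
  proof eventually_elim
    case (elim \<omega>)
    have step: "\<omega> \<in> few_visits (Suc k) 1" if "\<omega> \<in> few_visits k 1" for k
      using that no_level_skipped[OF elim(1), of k] by (simp add: few_visits_iff elim)
    have up: "\<omega> \<in> few_visits (k + j) 1" if "\<omega> \<in> few_visits k 1" for k j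
      by (induction j) (use that step in auto)
    show ?case
    proof
      assume "\<omega> \<in> W n"
      then obtain k where "k \<le> n" "\<omega> \<in> few_visits k 1" by (auto simp: W_def)
      then show "\<omega> \<in> few_visits n 1" using up[of k "n - k"] by simp
    qed (auto simp: W_def)
  qed
  have "(\<lambda>n. prob (W n)) \<longlonglongrightarrow> prob (\<Union>n. W n)"
    by (rule finite_Lim_measure_incseq) (auto simp: W_def incseq_def intro: order_trans)
  moreover have "prob (W n) = 1 - \<eta> n" for n
    using finite_measure_eq_AE[OF W_eq[of n]] by (simp add: pU[unfolded One_nat_def])
  ultimately have pW: "prob (\<Union>n. W n) = e" using e(1) LIMSEQ_unique by simp
  have fin_sub: "AE \<omega> in M. \<omega> \<in> (\<Union>k. dies k) \<longrightarrow> \<omega> \<in> (\<Union>n. W n)"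
    using AE_integral_steps AE_space
  proof eventually_elim
    case (elim \<omega>)
    show ?case
    proof
      assume "\<omega> \<in> (\<Union>k. dies k)"
      then have "finite (tree N \<omega>)" using dies_finite by auto
      then obtain n where "\<forall>u\<in>tree N \<omega>. level_count (position X \<omega>) n u = 0"
        using finite_tree_bounded by blast
      then have "\<omega> \<in> few_visits n 1" by (simp add: few_visits_iff elim)
      then show "\<omega> \<in> (\<Union>n. W n)" by (auto simp: W_def)
    qed
  qed
  have de: "d \<le> e"
    unfolding d_def pW[symmetric] using fin_sub by (intro finite_measure_mono_AE) auto
  have d0: "0 \<le> d" by (simp add: d_def)
  have "d = e"
  proof (rule ccontr)
    assume "d \<noteq> e"
    then have lt: "d < e" using de by simp
    define l where "l = (1 - e) / (1 - d)"
    note conv = gen_term_strictly_convex[OF d0 lt e(3) l_def]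
    have int: "integrable M (\<lambda>\<omega>. gen_term s (N [] \<omega>))" if "0 \<le> s" "s \<le> 1" for s
      using gen_term_bounds[OF that] by (intro integrable_const_bound[where B = 1]) (auto simp: abs_of_nonneg)
    let ?f = "\<lambda>\<omega>. l * gen_term d (N [] \<omega>) + (1 - l) - gen_term e (N [] \<omega>)"
    have fint: "integrable M ?f"
      using int[of d] int[of e] d0 lt e by (intro Bochner_Integration.integrable_diff Bochner_Integration.integrable_add integrable_mult_right) auto
    have "expectation ?f = l * expectation (\<lambda>\<omega>. gen_term d (N [] \<omega>)) + (1 - l) - expectation (\<lambda>\<omega>. gen_term e (N [] \<omega>))"
      using int[of d] int[of e] d0 lt e by (simp add: prob_space)
    also have "\<dots> \<le> l * d + (1 - l) - e"
      using prob_dies_lim unvisited_le[OF e(2,3,1,4)] by (simp add: d_def)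
    also have "l * d + (1 - l) - e = 0"
    proof -
      have "l * (1 - d) = 1 - e" using lt e by (simp add: l_def)
      then show ?thesis by (simp add: algebra_simps)
    qed
    finally have "expectation ?f \<le> 0" .
    then have "expectation ?f = 0" using conv(1) by (intro antisym integral_nonneg_AE) auto
    then have "AE \<omega> in M. ?f \<omega> = 0"
      using integral_nonneg_eq_0_iff_AE[OF fint] conv(1) by auto
    then have N1: "AE \<omega> in M. N [] \<omega> \<le> 1"
    proof eventually_elim
      case (elim \<omega>)
      then show ?case using conv(2)[of "N [] \<omega>"] by force
    qed
    have "emeasure (intensity M N X) UNIV = (\<integral>\<^sup>+x. 1 \<partial>intensity M N X)"
      using sets_eq_imp_space_eq[OF sets_intensity] by simp
    also have "\<dots> = (\<integral>\<^sup>+\<omega>. (\<Sum>i. if enat i < N [] \<omega> then 1 else 0) \<partial>M)"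
      by (rule nn_integral_intensity) simp
    also have "\<dots> \<le> (\<integral>\<^sup>+\<omega>. 1 \<partial>M)"
    proof (rule nn_integral_mono_AE)
      show "AE \<omega> in M. (\<Sum>i. if enat i < N [] \<omega> then 1 else 0) \<le> (1 :: ennreal)"
        using N1
      proof eventually_elim
        case (elim \<omega>)
        have "\<not> enat i < N [] \<omega>" if "i \<noteq> 0" for i
        proof
          assume "enat i < N [] \<omega>"
          from this elim have "enat i < enat 1" unfolding one_enat_def by (rule order.strict_trans2)
          then show False using that by simp
        qed
        then have "(\<Sum>i. if enat i < N [] \<omega> then 1 else 0 :: ennreal) = (\<Sum>i\<in>{0}. if enat i < N [] \<omega> then 1 else 0)"
          by (intro suminf_finite) auto
        then show ?case by simp
      qed
    qed
    also have "\<dots> = 1" by (simp add: emeasure_space_1)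
    finally show False using super by simp
  qed
  have "AE \<omega> in M. \<omega> \<in> (\<Union>n. W n) \<longrightarrow> \<omega> \<in> (\<Union>k. dies k)"
  proof -
    have "prob ((\<Union>n. W n) - (\<Union>k. dies k)) = prob ((\<Union>n. W n) \<union> (\<Union>k. dies k)) - prob (\<Union>k. dies k)"
      using finite_measure_Diff[of "(\<Union>n. W n) \<union> (\<Union>k. dies k)" "\<Union>k. dies k"] by (simp add: Un_Diff)
    also have "prob ((\<Union>n. W n) \<union> (\<Union>k. dies k)) = prob (\<Union>n. W n)"
      using fin_sub by (intro finite_measure_eq_AE) auto
    finally have "prob ((\<Union>n. W n) - (\<Union>k. dies k)) = 0" using pW \<open>d = e\<close> by (simp add: d_def)
    then have "(\<Union>n. W n) - (\<Union>k. dies k) \<in> null_sets M"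
      by (simp add: null_sets_def emeasure_eq_measure)
    from AE_not_in[OF this] show ?thesis by eventually_elim auto
  qed
  then show ?thesis
  proof eventually_elim
    case (elim \<omega>)
    show ?case
    proof (intro impI allI notI)
      fix n assume "infinite (tree N \<omega>)" "\<omega> \<in> few_visits n 1"
      then have "\<omega> \<in> (\<Union>n. W n)" by (auto simp: W_def)
      then have "\<omega> \<in> (\<Union>k. dies k)" using elim by blast
      then show False using dies_finite \<open>infinite (tree N \<omega>)\<close> by auto
    qed
  qed
qed

section \<open>Borel-Cantelli and the limit on survival\<close>

abbreviation "sup_visits \<omega> n \<equiv> (SUP \<xi>\<in>rays (tree N \<omega>). visits (position X \<omega>) \<xi> n)"

text \<open>Borel-Cantelli with the first-moment bound \<open>hit_prob_le\<close>.\<close>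

lemma AE_sup_visits_le:
  assumes s: "summable (\<lambda>n. exp (t * real n) * ret (k n))"
  shows "AE \<omega> in M. \<forall>\<^sub>F n in sequentially. sup_visits \<omega> n \<le> ereal (real (k n))"
proof -
  have "AE \<omega> in M. \<forall>\<^sub>F n in sequentially. \<omega> \<in> space M - (space M - few_visits n (Suc (k n)))"
  proof (rule borel_cantelli_AE1)
    have "prob (space M - few_visits n (Suc (k n))) \<le> exp (t * real n) * ret (k n)" for n
    proof -
      have "prob (space M - few_visits n (Suc (k n))) = (phi ^^ n) (ret (k n))"
        by (subst prob_compl) (auto simp: prob_few_visits)
      then show ?thesis
        using hit_prob_le[of "ret (k n)" n] ret_bounds[of "k n"] by (simp add: phi_pow)
    qed
    then show "summable (\<lambda>n. prob (space M - few_visits n (Suc (k n))))"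
      by (intro summable_comparison_test'[OF s]) auto
  qed (auto simp: emeasure_eq_measure)
  with AE_integral_steps AE_space show ?thesis
  proof eventually_elim
    case (elim \<omega>)
    show ?case using elim(3)
    proof eventually_elim
      case (elim n)
      then show ?case
        using few_visits_iff[of \<omega> n "Suc (k n)"] \<open>integral_steps \<omega>\<close> by (intro SUP_visits_le) auto
    qed
  qed
qed

text \<open>The event excluded by Borel-Cantelli and \<open>summable_gap\<close> is that level n is
  visited although no line visits it more than k n times. On survival every level is
  visited.\<close>

lemma AE_sup_visits_ge:
  assumes super: "1 < emeasure (intensity M N X) UNIV"
    and \<epsilon>: "0 < \<epsilon>" "\<epsilon> < t" and low: "\<forall>\<^sub>F n in sequentially. exp (- (t - \<epsilon>) * real n) \<le> ret (k n)"
  shows "AE \<omega> in M. infinite (tree N \<omega>) \<longrightarrow> (\<forall>\<^sub>F n in sequentially. ereal (real (Suc (k n))) \<le> sup_visits \<omega> n)"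
proof -
  have "AE \<omega> in M. \<forall>\<^sub>F n in sequentially. \<omega> \<in> space M - (few_visits n (Suc (k n)) - few_visits n 1)"
  proof (rule borel_cantelli_AE1)
    have "prob (few_visits n (Suc (k n)) - few_visits n 1) = (phi ^^ n) 1 - (phi ^^ n) (ret (k n))" for n
      using finite_measure_Diff[of "few_visits n (Suc (k n))" "few_visits n 1"] few_visits_mono[of 1 "Suc (k n)" n]
        prob_few_visits[of n 0] by (simp add: prob_few_visits)
    then show "summable (\<lambda>n. prob (few_visits n (Suc (k n)) - few_visits n 1))"
      using phi.summable_gap[OF \<epsilon> _ _ low] ret_bounds by simp
  qed (auto simp: emeasure_eq_measure)
  with AE_integral_steps AE_space AE_unvisited_dies[OF super] show ?thesis
  proof eventually_elim
    case (elim \<omega>)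
    show ?case
    proof
      assume inf: "infinite (tree N \<omega>)"
      show "\<forall>\<^sub>F n in sequentially. ereal (real (Suc (k n))) \<le> sup_visits \<omega> n"
        using elim(4)
      proof eventually_elim
        case (elim n)
        then have "\<omega> \<notin> few_visits n (Suc (k n))"
          using \<open>infinite (tree N \<omega>) \<longrightarrow> (\<forall>n. \<omega> \<notin> few_visits n 1)\<close> inf by auto
        then obtain w where w: "w \<in> tree N \<omega>" "Suc (k n) \<le> level_count (position X \<omega>) n w"
          using few_visits_iff[of \<omega> n "Suc (k n)"] \<open>integral_steps \<omega>\<close> \<open>\<omega> \<in> space M\<close> by (auto simp: not_less)
        then have "ereal (real (Suc (k n))) \<le> ereal (real (level_count (position X \<omega>) n w))"
          by (simp only: ereal_less_eq of_nat_le_iff)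
        also have "\<dots> \<le> sup_visits \<omega> n" by (rule level_count_le_SUP_visits[OF w(1)])
        finally show ?case .
      qed
    qed
  qed
qed

text \<open>For k of size c n^a the exponent -ln (ret k) is about (\<kappa> c)^(1/a) n, to be
  compared with t n; the threshold is c = t^a / \<kappa>. The power a is 1 with drift and 2
  without.\<close>

lemma sup_visits_limit:
  assumes super: "1 < emeasure (intensity M N X) UNIV"
    and a: "0 < a" and \<kappa>: "0 < \<kappa>"
    and lim: "(\<lambda>m. (- ln (ret m)) ^ a / real m) \<longlonglongrightarrow> \<kappa>"
  shows "AE \<omega> in M. infinite (tree N \<omega>) \<longrightarrow>
    (\<lambda>n. sup_visits \<omega> n / ereal (real n ^ a)) \<longlonglongrightarrow> ereal (t ^ a / \<kappa>)"
proof -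
  define L where "L = t ^ a / \<kappa>"
  have L: "0 < L" using tpos \<kappa> by (simp add: L_def)
  define y where "y m = - ln (ret m)" for m
  have ret_pos: "0 < ret m" for m by (rule ret_pos[OF up_lt_1])
  have y0: "0 \<le> y m" for m using ret_bounds[of m] ret_pos[of m] by (simp add: y_def)
  have ret_y: "ret m = exp (- y m)" for m using ret_pos by (simp add: y_def)
  define k where "k c n = nat \<lfloor>c * real n ^ a\<rfloor>" for c n
  have k_bounds: "real (k c n) \<le> c * real n ^ a" "c * real n ^ a \<le> real (Suc (k c n))" if "0 < c" for c n
  proof -
    have "0 \<le> c * real n ^ a" using that by simp
    then have "real (k c n) = of_int \<lfloor>c * real n ^ a\<rfloor>" by (simp add: k_def)
    then show "real (k c n) \<le> c * real n ^ a" "c * real n ^ a \<le> real (Suc (k c n))"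
      unfolding of_nat_Suc by linarith+
  qed
  have na_inf: "filterlim (\<lambda>n. real n ^ a) at_top sequentially"
    using a by (intro filterlim_pow_at_top filterlim_real_sequentially)
  have y_lim: "(\<lambda>n. (y (k c n) / real n) ^ a) \<longlonglongrightarrow> \<kappa> * c" if c: "0 < c" for c
  proof -
    have kn: "(\<lambda>n. real (k c n) / real n ^ a) \<longlonglongrightarrow> c"
    proof (rule tendsto_sandwich[OF _ _ _ tendsto_const])
      have "(\<lambda>n. c - 1 / real n ^ a) \<longlonglongrightarrow> c - 0"
        by (intro tendsto_intros tendsto_divide_0[OF tendsto_const] filterlim_at_top_imp_at_infinity na_inf)
      then show "(\<lambda>n. c - 1 / real n ^ a) \<longlonglongrightarrow> c" by simp
      show "\<forall>\<^sub>F n in sequentially. c - 1 / real n ^ a \<le> real (k c n) / real n ^ a"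
        using eventually_gt_at_top[of 0]
      proof eventually_elim
        case (elim n)
        have "(c * real n ^ a - 1) / real n ^ a \<le> real (k c n) / real n ^ a"
          using k_bounds(2)[OF c, of n] by (intro divide_right_mono) auto
        then show ?case using elim by (simp add: diff_divide_distrib)
      qed
      show "\<forall>\<^sub>F n in sequentially. real (k c n) / real n ^ a \<le> c"
        using eventually_gt_at_top[of 0]
      proof eventually_elim
        case (elim n)
        then show ?case using k_bounds(1)[OF c, of n] by (simp add: divide_le_eq)
      qed
    qed
    have "filterlim (\<lambda>n. real (k c n)) at_top sequentially"
    proof (rule filterlim_at_top_mono)
      show "filterlim (\<lambda>n. c * real n ^ a + (- 1)) at_top sequentially"
        by (intro filterlim_tendsto_add_at_top[OF tendsto_const, of _ _ "-1", simplified add.commute[of "-1"]]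
            filterlim_tendsto_pos_mult_at_top[OF tendsto_const c na_inf])
      show "\<forall>\<^sub>F n in sequentially. c * real n ^ a + (- 1) \<le> real (k c n)"
        using k_bounds(2)[OF c] by (intro always_eventually) (simp add: algebra_simps)
    qed
    then have k_inf: "filterlim (k c) sequentially sequentially"
      by (simp add: filterlim_sequentially_iff_filterlim_real)
    have "(\<lambda>n. (y (k c n) ^ a / real (k c n)) * (real (k c n) / real n ^ a)) \<longlonglongrightarrow> \<kappa> * c"
      by (intro tendsto_mult kn filterlim_compose[OF lim[folded y_def] k_inf])
    moreover have "\<forall>\<^sub>F n in sequentially. (y (k c n) ^ a / real (k c n)) * (real (k c n) / real n ^ a) = (y (k c n) / real n) ^ a"
    proof -
      have "\<forall>\<^sub>F n in sequentially. 0 < k c n"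
        using k_inf by (metis eventually_gt_at_top filterlim_iff)
      then show ?thesis by eventually_elim (simp add: power_divide)
    qed
    ultimately show ?thesis by (simp add: tendsto_cong)
  qed
  have upper: "AE \<omega> in M. \<forall>\<^sub>F n in sequentially. sup_visits \<omega> n / ereal (real n ^ a) \<le> ereal c" if c: "L < c" for c
  proof -
    have c0: "0 < c" using c L by linarith
    have tc: "t ^ a < \<kappa> * c" using c \<kappa> by (simp add: L_def field_simps)
    have "((\<lambda>e. (t + e) ^ a) \<longlongrightarrow> (t + 0) ^ a) (at_right 0)" by (intro tendsto_intros)
    then have "\<forall>\<^sub>F e in at_right 0. (t + e) ^ a < \<kappa> * c" using tc order_tendstoD(2) by fastforce
    moreover have "\<forall>\<^sub>F e in at_right (0::real). 0 < e" by (simp add: eventually_at_right_less)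
    ultimately have "\<forall>\<^sub>F e in at_right (0::real). 0 < e \<and> (t + e) ^ a < \<kappa> * c" by eventually_elim auto
    then obtain e where e: "0 < e" "(t + e) ^ a < \<kappa> * c" by (auto dest: eventually_happens)
    have "\<forall>\<^sub>F n in sequentially. (t + e) ^ a < (y (k c n) / real n) ^ a"
      using order_tendstoD(1)[OF y_lim[OF c0] e(2)] .
    then have ev: "\<forall>\<^sub>F n in sequentially. exp (t * real n) * ret (k c n) \<le> exp (- e) ^ n"
      using eventually_gt_at_top[of 0]
    proof eventually_elim
      case (elim n)
      have "t + e < y (k c n) / real n"
        by (rule power_less_imp_less_base[OF elim(1)]) (use y0 in simp)
      then have "(t + e) * real n \<le> y (k c n)" using elim(2) by (simp add: less_divide_eq)
      then have "t * real n - y (k c n) \<le> - e * real n" by (simp add: algebra_simps)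
      then have "exp (t * real n - y (k c n)) \<le> exp (- e * real n)" by simp
      then show ?case by (simp add: ret_y exp_diff exp_minus divide_inverse exp_of_nat_mult[symmetric] mult.commute)
        (simp add: exp_of_nat2_mult power_inverse mult.commute)
    qed
    have "summable (\<lambda>n. exp (t * real n) * ret (k c n))"
    proof (rule summable_comparison_test_ev)
      show "summable (\<lambda>n. exp (- e) ^ n)" using e by (intro summable_geometric) simp
      show "\<forall>\<^sub>F n in sequentially. norm (exp (t * real n) * ret (k c n)) \<le> exp (- e) ^ n"
        using ev by eventually_elim (use ret_bounds in simp)
    qed
    from AE_sup_visits_le[OF this] show ?thesis
    proof eventually_elim
      case (elim \<omega>)
      then show ?case using eventually_gt_at_top[of 0]
      proof eventually_elim
        case (elim n)
        have "sup_visits \<omega> n / ereal (real n ^ a) \<le> ereal (real (k c n)) / ereal (real n ^ a)"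
          using elim by (intro ereal_divide_right_mono) auto
        also have "\<dots> = ereal (real (k c n) / real n ^ a)" using elim by simp
        also have "\<dots> \<le> ereal c" using k_bounds(1)[OF c0, of n] elim by (simp add: divide_le_eq)
        finally show ?case .
      qed
    qed
  qed
  have lower: "AE \<omega> in M. infinite (tree N \<omega>) \<longrightarrow>
      (\<forall>\<^sub>F n in sequentially. ereal c \<le> sup_visits \<omega> n / ereal (real n ^ a))" if c: "0 < c" "c < L" for c
  proof -
    have tc: "\<kappa> * c < t ^ a" using c \<kappa> by (simp add: L_def field_simps)
    have "((\<lambda>e. (t - e) ^ a) \<longlongrightarrow> (t - 0) ^ a) (at_right 0)" by (intro tendsto_intros)
    then have "\<forall>\<^sub>F e in at_right 0. \<kappa> * c < (t - e) ^ a" using tc order_tendstoD(1) by fastforce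
    moreover have "\<forall>\<^sub>F e in at_right (0::real). 0 < e" by (simp add: eventually_at_right_less)
    moreover have "\<forall>\<^sub>F e in at_right (0::real). e < t"
      using eventually_at_right[of 0 t] tpos by blast
    ultimately have "\<forall>\<^sub>F e in at_right (0::real). 0 < e \<and> e < t \<and> \<kappa> * c < (t - e) ^ a" by eventually_elim auto
    then obtain e where e: "0 < e" "e < t" "\<kappa> * c < (t - e) ^ a" by (auto dest: eventually_happens)
    have "\<forall>\<^sub>F n in sequentially. (y (k c n) / real n) ^ a < (t - e) ^ a"
      using order_tendstoD(2)[OF y_lim[OF c(1)] e(3)] .
    then have "\<forall>\<^sub>F n in sequentially. exp (- (t - e) * real n) \<le> ret (k c n)"
      using eventually_gt_at_top[of 0]
    proof eventually_elim
      case (elim n)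
      have "y (k c n) / real n < t - e"
        by (rule power_less_imp_less_base[OF elim(1)]) (use e in simp)
      then have "y (k c n) \<le> (t - e) * real n" using elim(2) by (simp add: divide_less_eq)
      then show ?case by (simp add: ret_y algebra_simps)
    qed
    from AE_sup_visits_ge[OF super e(1,2) this] show ?thesis
    proof eventually_elim
      case (elim \<omega>)
      show ?case
      proof
        assume "infinite (tree N \<omega>)"
        then have "\<forall>\<^sub>F n in sequentially. ereal (real (Suc (k c n))) \<le> sup_visits \<omega> n" using elim by blast
        then show "\<forall>\<^sub>F n in sequentially. ereal c \<le> sup_visits \<omega> n / ereal (real n ^ a)"
          using eventually_gt_at_top[of 0]
        proof eventually_elim
          case (elim n)
          have "ereal c \<le> ereal (real (Suc (k c n)) / real n ^ a)"
            using k_bounds(2)[OF c(1), of n] elim by (simp add: le_divide_eq)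
          also have "\<dots> = ereal (real (Suc (k c n))) / ereal (real n ^ a)" using elim by simp
          also have "\<dots> \<le> sup_visits \<omega> n / ereal (real n ^ a)"
            using elim by (intro ereal_divide_right_mono) auto
          finally show ?case .
        qed
      qed
    qed
  qed
  have "AE \<omega> in M. \<forall>j. \<forall>\<^sub>F n in sequentially. sup_visits \<omega> n / ereal (real n ^ a) \<le> ereal (L + 1 / real (Suc j))"
    unfolding AE_all_countable by (intro allI upper) simp
  moreover have "AE \<omega> in M. \<forall>j. infinite (tree N \<omega>) \<longrightarrow>
      (\<forall>\<^sub>F n in sequentially. ereal (L - L / real (j + 2)) \<le> sup_visits \<omega> n / ereal (real n ^ a))"
    unfolding AE_all_countable
  proof (intro allI lower)
    fix j :: nat
    show "0 < L - L / real (j + 2)" "L - L / real (j + 2) < L" using L by (auto simp: divide_less_eq)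
  qed
  ultimately show ?thesis
  proof eventually_elim
    case (elim \<omega>)
    show ?case
      unfolding L_def[symmetric]
    proof
      assume inf: "infinite (tree N \<omega>)"
      show "(\<lambda>n. sup_visits \<omega> n / ereal (real n ^ a)) \<longlonglongrightarrow> ereal L"
        by (rule ereal_tendsto_of_bounds[where P = "\<lambda>c. (\<exists>j. c = L + 1 / real (Suc j)) \<or> (\<exists>j. c = L - L / real (j + 2))"])
          (use elim inf L in \<open>auto simp: divide_less_eq not_less[symmetric] dest: spec\<close>)
    qed
  qed
qed

lemma AE_survival_limit:
  assumes "1 < emeasure (intensity M N X) UNIV" "0 < a" "0 < \<kappa>"
    and "(\<lambda>m. (- ln (ret m)) ^ a / real m) \<longlonglongrightarrow> \<kappa>"
  shows "AE \<omega> in uniform_measure M (survival M N).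
    (\<lambda>n. sup_visits \<omega> n / ereal (real n ^ a)) \<longlonglongrightarrow> ereal (t ^ a / \<kappa>)"
  by (rule AE_uniform_measureI[OF survival_measurable])
    (use sup_visits_limit[OF assms] in \<open>eventually_elim, auto simp: survival_def\<close>)

end

lemma (in lattice_law) mean_pos_le_1: "mean_pos \<le> 1"
proof -
  have "mean_pos \<le> (\<integral>\<^sup>+x. 1 \<partial>\<nu>)"
    by (rule nn_integral_mono_AE) (use down_inverse in \<open>eventually_elim, auto intro: ennreal_le_1[THEN iffD2]\<close>)
  then show ?thesis by (simp add: emeasure_space_1)
qed

context branching_random_walk begin

context
  fixes t :: real
  assumes t: "0 < t" and log_laplace: "log_laplace (intensity M N X) t = 0"
    and support: "emeasure (intensity M N X) (UNIV - (real_of_int ` {..0} \<union> {1})) = 0"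
begin

lemma lattice_law_intensity: "lattice_law (tilted_law (intensity M N X) t)"
  by (rule lattice_law_tilted[OF log_laplace_eq_0[OF log_laplace] support])

lemma tilted_mean_pos_finite: "tilted_mean_pos (intensity M N X) t < \<infinity>"
  using lattice_law.mean_pos_le_1[OF lattice_law_intensity]
  by (simp add: tilted_mean_pos_eq) (metis ennreal_one_less_top le_less_trans)

text \<open>The negative half-line has positive mass for the intensity, and the positive exponential
  weight carries this over to the tilted law.\<close>

lemma H1'_means:
  assumes "H1' (intensity M N X) t"
  shows "0 < tilted_mean_neg (intensity M N X) t"
    and "tilted_mean_neg (intensity M N X) t < tilted_mean_pos (intensity M N X) t"
proof -
  let ?\<mu> = "intensity M N X"
  obtain p where p: "tilted_mean_pos ?\<mu> t = ennreal p" "0 \<le> p"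
    using tilted_mean_pos_finite by (cases "tilted_mean_pos ?\<mu> t") auto
  have "0 < tilted_mean ?\<mu> t" using assms by (simp add: H1'_def)
  then show "tilted_mean_neg ?\<mu> t < tilted_mean_pos ?\<mu> t"
    using p unfolding tilted_mean_def
    by (cases "tilted_mean_neg ?\<mu> t") (auto simp: enn2ereal_ennreal ennreal_less_iff)
  show "0 < tilted_mean_neg ?\<mu> t"
  proof (rule ccontr)
    assume "\<not> 0 < tilted_mean_neg ?\<mu> t"
    then have "(\<integral>\<^sup>+x. ennreal (- x) \<partial>tilted_law ?\<mu> t) = 0"
      by (simp add: tilted_mean_neg_eq)
    then have "(\<integral>\<^sup>+x. ennreal (exp (- t * x)) * ennreal (- x) \<partial>?\<mu>) = 0"
      by (subst (asm) nn_integral_tilted_law) auto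
    then have "AE x in ?\<mu>. ennreal (exp (- t * x)) * ennreal (- x) = 0"
      by (subst (asm) nn_integral_0_iff_AE) auto
    then have "AE x in ?\<mu>. x \<notin> {..<0}"
      by eventually_elim (auto simp: ennreal_eq_0_iff)
    then have "{..<0} \<in> null_sets ?\<mu>"
      by (subst AE_iff_null_sets) auto
    then have "emeasure ?\<mu> {..<0} = 0" by auto
    then show False using assms by (simp add: H1'_def)
  qed
qed

text \<open>At mean 0 the absence of a negative part would remove the positive part as well, and the
  second moment would vanish.\<close>

lemma H2_means:
  assumes "H2 (intensity M N X) t"
  shows "0 < tilted_mean_neg (intensity M N X) t"
    and "tilted_mean_neg (intensity M N X) t = tilted_mean_pos (intensity M N X) t"
    and "(\<integral>\<^sup>+x. ennreal (x\<^sup>2) \<partial>tilted_law (intensity M N X) t) < \<infinity>"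
proof -
  let ?\<mu> = "intensity M N X"
  obtain p where p: "tilted_mean_pos ?\<mu> t = ennreal p" "0 \<le> p"
    using tilted_mean_pos_finite by (cases "tilted_mean_pos ?\<mu> t") auto
  have "tilted_mean ?\<mu> t = 0" using assms by (simp add: H2_def)
  then show eq: "tilted_mean_neg ?\<mu> t = tilted_mean_pos ?\<mu> t"
    using p unfolding tilted_mean_def
    by (cases "tilted_mean_neg ?\<mu> t") (auto simp: enn2ereal_ennreal zero_ereal_def)
  have "(\<integral>\<^sup>+x. ennreal (x\<^sup>2) \<partial>tilted_law ?\<mu> t) = (\<integral>\<^sup>+x. ennreal (exp (- t * x)) * ennreal (x\<^sup>2) \<partial>?\<mu>)"
    by (rule nn_integral_tilted_law) auto
  also have "\<dots> = (\<integral>\<^sup>+x. ennreal (x\<^sup>2 * exp (- t * x)) \<partial>?\<mu>)"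
    by (intro nn_integral_cong) (simp add: ennreal_mult mult.commute)
  finally have sq: "(\<integral>\<^sup>+x. ennreal (x\<^sup>2) \<partial>tilted_law ?\<mu> t) = (\<integral>\<^sup>+x. ennreal (x\<^sup>2 * exp (- t * x)) \<partial>?\<mu>)" .
  then show "(\<integral>\<^sup>+x. ennreal (x\<^sup>2) \<partial>tilted_law ?\<mu> t) < \<infinity>" using assms by (simp add: H2_def)
  show "0 < tilted_mean_neg ?\<mu> t"
  proof (rule ccontr)
    assume "\<not> 0 < tilted_mean_neg ?\<mu> t"
    then have "(\<integral>\<^sup>+x. ennreal (- x) \<partial>tilted_law ?\<mu> t) = 0" "(\<integral>\<^sup>+x. ennreal x \<partial>tilted_law ?\<mu> t) = 0"
      using eq by (simp_all add: tilted_mean_neg_eq tilted_mean_pos_eq)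
    then have "AE x in tilted_law ?\<mu> t. ennreal (- x) = 0" "AE x in tilted_law ?\<mu> t. ennreal x = 0"
      by (subst (asm) (1 2) nn_integral_0_iff_AE, auto simp: measurable_cong_sets[OF sets_tilted_law refl])+
    then have "AE x in tilted_law ?\<mu> t. ennreal (x\<^sup>2) = 0"
      by eventually_elim (auto simp: ennreal_eq_0_iff)
    then have "(\<integral>\<^sup>+x. ennreal (x\<^sup>2) \<partial>tilted_law ?\<mu> t) = (\<integral>\<^sup>+x. 0 \<partial>tilted_law ?\<mu> t)"
      by (rule nn_integral_cong_AE)
    then show False using assms sq by (simp add: H2_def)
  qed
qed

end

end

theorem theorem1p6:
  fixes M :: "'a measure"
    and N :: "nat list \<Rightarrow> 'a \<Rightarrow> enat"
    and X :: "nat list \<Rightarrow> nat \<Rightarrow> 'a \<Rightarrow> real"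
    and \<mu> :: "real measure"
    and t\<^sub>0 :: real
    and P :: "'b measure"
    and S :: "nat \<Rightarrow> 'b \<Rightarrow> real"
  assumes brw: "branching_random_walk M N X"
    and intensity: "\<mu> = intensity M N X"
    and supercritical: "emeasure \<mu> UNIV > 1"
    and hyp: "H1' \<mu> t\<^sub>0 \<or> H2 \<mu> t\<^sub>0"
    and support: "emeasure \<mu> (UNIV - (real_of_int ` {..0} \<union> {1})) = 0"
    and second_moment:
      "(\<integral>\<^sup>+\<omega>. (\<Sum>\<^sub>\<infinity>(u, v) \<in> {(u, v). u \<in> generation N \<omega> 1 \<and> v \<in> generation N \<omega> 1 \<and> u \<noteq> v}.
          ennreal (exp (- t\<^sub>0 * position X \<omega> u) * exp (- t\<^sub>0 * position X \<omega> v))) \<partial>M) < \<infinity>"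
    and walk: "random_walk P (tilted_law \<mu> t\<^sub>0) S"
  shows "(H1' \<mu> t\<^sub>0 \<longrightarrow>
           (let q = measure P {\<omega> \<in> space P. return_time S \<omega> < \<infinity>} in
             0 < q \<and> q < 1 \<and>
             (AE \<omega> in uniform_measure M (survival M N).
               (\<lambda>n. (SUP \<xi>\<in>rays (tree N \<omega>). visits (position X \<omega>) \<xi> n) / ereal (real n))
                 \<longlonglongrightarrow> ereal (- t\<^sub>0 / ln q)))) \<and>
         (H2 \<mu> t\<^sub>0 \<longrightarrow>
           (\<exists>\<theta>>0.
             (\<lambda>n. measure P {\<omega> \<in> space P. excursion_min S \<omega> \<le> ereal (- real n)})
               \<sim>[at_top] (\<lambda>n. \<theta> / real n) \<and>
             (AE \<omega> in uniform_measure M (survival M N).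
               (\<lambda>n. (SUP \<xi>\<in>rays (tree N \<omega>). visits (position X \<omega>) \<xi> n) / ereal ((real n)\<^sup>2))
                 \<longlonglongrightarrow> ereal (t\<^sub>0 / (2 * \<theta>)))))"
proof -
  interpret brw: branching_random_walk M N X by fact
  note lattice = support[unfolded intensity]
  have super: "1 < emeasure (Defs.intensity M N X) UNIV"
    using supercritical intensity by simp
  show ?thesis
  proof (intro conjI impI)
    assume H1': "H1' \<mu> t\<^sub>0"
    then have t: "0 < t\<^sub>0" "log_laplace (Defs.intensity M N X) t\<^sub>0 = 0"
      by (auto simp: H1'_def intensity)
    note means = brw.H1'_means[OF t lattice H1'[unfolded intensity]]
    interpret lattice_brw M N X t\<^sub>0
      by (intro lattice_brw.intro lattice_brw_axioms.intro brw t log_laplace_eq_0 lattice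
          second_moment means less_imp_le)
    interpret lattice_walk P "tilted_law (Defs.intensity M N X) t\<^sub>0" S
      by (intro lattice_walk.intro law.lattice_law_axioms walk_D walk[unfolded intensity])
    have drift: "measure_pmf.expectation (down_pmf (tilted_law (Defs.intensity M N X) t\<^sub>0)) real < 1"
      using drift_iff means by simp
    obtain u where u: "(\<lambda>n. U (int n)) \<longlonglongrightarrow> u" using U_tendsto_of_drift[OF drift] by auto
    define q where "q = measure P {\<omega> \<in> space P. return_time S \<omega> < \<infinity>}"
    have q: "q = 1 - pmf law.D 0 / u"
      unfolding q_def return_time_prob by (rule return_prob[OF u])
    have "1 \<le> u" by (rule U_le_lim(2)[OF u])
    then have "pmf law.D 0 / u \<le> pmf law.D 0" "0 < pmf law.D 0 / u"
      using up by (simp_all add: divide_le_eq mult_left_le)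
    then have q01: "0 < q" "q < 1" using up_lt_1 by (auto simp: q)
    have "AE \<omega> in uniform_measure M (survival M N).
        (\<lambda>n. sup_visits \<omega> n / ereal (real n ^ 1)) \<longlonglongrightarrow> ereal (t\<^sub>0 ^ 1 / - ln q)"
      using log_ret_drift[OF u up_lt_1 q] q01
      by (intro AE_survival_limit super) auto
    then show "let q = measure P {\<omega> \<in> space P. return_time S \<omega> < \<infinity>} in
        0 < q \<and> q < 1 \<and>
        (AE \<omega> in uniform_measure M (survival M N).
          (\<lambda>n. (SUP \<xi>\<in>rays (tree N \<omega>). visits (position X \<omega>) \<xi> n) / ereal (real n))
            \<longlonglongrightarrow> ereal (- t\<^sub>0 / ln q))"
      unfolding q_def[symmetric] Let_def using q01 by simp
  next
    assume H2: "H2 \<mu> t\<^sub>0"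
    then have t: "0 < t\<^sub>0" "log_laplace (Defs.intensity M N X) t\<^sub>0 = 0"
      by (auto simp: H2_def intensity)
    note means = brw.H2_means[OF t lattice H2[unfolded intensity]]
    interpret lattice_brw M N X t\<^sub>0
      by (intro lattice_brw.intro lattice_brw_axioms.intro brw t log_laplace_eq_0 lattice
          second_moment means eq_refl)
    interpret lattice_walk P "tilted_law (Defs.intensity M N X) t\<^sub>0" S
      by (intro lattice_walk.intro law.lattice_law_axioms walk_D walk[unfolded intensity])
    have crit: "measure_pmf.expectation law.D real = 1"
      using drift_iff means drift by simp
    note U = U_critical[OF crit law.square_integrable_D[OF means(3)] up_lt_1]
    obtain m where m: "0 < m" "(\<lambda>n. real n / U (int n)) \<longlonglongrightarrow> m" using U(1) by auto
    \<comment> \<open>The probability that the excursion reaches - n is pmf D 0 / U n by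
      \<open>reach_below\<close>; multiplied by n it tends to pmf D 0 * m.\<close>
    define \<theta> where "\<theta> = pmf law.D 0 * m"
    have \<theta>: "0 < \<theta>" using m up by (simp add: \<theta>_def)
    have ex: "measure P {\<omega> \<in> space P. excursion_min S \<omega> \<le> ereal (- real n)} = pmf law.D 0 / U (int n)" if "0 < n" for n
      using excursion_min_prob[OF that] reach_below[OF U(2) that] by simp
    have "(\<lambda>n. measure P {\<omega> \<in> space P. excursion_min S \<omega> \<le> ereal (- real n)}) \<sim>[at_top] (\<lambda>n. \<theta> / real n)"
    proof (rule asymp_equivI')
      have "(\<lambda>n. (real n / U (int n)) / m) \<longlonglongrightarrow> m / m" using m by (intro tendsto_intros) auto
      moreover have "\<forall>\<^sub>F n in sequentially. (real n / U (int n)) / m =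
          measure P {\<omega> \<in> space P. excursion_min S \<omega> \<le> ereal (- real n)} / (\<theta> / real n)"
        using eventually_gt_at_top[of 0]
        by eventually_elim (use up in \<open>simp add: ex \<theta>_def\<close>)
      ultimately show "(\<lambda>n. measure P {\<omega> \<in> space P. excursion_min S \<omega> \<le> ereal (- real n)} / (\<theta> / real n)) \<longlonglongrightarrow> 1"
        using m by (simp add: tendsto_cong)
    qed
    moreover have "AE \<omega> in uniform_measure M (survival M N).
        (\<lambda>n. sup_visits \<omega> n / ereal (real n ^ 2)) \<longlonglongrightarrow> ereal (t\<^sub>0 ^ 2 / (2 * (pmf law.D 0 * m * t\<^sub>0)))"
      using log_ret_critical[OF m(2,1) U(2) up_lt_1] m up t
      by (intro AE_survival_limit super) auto
    \<comment> \<open>\<open>log_ret_critical\<close> supplies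
      \<open>\<kappa> = 2 * \<theta> * t\<^sub>0\<close>, which turns
      \<open>t\<^sub>0 ^ 2 / \<kappa>\<close> into the constant of the theorem.\<close>
    moreover have "t\<^sub>0 ^ 2 / (2 * (pmf law.D 0 * m * t\<^sub>0)) = t\<^sub>0 / (2 * \<theta>)"
      using t by (simp add: \<theta>_def power2_eq_square)
    ultimately show "\<exists>\<theta>>0.
        (\<lambda>n. measure P {\<omega> \<in> space P. excursion_min S \<omega> \<le> ereal (- real n)})
          \<sim>[at_top] (\<lambda>n. \<theta> / real n) \<and>
        (AE \<omega> in uniform_measure M (survival M N).
          (\<lambda>n. (SUP \<xi>\<in>rays (tree N \<omega>). visits (position X \<omega>) \<xi> n) / ereal ((real n)\<^sup>2))
            \<longlonglongrightarrow> ereal (t\<^sub>0 / (2 * \<theta>)))"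
      using \<theta> by auto
  qed
qed

end
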